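(* In the setting of the context, assume every irreducible $T$-module is thin. Then there exists a unique $\mathbf{C}\in T$ such that $$\mathbf{A}+\frac{q\mathbf{B}\mathbf{C}-q^{-1}\mathbf{C}\mathbf{B}}{q^2-q^{-2}}=\frac{(\mathbf{a}+\mathbf{a}^{-1})(\Lambda+\Lambda^{-1})+(\mathbf{b}+\mathbf{b}^{-1})(\mathbf{c}+\mathbf{c}^{-1})}{q+q^{-1}},$$ $$\mathbf{B}+\frac{q\mathbf{C}\mathbf{A}-q^{-1}\mathbf{A}\mathbf{C}}{q^2-q^{-2}}=\frac{(\mathbf{b}+\mathbf{b}^{-1})(\Lambda+\Lambda^{-1})+(\mathbf{c}+\mathbf{c}^{-1})(\mathbf{a}+\mathbf{a}^{-1})}{q+q^{-1}},$$ $$\mathbf{C}+\frac{q\mathbf{A}\mathbf{B}-q^{-1}\mathbf{B}\mathbf{A}}{q^2-q^{-2}}=\frac{(\mathbf{c}+\mathbf{c}^{-1})(\Lambda+\Lambda^{-1})+(\mathbf{a}+\mathbf{a}^{-1})(\mathbf{b}+\mathbf{b}^{-1})}{q+q^{-1}}.$$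
   Context: Fix a nonzero $q\in\mathbb{C}$ with $q^4\neq1$. Let $\Gamma$ be a finite connected distance-regular graph (undirected, no loops or multiple edges) with vertex set $X$, distance $\partial$, diameter $D\ge3$; $V=\mathbb{C}^X$. $A$ is the adjacency matrix, $E_0,\dots,E_D$ the primitive idempotents of the Bose–Mesner algebra with $E_0=|X|^{-1}J$ and $E_1,\dots,E_D$ a $Q$-polynomial ordering; $A=\sum\theta_iE_i$. Fix a vertex $x$; $E_i^*$ is the diagonal $0/1$ matrix projecting onto vertices at distance $i$ from $x$; $A^*$ is diagonal with $(y,y)$-entry $|X|(E_1)_{xy}$, $A^*=\sum\theta_i^*E_i^*$; $T$ is the algebra generated by $A,A^*$. Assume $q$-Racah type: $\theta_i=w+uq^{2i-D}+vq^{D-2i}$, $\theta_i^*=w^*+u^*q^{2i-D}+v^*q^{D-2i}$, $u,u^*,v,v^*\neq0$; fix $a,b$ with $a^2=u/v$, $b^2=u^*/v^*$; $\mathbf{A}=(A-wI)/(av)$, $\mathbf{B}=(A^*-w^*I)/(bv^* )$. For an irreducible $T$-module $W\subseteq V$: endpoint $\rho=\min\{i:E_i^*W\ne0\}$, dual endpoint $\tau=\min\{i:E_iW\neq0\}$, diameter $d=|\{i:E^*_iW\ne0\}|-1$; thin means $\dim E^*_iW\le1$ for all $i$. Put $a(W)=aq^{2\tau+d-D}$, $b(W)=bq^{2\rho+d-D}$. If $W$ is thin, $(\mathbf{A}|_W,\{E_{\tau+i}|_W\}_{i=0}^d,\mathbf{B}|_W,\{E^*_{\rho+i}|_W\}_{i=0}^d)$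 is a Leonard system with eigenvalues $\vartheta_i=a(W)q^{2i-d}+a(W)^{-1}q^{d-2i}$ and dual eigenvalues $\vartheta^*_i=b(W)q^{2i-d}+b(W)^{-1}q^{d-2i}$; let $\kappa=0$ if $d=0$ and, for $d\ge1$, $\kappa=a(W)b(W)^{-1}q^{d-1}+a(W)^{-1}b(W)q^{1-d}+\phi_1/((q-q^{-1})(q^d-q^{-d}))$ where $\phi_1=(\vartheta^*_0-\vartheta^*_1)(\mathrm{trace}(E^*_\rho\mathbf{A}|_W)-\vartheta_d)$; $c(W)$ is a root of $\xi^2-\kappa\xi+1=0$ (defined up to reciprocal). Isomorphism of irreducible modules: linear bijection commuting with $T$; $\Psi$ = set of types; for $\psi\in\Psi$, $a(\psi),b(\psi),d(\psi),c(\psi)$ are $a(W),b(W)$, the diameter, and (a fixed choice of) $c(W)$ for $W$ of type $\psi$. $V_\psi$ = span of irreducible modules of type $\psi$, $V=\bigoplus_\psi V_\psi$, $e_\psi$ = identity on $V_\psi$, $0$ on other $V_\lambda$. Define $\mathbf{a}=\sum_\psi a(\psi)e_\psi$, $\mathbf{b}=\sum_\psi b(\psi)e_\psi$, $\mathbf{c}=\sum_\psi c(\psi)e_\psi$, $\Lambda=\sum_\psi q^{d(\psi)+1}e_\psi$ (these are invertible). *)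

theory Defs
  imports "HOL-Analysis.Analysis"
begin

type_synonym 'v cmat = "complex^'v^'v"
type_synonym 'v cvec = "complex^'v"

section \<open>Matrix helpers\<close>

definition cmult :: "complex \<Rightarrow> 'v::finite cmat \<Rightarrow> 'v cmat" where
  "cmult c M = (\<chi> i j. c * M $ i $ j)"

definition schur :: "'v::finite cmat \<Rightarrow> 'v cmat \<Rightarrow> 'v cmat" where
  "schur M N = (\<chi> i j. M $ i $ j * N $ i $ j)"

definition allones :: "'v::finite cmat" where
  "allones = (\<chi> i j. 1)"

definition mpow :: "'v::finite cmat \<Rightarrow> nat \<Rightarrow> 'v cmat" where
  "mpow M k = (((**) M) ^^ k) (mat 1)"

text \<open>Complex linear span of a set of matrices (finite linear combinations).\<close>
definition mspan :: "'v::finite cmat set \<Rightarrow> 'v cmat set" where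
  "mspan S = {M. \<exists>(n::nat) c W. (\<forall>k<n. W k \<in> S) \<and> M = (\<Sum>k<n. cmult (c k) (W k))}"

text \<open>Product of a list of matrices (empty product = identity).\<close>
definition mprod :: "'v::finite cmat list \<Rightarrow> 'v cmat" where
  "mprod ws = foldr (**) ws (mat 1)"

text \<open>Subalgebra (with identity) generated by a set of matrices.\<close>
definition gen_alg :: "'v::finite cmat set \<Rightarrow> 'v cmat set" where
  "gen_alg S = mspan {mprod ws | ws. set ws \<subseteq> S}"

section \<open>Graphs\<close>

definition walk_rel :: "('v \<Rightarrow> 'v \<Rightarrow> bool) \<Rightarrow> ('v \<times> 'v) set" where
  "walk_rel Adj = {(x, y). Adj x y}"

definition gdist :: "('v \<Rightarrow> 'v \<Rightarrow> bool) \<Rightarrow> 'v \<Rightarrow> 'v \<Rightarrow> nat" where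
  "gdist Adj x y = (LEAST n. (x, y) \<in> walk_rel Adj ^^ n)"

definition connected_graph :: "('v \<Rightarrow> 'v \<Rightarrow> bool) \<Rightarrow> bool" where
  "connected_graph Adj \<longleftrightarrow> (\<forall>x y. \<exists>n. (x, y) \<in> walk_rel Adj ^^ n)"

definition simple_graph :: "('v \<Rightarrow> 'v \<Rightarrow> bool) \<Rightarrow> bool" where
  "simple_graph Adj \<longleftrightarrow> (\<forall>x y. Adj x y \<longrightarrow> Adj y x) \<and> (\<forall>x. \<not> Adj x x)"

definition diameter :: "('v::finite \<Rightarrow> 'v \<Rightarrow> bool) \<Rightarrow> nat" where
  "diameter Adj = Max {gdist Adj x y | x y. True}"

definition distance_regular :: "('v::finite \<Rightarrow> 'v \<Rightarrow> bool) \<Rightarrow> bool" where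
  "distance_regular Adj \<longleftrightarrow> simple_graph Adj \<and> connected_graph Adj \<and>
     (\<forall>i j x y x' y'. gdist Adj x y = gdist Adj x' y' \<longrightarrow>
        card {z. gdist Adj x z = i \<and> gdist Adj y z = j} =
        card {z. gdist Adj x' z = i \<and> gdist Adj y' z = j})"

definition adj_mat :: "('v::finite \<Rightarrow> 'v \<Rightarrow> bool) \<Rightarrow> 'v cmat" where
  "adj_mat Adj = (\<chi> i j. if Adj i j then 1 else 0)"

text \<open>Bose--Mesner algebra: the algebra generated by the adjacency matrix.\<close>
definition bose_mesner :: "('v::finite \<Rightarrow> 'v \<Rightarrow> bool) \<Rightarrow> 'v cmat set" where
  "bose_mesner Adj = gen_alg {adj_mat Adj}"

definition idempotent_in :: "'v::finite cmat set \<Rightarrow> 'v cmat \<Rightarrow> bool" where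
  "idempotent_in M E \<longleftrightarrow> E \<in> M \<and> E ** E = E \<and> E \<noteq> 0"

text \<open>Primitive idempotent: nonzero idempotent which is not a sum of two orthogonal
  nonzero idempotents of the algebra.\<close>
definition primitive_idempotent :: "'v::finite cmat set \<Rightarrow> 'v cmat \<Rightarrow> bool" where
  "primitive_idempotent M E \<longleftrightarrow> idempotent_in M E \<and>
     \<not> (\<exists>F G. idempotent_in M F \<and> idempotent_in M G \<and> F ** G = 0 \<and> G ** F = 0 \<and> E = F + G)"

text \<open>Q-polynomial ordering of the primitive idempotents E 0, ..., E D via Krein parameters.\<close>
definition Q_polynomial :: "nat \<Rightarrow> (nat \<Rightarrow> 'v::finite cmat) \<Rightarrow> bool" where
  "Q_polynomial D E \<longleftrightarrow> (\<exists>kr :: nat \<Rightarrow> nat \<Rightarrow> nat \<Rightarrow> complex.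
     (\<forall>i\<le>D. \<forall>j\<le>D. schur (E i) (E j) =
         cmult (1 / of_nat CARD('v)) (\<Sum>h\<le>D. cmult (kr h i j) (E h))) \<and>
     (\<forall>h\<le>D. \<forall>i\<le>D. \<forall>j\<le>D.
         ((h > i + j \<or> i > h + j \<or> j > h + i) \<longrightarrow> kr h i j = 0) \<and>
         ((h = i + j \<or> i = h + j \<or> j = h + i) \<longrightarrow> kr h i j \<noteq> 0)))"

text \<open>Dual idempotents with respect to base vertex x, and the dual adjacency matrix.\<close>
definition dual_idem :: "('v::finite \<Rightarrow> 'v \<Rightarrow> bool) \<Rightarrow> 'v \<Rightarrow> nat \<Rightarrow> 'v cmat" where
  "dual_idem Adj x i = (\<chi> y z. if y = z \<and> gdist Adj x y = i then 1 else 0)"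

definition dual_adj :: "'v::finite cmat \<Rightarrow> 'v \<Rightarrow> 'v cmat" where
  "dual_adj E1 x = (\<chi> y z. if y = z then of_nat CARD('v) * E1 $ x $ y else 0)"

section \<open>Modules of a matrix algebra T acting on V = C^X\<close>

definition tmodule :: "'v::finite cmat set \<Rightarrow> 'v cvec set \<Rightarrow> bool" where
  "tmodule T W \<longleftrightarrow> vec.subspace W \<and> (\<forall>M\<in>T. \<forall>v\<in>W. M *v v \<in> W)"

definition irred_module :: "'v::finite cmat set \<Rightarrow> 'v cvec set \<Rightarrow> bool" where
  "irred_module T W \<longleftrightarrow> tmodule T W \<and> W \<noteq> {0} \<and>
     (\<forall>U. tmodule T U \<and> U \<subseteq> W \<longrightarrow> U = {0} \<or> U = W)"

definition mod_iso :: "'v::finite cmat set \<Rightarrow> 'v cvec set \<Rightarrow> 'v cvec set \<Rightarrow> bool" where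
  "mod_iso T W W' \<longleftrightarrow> (\<exists>f. Vector_Spaces.linear ((*s)) ((*s)) f \<and> bij_betw f W W' \<and>
     (\<forall>M\<in>T. \<forall>v\<in>W. f (M *v v) = M *v f v))"

definition img :: "'v::finite cmat \<Rightarrow> 'v cvec set \<Rightarrow> 'v cvec set" where
  "img M W = (\<lambda>v. M *v v) ` W"

definition thin :: "(nat \<Rightarrow> 'v::finite cmat) \<Rightarrow> 'v cvec set \<Rightarrow> bool" where
  "thin Es W \<longleftrightarrow> (\<forall>i. vec.dim (img (Es i) W) \<le> 1)"

definition endpoint :: "(nat \<Rightarrow> 'v::finite cmat) \<Rightarrow> 'v cvec set \<Rightarrow> nat" where
  "endpoint Es W = (LEAST i. img (Es i) W \<noteq> {0})"

definition dual_endpoint :: "nat \<Rightarrow> (nat \<Rightarrow> 'v::finite cmat) \<Rightarrow> 'v cvec set \<Rightarrow> nat" where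
  "dual_endpoint D E W = (LEAST i. i \<le> D \<and> img (E i) W \<noteq> {0})"

definition mod_diam :: "(nat \<Rightarrow> 'v::finite cmat) \<Rightarrow> 'v cvec set \<Rightarrow> nat" where
  "mod_diam Es W = card {i. img (Es i) W \<noteq> {0}} - 1"

text \<open>Trace of a linear map f restricted to an invariant subspace W (computed in a basis of W).\<close>
definition trace_on :: "'v::finite cvec set \<Rightarrow> ('v cvec \<Rightarrow> 'v cvec) \<Rightarrow> complex" where
  "trace_on W f = (SOME t. \<exists>B. finite B \<and> vec.independent B \<and> vec.span B = W \<and>
      t = (\<Sum>b\<in>B. vec.representation B (f b) b))"

section \<open>The parameters a(W), b(W), kappa(W)\<close>

definition aW :: "complex \<Rightarrow> complex \<Rightarrow> nat \<Rightarrow> nat \<Rightarrow> nat \<Rightarrow> complex" where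
  "aW q a D tau d = a * q powi (2 * int tau + int d - int D)"

definition bW :: "complex \<Rightarrow> complex \<Rightarrow> nat \<Rightarrow> nat \<Rightarrow> nat \<Rightarrow> complex" where
  "bW q b D rho d = b * q powi (2 * int rho + int d - int D)"

text \<open>Eigenvalue sequence theta_i = s q^(2i-d) + s^(-1) q^(d-2i) (used for both
  eigenvalues with s = a(W) and dual eigenvalues with s = b(W)).\<close>
definition lev :: "complex \<Rightarrow> complex \<Rightarrow> nat \<Rightarrow> nat \<Rightarrow> complex" where
  "lev q s d i = s * q powi (2 * int i - int d) + inverse s * q powi (int d - 2 * int i)"

text \<open>Parameters of the whole setting packaged as functions of a module W.
  Abold is the normalized adjacency matrix, E the primitive idempotents, Es the dual ones.\<close>
definition a_of :: "complex \<Rightarrow> complex \<Rightarrow> nat \<Rightarrow> (nat \<Rightarrow> 'v::finite cmat) \<Rightarrow> (nat \<Rightarrow> 'v cmat)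
    \<Rightarrow> 'v cvec set \<Rightarrow> complex" where
  "a_of q a D E Es W = aW q a D (dual_endpoint D E W) (mod_diam Es W)"

definition b_of :: "complex \<Rightarrow> complex \<Rightarrow> nat \<Rightarrow> (nat \<Rightarrow> 'v::finite cmat) \<Rightarrow> 'v cvec set \<Rightarrow> complex" where
  "b_of q b D Es W = bW q b D (endpoint Es W) (mod_diam Es W)"

definition kappa_of :: "complex \<Rightarrow> complex \<Rightarrow> complex \<Rightarrow> nat \<Rightarrow> 'v::finite cmat \<Rightarrow>
    (nat \<Rightarrow> 'v cmat) \<Rightarrow> (nat \<Rightarrow> 'v cmat) \<Rightarrow> 'v cvec set \<Rightarrow> complex" where
  "kappa_of q a b D Abold E Es W =
     (let d = mod_diam Es W; rho = endpoint Es W;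
          aa = a_of q a D E Es W; bb = b_of q b D Es W;
          phi1 = (lev q bb d 0 - lev q bb d 1) *
                 (trace_on W (\<lambda>v. (Es rho ** Abold) *v v) - lev q aa d d)
      in if d = 0 then 0
         else aa / bb * q ^ (d - 1) + bb / aa * q powi (1 - int d)
              + phi1 / ((q - inverse q) * (q ^ d - q powi (- int d))))"

section \<open>Isomorphism types and the central elements e_psi\<close>

definition iso_types :: "'v::finite cmat set \<Rightarrow> 'v cvec set set set" where
  "iso_types T = {{W'. irred_module T W' \<and> mod_iso T W W'} | W. irred_module T W}"

definition rep :: "'v::finite cvec set set \<Rightarrow> 'v cvec set" where
  "rep psi = (SOME W. W \<in> psi)"

definition Vtype :: "'v::finite cvec set set \<Rightarrow> 'v cvec set" where
  "Vtype psi = vec.span (\<Union> psi)"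

definition e_type :: "'v::finite cmat set \<Rightarrow> 'v cvec set set \<Rightarrow> 'v cmat" where
  "e_type T psi = (THE M. (\<forall>v\<in>Vtype psi. M *v v = v) \<and>
      (\<forall>lam\<in>iso_types T. lam \<noteq> psi \<longrightarrow> (\<forall>v\<in>Vtype lam. M *v v = 0)))"

definition type_sum :: "'v::finite cmat set \<Rightarrow> ('v cvec set set \<Rightarrow> complex) \<Rightarrow> 'v cmat" where
  "type_sum T f = (\<Sum>psi\<in>iso_types T. cmult (f psi) (e_type T psi))"

end

theory Submission
  imports Defs
begin

text \<open>The third equation forces \<open>C\<close>, so only existence matters. The algebra \<open>T\<close> is closed under adjoints,
  hence semisimple, non-isomorphic irreducible modules are orthogonal, and the \<open>e\<^sub>\<psi>\<close> are the orthogonal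
  projections onto the homogeneous components; they lie in \<open>T\<close> by the double commutant theorem. It
  remains to verify the first two equations on one irreducible module \<open>W\<close> of each type, where they
  become the Askey-Wilson relations
  \<open>X = A\<^sup>2B - \<beta>ABA + BA\<^sup>2 + \<rho>B = \<eta>A + \<mu>\<close> and \<open>Y = B\<^sup>2A - \<beta>BAB + AB\<^sup>2 + \<rho>A = \<eta>B + \<mu>'\<close>
  with \<open>\<beta> = q\<^sup>2 + q\<^sup>-\<^sup>2\<close> and \<open>\<rho> = (q\<^sup>2 - q\<^sup>-\<^sup>2)\<^sup>2\<close>.
  The form of the eigenvalues makes \<open>X\<close> commute with \<open>A\<close> and makes it tridiagonal with respect to the
  dual eigenspaces; as \<open>W\<close> is generated from \<open>E\<^sup>*\<^sub>\<rho>W\<close> by \<open>A\<close>, \<open>X\<close> is linear in \<open>A\<close>, and likewise for \<open>Y\<close>.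
  The two leading coefficients agree because \<open>[X, B] = [A, Y]\<close>. Finally \<open>\<eta>\<close>, \<open>\<mu>\<close>, \<open>\<mu>'\<close> are determined by the
  end diagonal entries of \<open>A\<close> and \<open>B\<close>, which are tied to \<open>\<kappa>\<close> by evaluating \<open>E\<^sub>\<tau>BAE\<^sup>*\<^sub>\<rho>\<close> in two ways.
  This avoids any division by \<open>q\<^sup>2\<^sup>d\<^sup>+\<^sup>2 - 1\<close>, which may vanish.\<close>

section \<open>Matrix algebras\<close>

text \<open>Since only q^4 = 1 is excluded, q may be another root of unity, and the formulas for the
  eigenvalues do not by themselves make them distinct. Distinctness comes from the graph: the E_i
  are primitive, and the row of E_1 at x separates the distances from x. The normalization by a and
  b turns both eigenvalue sequences into s q^(2i-D) + s^-1 q^(D-2i). A linear recurrence with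
  coefficient \<beta> for three consecutive terms and a quadratic relation with constant \<rho> for
  two consecutive ones are what the tridiagonality of X and its commutation with A rest on. The
  setting is kept symmetric under exchanging A with B and under reversing the order of the E_i; one
  computation at one end of a module therefore yields both corner equations needed to find the
  coefficients. The root c(\<psi>) enters only through c + c^-1 = \<kappa>, so the choice between it
  and its reciprocal has no effect.\<close>

lemma cmult_nth [simp]: "cmult c M $ i $ j = c * M $ i $ j"
  by (simp add: cmult_def)

lemma cmult_vec [simp]: "cmult c M *v x = c *s (M *v x)"
  by (simp add: vec_eq_iff matrix_vector_mult_def sum_distrib_left mult.assoc)

lemma mat_vec [simp]: "mat c *v x = c *s (x :: complex^'v::finite)"
  by (simp add: vec_eq_iff matrix_vector_mult_def mat_def if_distrib if_distribR cong: if_cong)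

lemma mat_vec_scale [simp]: "M *v (c *s x) = c *s (M *v (x :: complex^'v::finite))"
  by (simp add: vector_scalar_commute)

lemma sum_mat_vec: "sum f I *v x = (\<Sum>i\<in>I. f i *v (x :: complex^'v::finite))"
  by (induction I rule: infinite_finite_induct) (auto simp: matrix_vector_mult_add_rdistrib)

lemma mat_vec_sum: "M *v sum f I = (\<Sum>i\<in>I. M *v (f i :: complex^'v::finite))"
  by (induction I rule: infinite_finite_induct) (auto simp: matrix_vector_right_distrib)

lemma mul_vec [simp]: "(M ** N) *v x = M *v (N *v (x :: complex^'v::finite))"
  by (simp add: matrix_vector_mul_assoc)

lemma cmult_mul [simp]: "cmult c M ** N = cmult c (M ** N)" "M ** cmult c N = cmult c (M ** N)"
  by (simp_all add: matrix_eq)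

lemma cmult_cmult [simp]: "cmult c (cmult d M) = cmult (c * d) M"
  by (simp add: vec_eq_iff mult.assoc)

lemma cmult_add: "cmult c (M + N) = cmult c M + cmult c N"
  by (simp add: vec_eq_iff distrib_left)

lemma cmult_one [simp]: "cmult 1 M = M" and cmult_zero [simp]: "cmult 0 M = 0" "cmult c 0 = 0"
  by (simp_all add: vec_eq_iff)

lemma cmult_sum: "cmult c (sum f I) = (\<Sum>i\<in>I. cmult c (f i))"
  by (induction I rule: infinite_finite_induct) (auto simp: cmult_add)

lemma sum_mat_mul: "sum f I ** M = (\<Sum>i\<in>I. f i ** (M :: 'v::finite cmat))"
  by (simp add: matrix_eq sum_mat_vec)

lemma mat_mul_sum: "M ** sum f I = (\<Sum>i\<in>I. M ** (f i :: 'v::finite cmat))"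
  by (simp add: matrix_eq sum_mat_vec mat_vec_sum)

definition subalg :: "'v::finite cmat set \<Rightarrow> bool" where
  "subalg T \<longleftrightarrow> mat 1 \<in> T \<and> (\<forall>M\<in>T. \<forall>N\<in>T. M + N \<in> T \<and> M ** N \<in> T) \<and> (\<forall>c. \<forall>M\<in>T. cmult c M \<in> T)"

lemma subalgD:
  assumes "subalg T"
  shows "mat 1 \<in> T" "M \<in> T \<Longrightarrow> N \<in> T \<Longrightarrow> M + N \<in> T" "M \<in> T \<Longrightarrow> N \<in> T \<Longrightarrow> M ** N \<in> T"
    "M \<in> T \<Longrightarrow> cmult c M \<in> T"
  using assms by (auto simp: subalg_def)

lemma subalg_zero: "subalg T \<Longrightarrow> 0 \<in> T"
  using subalgD(1)[of T] subalgD(4)[of T "mat 1" 0] by simp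

lemma subalg_diff: "subalg T \<Longrightarrow> M \<in> T \<Longrightarrow> N \<in> T \<Longrightarrow> M - N \<in> T"
proof -
  assume a: "subalg T" "M \<in> T" "N \<in> T"
  have "M - N = M + cmult (-1) N" by (simp add: vec_eq_iff)
  then show ?thesis using a by (metis subalgD(2,4))
qed

lemma subalg_sum: "subalg T \<Longrightarrow> (\<And>i. i \<in> I \<Longrightarrow> f i \<in> T) \<Longrightarrow> sum f I \<in> T"
  by (induction I rule: infinite_finite_induct) (auto simp: subalg_zero subalgD)

lemma subalg_mat: "subalg T \<Longrightarrow> mat c \<in> T"
proof -
  assume a: "subalg T"
  have "mat c = cmult c (mat 1)" by (simp add: vec_eq_iff mat_def)
  then show ?thesis using a by (metis subalgD(1,4))
qed

lemma mprod_append: "mprod (us @ ws) = mprod us ** mprod ws"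
  by (induction us) (auto simp: mprod_def matrix_mul_assoc)

lemma mprod_in: "subalg T \<Longrightarrow> set ws \<subseteq> T \<Longrightarrow> mprod ws \<in> T"
  by (induction ws) (auto simp: mprod_def subalgD)

text \<open>Spares the explicit words: a property of the generated algebra follows once the matrices
  enjoying it form a subalgebra that contains the generators.\<close>

lemma gen_alg_induct [consumes 1]:
  assumes "M \<in> gen_alg S" "subalg T" "S \<subseteq> T"
  shows "M \<in> T"
proof -
  obtain n :: nat and c W where *: "\<forall>k<n. W k \<in> {mprod ws | ws. set ws \<subseteq> S}" "M = (\<Sum>k<n. cmult (c k) (W k))"
    using assms(1) by (auto simp: gen_alg_def mspan_def)
  have "cmult (c k) (W k) \<in> T" if "k < n" for k
    using *(1) that assms(2,3) mprod_in[OF assms(2)] by (fastforce simp: subalgD)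
  then show ?thesis unfolding *(2) by (intro subalg_sum assms) auto
qed

text \<open>\<open>mspan\<close> indexes its combinations by an initial segment of the naturals.
  Enumerating an arbitrary finite set lets disjoint sums and pairs index the sums and products
  below.\<close>

lemma mspan_sum:
  assumes "finite I" "\<And>i. i \<in> I \<Longrightarrow> f i \<in> S"
  shows "(\<Sum>i\<in>I. cmult (c i) (f i)) \<in> mspan S"
proof -
  obtain h where h: "bij_betw h {..<card I} I"
    using ex_bij_betw_nat_finite[OF assms(1)] atLeast0LessThan by metis
  have "(\<Sum>i\<in>I. cmult (c i) (f i)) = (\<Sum>k<card I. cmult (c (h k)) (f (h k)))"
    using sum.reindex_bij_betw[OF h, of "\<lambda>i. cmult (c i) (f i)"] by simp
  moreover have "\<forall>k<card I. f (h k) \<in> S" using h assms(2) by (auto simp: bij_betw_def)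
  ultimately show ?thesis
    unfolding mspan_def by (intro CollectI exI[of _ "card I"] exI[of _ "\<lambda>k. c (h k)"] exI[of _ "\<lambda>k. f (h k)"]) simp
qed

lemma subalg_gen_alg: "subalg (gen_alg S)"
  unfolding subalg_def
proof (intro conjI ballI allI)
  have single: "mprod ws \<in> gen_alg S" if "set ws \<subseteq> S" for ws
    using mspan_sum[of "{0::nat}" "\<lambda>_. mprod ws" "{mprod ws |ws. set ws \<subseteq> S}" "\<lambda>_. 1"] that by (auto simp: gen_alg_def)
  show "mat 1 \<in> gen_alg S" using single[of "[]"] by (simp add: mprod_def)
  fix M N assume "M \<in> gen_alg S" "N \<in> gen_alg S"
  then obtain n m :: nat and c d V W where
    M: "\<forall>k<n. V k \<in> {mprod ws | ws. set ws \<subseteq> S}" "M = (\<Sum>k<n. cmult (c k) (V k))" and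
    N: "\<forall>k<m. W k \<in> {mprod ws | ws. set ws \<subseteq> S}" "N = (\<Sum>k<m. cmult (d k) (W k))"
    by (auto simp: gen_alg_def mspan_def)
  let ?f = "\<lambda>k. case k of Inl i \<Rightarrow> V i | Inr i \<Rightarrow> W i"
  let ?e = "\<lambda>k. case k of Inl i \<Rightarrow> c i | Inr i \<Rightarrow> d i"
  have "M + N = (\<Sum>k\<in>{..<n} <+> {..<m}. cmult (?e k) (?f k))"
    by (simp add: sum.Plus M N)
  also have "\<dots> \<in> gen_alg S"
    unfolding gen_alg_def by (rule mspan_sum) (use M(1) N(1) in auto)
  finally show "M + N \<in> gen_alg S" .
  have "M ** N = (\<Sum>k<n. \<Sum>l<m. cmult (c k * d l) (V k ** W l))"
    by (subst sum.swap) (simp add: M(2) N(2) sum_mat_mul mat_mul_sum cmult_sum mult.commute)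
  also have "\<dots> = (\<Sum>p\<in>{..<n} \<times> {..<m}. cmult (c (fst p) * d (snd p)) (V (fst p) ** W (snd p)))"
    by (simp add: sum.cartesian_product case_prod_beta)
  also have "\<dots> \<in> gen_alg S"
    unfolding gen_alg_def
  proof (rule mspan_sum)
    fix p assume "p \<in> {..<n} \<times> {..<m}"
    then obtain us ws where "set us \<subseteq> S" "set ws \<subseteq> S" "V (fst p) = mprod us" "W (snd p) = mprod ws"
      using M(1) N(1) by fastforce
    then show "V (fst p) ** W (snd p) \<in> {mprod ws | ws. set ws \<subseteq> S}"
      by (auto simp: mprod_append[symmetric] intro!: exI[of _ "us @ ws"])
  qed auto
  finally show "M ** N \<in> gen_alg S" .
next
  fix e M assume "M \<in> gen_alg S"
  then obtain n :: nat and c V where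
    M: "\<forall>k<n. V k \<in> {mprod ws | ws. set ws \<subseteq> S}" "M = (\<Sum>k<n. cmult (c k) (V k))"
    by (auto simp: gen_alg_def mspan_def)
  have "cmult e M = (\<Sum>k<n. cmult (e * c k) (V k))" by (simp add: M cmult_sum)
  also have "\<dots> \<in> gen_alg S"
    unfolding gen_alg_def by (rule mspan_sum) (use M in auto)
  finally show "cmult e M \<in> gen_alg S" .
qed

lemma gen_alg_gen:
  assumes "M \<in> S"
  shows "M \<in> gen_alg S"
proof -
  have "mprod [M] \<in> {mprod ws | ws. set ws \<subseteq> S}" using assms by force
  then show ?thesis
    using mspan_sum[of "{0::nat}" "\<lambda>_. mprod [M]" "{mprod ws | ws. set ws \<subseteq> S}" "\<lambda>_. 1"]
    by (simp add: gen_alg_def mprod_def)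
qed

lemma tmodule_gen_alg:
  "tmodule (gen_alg S) W \<longleftrightarrow> vec.subspace W \<and> (\<forall>M\<in>S. \<forall>v\<in>W. M *v v \<in> W)"
proof
  assume r: "vec.subspace W \<and> (\<forall>M\<in>S. \<forall>v\<in>W. M *v v \<in> W)"
  let ?T = "{M. \<forall>v\<in>W. M *v v \<in> W}"
  have "subalg ?T"
    using r by (auto simp: subalg_def matrix_vector_mult_add_rdistrib intro: vec.subspace_add vec.subspace_scale)
  moreover have "S \<subseteq> ?T" using r by auto
  ultimately have "M \<in> ?T" if "M \<in> gen_alg S" for M
    using gen_alg_induct[OF that] by blast
  with r show "tmodule (gen_alg S) W" unfolding tmodule_def by blast
qed (auto simp: tmodule_def gen_alg_gen)

section \<open>Orthogonality and adjoints\<close>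

definition adj :: "'v::finite cmat \<Rightarrow> 'v cmat" where
  "adj M = (\<chi> i j. cnj (M $ j $ i))"

text \<open>The inner product of the type is the real part of the Hermitian form. Against a complex
  subspace the vanishing of the real part forces that of the whole form, so \<open>inner\<close>
  suffices throughout.\<close>

lemma inner_cvec: "inner x y = Re (\<Sum>i\<in>UNIV. cnj (x $ i) * (y $ i))" for x y :: "complex^'v::finite"
  by (simp add: inner_vec_def inner_complex_def)

lemma inner_adj: "inner (M *v x) y = inner x (adj M *v y)" for x y :: "complex^'v::finite"
proof -
  have "(\<Sum>i\<in>UNIV. cnj ((M *v x) $ i) * (y $ i)) = (\<Sum>i\<in>UNIV. \<Sum>j\<in>UNIV. cnj (M $ i $ j) * cnj (x $ j) * y $ i)"
    by (simp add: matrix_vector_mult_def sum_distrib_right)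
  also have "\<dots> = (\<Sum>j\<in>UNIV. \<Sum>i\<in>UNIV. cnj (M $ i $ j) * cnj (x $ j) * y $ i)"
    by (rule sum.swap)
  also have "\<dots> = (\<Sum>j\<in>UNIV. cnj (x $ j) * ((adj M *v y) $ j))"
    by (simp add: matrix_vector_mult_def adj_def sum_distrib_left mult_ac)
  finally show ?thesis by (simp add: inner_cvec)
qed

lemma inner_scale: "inner (c *s x) y = inner x (cnj c *s y)" for x y :: "complex^'v::finite"
  by (simp add: inner_cvec mult_ac)

lemma adj_adj [simp]: "adj (adj M) = M"
  by (simp add: adj_def vec_eq_iff)

lemma adj_add: "adj (M + N) = adj M + adj N"
  by (simp add: adj_def vec_eq_iff)

lemma adj_diff: "adj (M - N) = adj M - adj N"
  by (simp add: adj_def vec_eq_iff)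

lemma adj_cmult: "adj (cmult c M) = cmult (cnj c) (adj M)"
  by (simp add: adj_def vec_eq_iff)

lemma adj_mult: "adj (M ** N) = adj N ** adj M"
  by (simp add: adj_def vec_eq_iff matrix_matrix_mult_def mult.commute)

lemma adj_mat: "adj (mat 1) = mat 1"
  by (simp add: adj_def vec_eq_iff mat_def)

lemma gen_alg_adj:
  assumes "\<And>M. M \<in> S \<Longrightarrow> adj M = M" "M \<in> gen_alg S"
  shows "adj M \<in> gen_alg S"
proof -
  have "M \<in> {M. adj M \<in> gen_alg S}"
    using assms(2)
    by (rule gen_alg_induct)
      (auto simp: subalg_def adj_add adj_cmult adj_mult adj_mat subalgD[OF subalg_gen_alg] assms(1) gen_alg_gen)
  then show ?thesis by simp
qed

lemma csubspace_subspace: "vec.subspace W \<Longrightarrow> subspace (W :: (complex^'v::finite) set)"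
proof -
  assume W: "vec.subspace W"
  have "r *\<^sub>R x = complex_of_real r *s x" for r and x :: "complex^'v"
    unfolding vec_eq_iff vector_scaleR_component vector_smult_component
    by (metis scaleR_conv_of_real)
  with W show ?thesis by (auto simp: subspace_def vec.subspace_def)
qed

definition orthc :: "(complex^'v::finite) set \<Rightarrow> (complex^'v) set" where
  "orthc W = {y. \<forall>x\<in>W. inner x y = 0}"

text \<open>Orthogonality is tested with a real form, so closure under complex scalars uses that W
  is complex: the scalar moves to the other argument as its conjugate.\<close>

lemma orthc_subspace:
  assumes "vec.subspace W"
  shows "vec.subspace (orthc W)"
proof (rule vec.subspaceI)
  fix c y assume y: "y \<in> orthc W"
  { fix x assume "x \<in> W"
    then have "cnj c *s x \<in> W" using assms by (simp add: vec.subspace_scale)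
    then have "inner x (c *s y) = 0" using y inner_scale[of "cnj c" x y] by (simp add: orthc_def) }
  then show "c *s y \<in> orthc W" by (simp add: orthc_def)
qed (auto simp: orthc_def inner_add_right)

lemma orthc_decomp:
  assumes "vec.subspace W"
  obtains y z where "y \<in> W" "z \<in> orthc W" "x = y + z"
proof -
  have s: "span W = W" using csubspace_subspace[OF assms] by (simp add: span_eq_iff)
  obtain y z where "y \<in> span W" "\<And>w. w \<in> span W \<Longrightarrow> orthogonal z w" "x = y + z"
    using orthogonal_subspace_decomp_exists[of W x] by metis
  then show ?thesis
    using that[of y z] unfolding s by (auto simp: orthc_def orthogonal_def inner_commute)
qed

lemma orthc_self: "x \<in> W \<Longrightarrow> x \<in> orthc W \<Longrightarrow> x = 0"
  by (auto simp: orthc_def)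

definition oproj :: "(complex^'v::finite) set \<Rightarrow> 'v cmat" where
  "oproj W = matrix (\<lambda>x. THE y. y \<in> W \<and> x - y \<in> orthc W)"

text \<open>Two candidates for the projection of x differ by a vector in both W and its complement,
  hence agree. Linearity follows from this uniqueness, and \<open>oproj_eq\<close> passes the same
  criterion on to later proofs.\<close>

lemma oproj:
  assumes "vec.subspace W"
  shows oproj_in: "oproj W *v x \<in> W" and oproj_orth: "x - oproj W *v x \<in> orthc W"
    and oproj_eq: "y \<in> W \<Longrightarrow> x - y \<in> orthc W \<Longrightarrow> oproj W *v x = y"
proof -
  let ?P = "\<lambda>x y. y \<in> W \<and> x - y \<in> orthc W"
  have uniq: "y = z" if "?P x y" "?P x z" for x y z
  proof -
    have "y - z \<in> W" using that assms by (simp add: vec.subspace_diff)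
    moreover have "(x - z) - (x - y) \<in> orthc W"
      by (rule vec.subspace_diff[OF orthc_subspace[OF assms]]) (use that in blast)+
    ultimately show ?thesis using orthc_self[of "y - z" W] by simp
  qed
  have ex: "\<exists>y. ?P x y" for x
  proof -
    obtain y z where "y \<in> W" "z \<in> orthc W" "x = y + z" by (rule orthc_decomp[OF assms])
    then show ?thesis by (intro exI[of _ y]) simp
  qed
  define p where "p = (\<lambda>x. THE y. ?P x y)"
  have p: "?P x (p x)" for x
  proof -
    obtain y where y: "?P x y" using ex by blast
    then have "p x = y" unfolding p_def by (rule the_equality) (rule uniq[OF _ y])
    with y show ?thesis by simp
  qed
  have pe: "p x = y" if "?P x y" for x y by (rule uniq[OF p that])
  have "Vector_Spaces.linear (*s) (*s) p"
  proof (rule Vector_Spaces.linear_iff[THEN iffD2], intro conjI allI vec.vector_space_axioms)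
    fix x y show "p (x + y) = p x + p y"
      using p[of x] p[of y] assms vec.subspace_add[OF orthc_subspace[OF assms], of "x - p x" "y - p y"]
      by (intro pe) (simp add: vec.subspace_add algebra_simps)
  next
    fix c x show "p (c *s x) = c *s p x"
      using p[of x] assms vec.subspace_scale[OF orthc_subspace[OF assms], of "x - p x" c]
      by (intro pe) (simp add: vec.subspace_scale vec.scale_right_diff_distrib)
  qed
  then have "oproj W *v x = p x" for x
    by (simp add: oproj_def p_def[symmetric] matrix_works)
  then show "oproj W *v x \<in> W" "x - oproj W *v x \<in> orthc W"
    "y \<in> W \<Longrightarrow> x - y \<in> orthc W \<Longrightarrow> oproj W *v x = y"
    using p[of x] pe[of y x] by simp_all
qed

section \<open>Modules of a self-adjoint matrix algebra\<close>

definition staralg :: "'v::finite cmat set \<Rightarrow> bool" where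
  "staralg T \<longleftrightarrow> subalg T \<and> (\<forall>M\<in>T. adj M \<in> T)"

lemma irred_moduleD:
  assumes "irred_module T W"
  shows "tmodule T W" "vec.subspace W" "\<And>M v. M \<in> T \<Longrightarrow> v \<in> W \<Longrightarrow> M *v v \<in> W"
    "\<And>U. tmodule T U \<Longrightarrow> U \<subseteq> W \<Longrightarrow> U = {0} \<or> U = W" "\<exists>v\<in>W. v \<noteq> 0"
proof -
  show "tmodule T W" "vec.subspace W" "\<And>M v. M \<in> T \<Longrightarrow> v \<in> W \<Longrightarrow> M *v v \<in> W"
    "\<And>U. tmodule T U \<Longrightarrow> U \<subseteq> W \<Longrightarrow> U = {0} \<or> U = W" "\<exists>v\<in>W. v \<noteq> 0"
    using assms vec.subspace_0 unfolding irred_module_def tmodule_def by blast+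
qed

text \<open>M preserves the complement of W because \<open>adj M\<close> preserves W, so M maps the
  two parts of x to the two parts of M x.\<close>

lemma oproj_commutes:
  assumes "staralg T" "tmodule T W" "M \<in> T"
  shows "oproj W *v (M *v x) = M *v (oproj W *v x)"
proof (rule oproj_eq)
  show s: "vec.subspace W" using assms by (simp add: tmodule_def)
  show "M *v (oproj W *v x) \<in> W" using assms oproj_in[OF s] by (simp add: tmodule_def)
  show "M *v x - M *v (oproj W *v x) \<in> orthc W"
    unfolding orthc_def
  proof (intro CollectI ballI)
    fix w assume w: "w \<in> W"
    have "inner (adj M *v w) (x - oproj W *v x) = 0"
      using oproj_orth[OF s, of x] w assms by (auto simp: orthc_def staralg_def tmodule_def)
    then show "inner w (M *v x - M *v (oproj W *v x)) = 0"
      by (simp add: inner_adj matrix_vector_mult_diff_distrib)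
  qed
qed

lemma tmodule_orthc:
  assumes "staralg T" "tmodule T W"
  shows "tmodule T (orthc W)"
  using assms orthc_subspace[of W]
  unfolding tmodule_def staralg_def orthc_def by (fastforce simp: inner_adj[symmetric] inner_adj[of "adj _", simplified, symmetric])

text \<open>A nonzero submodule of least dimension is irreducible.\<close>

lemma ex_irred:
  assumes "tmodule T W" "W \<noteq> {0}"
  obtains U where "irred_module T U" "U \<subseteq> W"
proof -
  let ?P = "\<lambda>U. tmodule T U \<and> U \<noteq> {0} \<and> U \<subseteq> W"
  define U where "U = arg_min vec.dim ?P"
  have U: "?P U" "\<And>U'. ?P U' \<Longrightarrow> vec.dim U \<le> vec.dim U'"
    using arg_min_nat_lemma[of ?P W vec.dim] assms unfolding U_def by auto
  have "U' = {0} \<or> U' = U" if U': "tmodule T U'" "U' \<subseteq> U" for U'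
  proof (rule disjCI)
    assume "U' \<noteq> U"
    have "vec.dim U \<le> vec.dim U'" if "U' \<noteq> {0}"
      using U(2)[of U'] that U' U(1) by blast
    then show "U' = {0}"
      using vec.subspace_dim_equal[of U' U] U' U(1) \<open>U' \<noteq> U\<close> unfolding tmodule_def by blast
  qed
  then show ?thesis using that[of U] U(1) unfolding irred_module_def by blast
qed

lemma span_tmodule:
  assumes "\<And>W. W \<in> S \<Longrightarrow> tmodule T W"
  shows "tmodule T (vec.span (\<Union>S))"
  unfolding tmodule_def
proof (intro conjI ballI)
  fix M v assume M: "M \<in> T" and v: "v \<in> vec.span (\<Union>S)"
  have "vec.span (\<Union>S) \<subseteq> {v. M *v v \<in> vec.span (\<Union>S)}"
  proof (rule vec.span_minimal)
    show "\<Union>S \<subseteq> {v. M *v v \<in> vec.span (\<Union>S)}"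
      using assms M by (fastforce simp: tmodule_def intro: vec.span_base)
    show "vec.subspace {v. M *v v \<in> vec.span (\<Union>S)}"
      by (auto simp: vec.subspace_def matrix_vector_right_distrib intro: vec.span_zero vec.span_add vec.span_scale)
  qed
  then show "M *v v \<in> vec.span (\<Union>S)" using v by blast
qed simp

text \<open>Complete reducibility: if the irreducible modules spanned less, the complement of their
  span would be a nonzero module, and an irreducible module inside it would be orthogonal to
  itself.\<close>

lemma span_irred:
  assumes "staralg T"
  shows "vec.span (\<Union>{W. irred_module T W}) = UNIV"
proof (rule ccontr)
  let ?U = "vec.span (\<Union>{W. irred_module T W})"
  assume "?U \<noteq> UNIV"
  then obtain x where x: "x \<notin> ?U" by blast
  obtain y z where "y \<in> ?U" "z \<in> orthc ?U" "x = y + z" by (rule orthc_decomp[of ?U]) auto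
  with x have z: "z \<in> orthc ?U" "z \<noteq> 0" by auto
  have "tmodule T (orthc ?U)"
    by (intro tmodule_orthc assms span_tmodule) (auto simp: irred_moduleD)
  moreover have "orthc ?U \<noteq> {0}" using z by blast
  ultimately obtain W where W: "irred_module T W" "W \<subseteq> orthc ?U" by (rule ex_irred)
  then have "W \<subseteq> ?U" by (auto intro: vec.span_base)
  with W have "W \<subseteq> {0}" using orthc_self[of _ ?U] by blast
  with irred_moduleD(5)[OF W(1)] show False by blast
qed

section \<open>Isomorphism types and homogeneous components\<close>

lemma mod_iso_refl: "mod_iso T W W"
  unfolding mod_iso_def using vec.linear_id by (intro exI[of _ id]) auto

lemma mod_iso_trans:
  assumes "irred_module T U" "mod_iso T U V" "mod_iso T V W"
  shows "mod_iso T U W"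
proof -
  obtain f g where "Vector_Spaces.linear ((*s)) ((*s)) f" "bij_betw f U V" "\<forall>M\<in>T. \<forall>v\<in>U. f (M *v v) = M *v f v"
    "Vector_Spaces.linear ((*s)) ((*s)) g" "bij_betw g V W" "\<forall>M\<in>T. \<forall>v\<in>V. g (M *v v) = M *v g v"
    using assms(2,3) unfolding mod_iso_def by metis
  then have "Vector_Spaces.linear ((*s)) ((*s)) (g \<circ> f) \<and> bij_betw (g \<circ> f) U W \<and>
     (\<forall>M\<in>T. \<forall>v\<in>U. (g \<circ> f) (M *v v) = M *v (g \<circ> f) v)"
    by (auto intro: Vector_Spaces.linear_compose bij_betw_trans dest: bij_betwE)
  then show ?thesis unfolding mod_iso_def by blast
qed

lemma mod_iso_sym:
  assumes "irred_module T U" "mod_iso T U V"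
  shows "mod_iso T V U"
proof -
  obtain f where f: "Vector_Spaces.linear ((*s)) ((*s)) f" "bij_betw f U V" "\<forall>M\<in>T. \<forall>v\<in>U. f (M *v v) = M *v f v"
    using assms(2) unfolding mod_iso_def by metis
  \<comment> \<open>The inverse on V must be the restriction of a linear map of the whole space, so
    a linear left inverse of f on U is taken.\<close>
  obtain g where g: "Vector_Spaces.linear ((*s)) ((*s)) g" "\<And>v. v \<in> U \<Longrightarrow> g (f v) = v"
    using vec.linear_exists_left_inverse_on[OF f(1), of U] f(2) irred_moduleD(2)[OF assms(1)]
    by (auto simp: bij_betw_def)
  have "bij_betw g V U"
    using f(2) g(2) by (intro bij_betw_byWitness[where f' = f]) (auto simp: bij_betw_def)
  moreover have "g (M *v v) = M *v g v" if M: "M \<in> T" and v: "v \<in> V" for M v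
  proof -
    obtain u where u: "u \<in> U" "v = f u" using f(2) v by (auto simp: bij_betw_def)
    then have "g (M *v v) = g (f (M *v u))" using f(3) M by simp
    then show ?thesis using u g(2) irred_moduleD(3)[OF assms(1)] M by simp
  qed
  ultimately show ?thesis unfolding mod_iso_def using g(1) by blast
qed

text \<open>Schur's lemma for a matrix that intertwines T on W: the kernel in W and the preimages of
  submodules are submodules, so the kernel is trivial and the image is irreducible.\<close>

lemma schur_image:
  assumes W: "irred_module T W" and T: "\<And>M v. M \<in> T \<Longrightarrow> v \<in> W \<Longrightarrow> N *v (M *v v) = M *v (N *v v)"
    and nz: "v0 \<in> W" "N *v v0 \<noteq> 0"
  shows "irred_module T (img N W)" "mod_iso T W (img N W)"
proof -
  note Wd = irred_moduleD[OF W]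
  have lin: "Vector_Spaces.linear ((*s)) ((*s)) ((*v) N)" by simp
  have "tmodule T {v \<in> W. N *v v = 0}"
    using Wd(2,3) T by (auto simp: tmodule_def vec.subspace_def matrix_vector_right_distrib)
  then have "{v \<in> W. N *v v = 0} = {0}" using Wd(4) nz by blast
  then have inj: "inj_on ((*v) N) W"
    by (subst vec.linear_inj_on_iff_eq_0[OF lin Wd(2)]) auto
  have timg: "tmodule T (img N W)"
    using Wd(2,3) T[symmetric] unfolding tmodule_def img_def
    by (auto intro!: vec.linear_subspace_image)
  have sub: "U = {0} \<or> U = img N W" if U: "tmodule T U" "U \<subseteq> img N W" for U
  proof -
    have "tmodule T {v \<in> W. N *v v \<in> U}"
      using U(1) Wd(2,3) T by (auto simp: tmodule_def vec.subspace_def matrix_vector_right_distrib)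
    then have "{v \<in> W. N *v v \<in> U} = {0} \<or> {v \<in> W. N *v v \<in> U} = W" using Wd(4) by blast
    moreover have "0 \<in> U" using U(1) by (simp add: tmodule_def vec.subspace_0)
    moreover have "\<And>u. u \<in> U \<Longrightarrow> \<exists>w\<in>{v \<in> W. N *v v \<in> U}. u = N *v w"
      using U(2) by (auto simp: img_def)
    ultimately show ?thesis using U(2) by (fastforce simp: img_def)
  qed
  have "img N W \<noteq> {0}" using nz by (auto simp: img_def)
  with timg sub show "irred_module T (img N W)" unfolding irred_module_def by blast
  have "bij_betw ((*v) N) W (img N W)" using inj by (simp add: bij_betw_def img_def)
  with T show "mod_iso T W (img N W)" unfolding mod_iso_def by (intro exI[of _ "(*v) N"]) simp
qed

lemma iso_types_mem:
  assumes "psi \<in> iso_types T" "W \<in> psi"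
  shows "irred_module T W" "psi = {W'. irred_module T W' \<and> mod_iso T W W'}"
proof -
  obtain U where U: "irred_module T U" "psi = {W'. irred_module T W' \<and> mod_iso T U W'}"
    using assms(1) by (auto simp: iso_types_def)
  with assms show "irred_module T W" by auto
  have "mod_iso T U W" using U assms by auto
  then show "psi = {W'. irred_module T W' \<and> mod_iso T W W'}"
    using U assms mod_iso_sym mod_iso_trans by blast
qed

lemma iso_types_rep:
  assumes "psi \<in> iso_types T"
  shows "rep psi \<in> psi"
proof -
  obtain U where "irred_module T U" "psi = {W'. irred_module T W' \<and> mod_iso T U W'}"
    using assms by (auto simp: iso_types_def)
  then have "U \<in> psi" by (simp add: mod_iso_refl)
  then show ?thesis unfolding rep_def by (rule someI)
qed

lemma iso_types_cover: "irred_module T W \<Longrightarrow> \<exists>psi\<in>iso_types T. W \<in> psi"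
  by (auto simp: iso_types_def intro!: exI[of _ "{W'. irred_module T W' \<and> mod_iso T W W'}"] mod_iso_refl)

text \<open>The projection onto U intertwines T on W. Were it nonzero at y, its image would be all
  of U by irreducibility, and U and W would be isomorphic.\<close>

lemma irred_orth:
  assumes "staralg T" "psi \<in> iso_types T" "lam \<in> iso_types T" "psi \<noteq> lam" "U \<in> psi" "W \<in> lam" "x \<in> U" "y \<in> W"
  shows "inner x y = 0"
proof -
  note U = iso_types_mem[OF assms(2,5)] and W = iso_types_mem[OF assms(3,6)]
  note Us = irred_moduleD(2)[OF U(1)]
  have "oproj U *v y = 0"
  proof (rule ccontr)
    assume nz: "oproj U *v y \<noteq> 0"
    note s = schur_image[OF W(1) oproj_commutes[OF assms(1) irred_moduleD(1)[OF U(1)]] assms(8) nz, simplified]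
    have "img (oproj U) W \<subseteq> U" using oproj_in[OF Us] by (auto simp: img_def)
    moreover have "img (oproj U) W \<noteq> {0}" using nz assms(8) by (auto simp: img_def)
    ultimately have "img (oproj U) W = U"
      using irred_moduleD(4)[OF U(1) irred_moduleD(1)[OF s(1)]] by blast
    with s(2) have "mod_iso T W U" by simp
    then have "U \<in> lam" using W(2) U(1) by blast
    then show False using iso_types_mem(2)[OF assms(3)] U(2) assms(4) by blast
  qed
  then show ?thesis using oproj_orth[OF Us, of y] assms(7) by (simp add: orthc_def)
qed

lemma Vtype_orth:
  assumes "staralg T" "psi \<in> iso_types T" "lam \<in> iso_types T" "psi \<noteq> lam" "x \<in> Vtype psi" "y \<in> Vtype lam"
  shows "inner x y = 0"
proof -
  have "Vtype lam \<subseteq> orthc U" if "U \<in> psi" for U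
    unfolding Vtype_def
  proof (rule vec.span_minimal)
    show "\<Union>lam \<subseteq> orthc U" using irred_orth[OF assms(1-4) that] by (auto simp: orthc_def)
    show "vec.subspace (orthc U)"
      using iso_types_mem(1)[OF assms(2) that] by (intro orthc_subspace irred_moduleD(2))
  qed
  then have "\<Union>psi \<subseteq> orthc (Vtype lam)"
    by (force simp: orthc_def inner_commute)
  then have "Vtype psi \<subseteq> orthc (Vtype lam)"
    unfolding Vtype_def[of psi] by (rule vec.span_minimal) (simp add: orthc_subspace Vtype_def)
  then show ?thesis using assms(5,6) by (auto simp: orthc_def inner_commute)
qed

lemma subspace_Vtype: "vec.subspace (Vtype psi)"
  by (simp add: Vtype_def)

text \<open>The irreducible modules span, so two matrices can be compared on the homogeneous
  components.\<close>

lemma Vtype_ext: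
  assumes "staralg T"
    and "\<And>psi v. psi \<in> iso_types T \<Longrightarrow> v \<in> Vtype psi \<Longrightarrow> M *v v = N *v v"
  shows "M = N"
proof -
  have "vec.span (\<Union>{W. irred_module T W}) \<subseteq> {v. M *v v = N *v v}"
  proof (rule vec.span_minimal)
    show "\<Union>{W. irred_module T W} \<subseteq> {v. M *v v = N *v v}"
      using iso_types_cover[of T] assms(2) by (fastforce simp: Vtype_def intro: vec.span_base)
    show "vec.subspace {v. M *v v = N *v v}"
      by (auto simp: vec.subspace_def matrix_vector_right_distrib)
  qed
  then show ?thesis unfolding span_irred[OF assms(1)] by (auto simp: matrix_eq)
qed

lemma oproj_Vtype:
  assumes "staralg T" "psi \<in> iso_types T"
  shows "v \<in> Vtype psi \<Longrightarrow> oproj (Vtype psi) *v v = v"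
    "lam \<in> iso_types T \<Longrightarrow> lam \<noteq> psi \<Longrightarrow> v \<in> Vtype lam \<Longrightarrow> oproj (Vtype psi) *v v = 0"
proof -
  show "oproj (Vtype psi) *v v = v" if "v \<in> Vtype psi"
    using that by (intro oproj_eq subspace_Vtype) (auto simp: orthc_def)
  show "oproj (Vtype psi) *v v = 0" if "lam \<in> iso_types T" "lam \<noteq> psi" "v \<in> Vtype lam"
    using that Vtype_orth[OF assms(1,2) that(1)]
    by (intro oproj_eq subspace_Vtype) (auto simp: orthc_def vec.subspace_0[OF subspace_Vtype])
qed

lemma e_type_oproj:
  assumes "staralg T" "psi \<in> iso_types T"
  shows "e_type T psi = oproj (Vtype psi)"
  unfolding e_type_def
proof (rule the_equality)
  fix M assume M: "(\<forall>v\<in>Vtype psi. M *v v = v) \<and>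
      (\<forall>lam\<in>iso_types T. lam \<noteq> psi \<longrightarrow> (\<forall>v\<in>Vtype lam. M *v v = 0))"
  show "M = oproj (Vtype psi)"
  proof (rule Vtype_ext[OF assms(1)])
    fix lam v assume "lam \<in> iso_types T" "v \<in> Vtype lam"
    then show "M *v v = oproj (Vtype psi) *v v"
      using M oproj_Vtype[OF assms] by (cases "lam = psi") auto
  qed
qed (use oproj_Vtype[OF assms] in auto)

text \<open>A nonzero vector chosen from each component gives pairwise orthogonal, hence
  independent, vectors. Finiteness is what makes \<open>type_sum\<close> a genuine sum.\<close>

lemma finite_iso_types:
  assumes "staralg T"
  shows "finite (iso_types T)"
proof -
  have "\<exists>v. v \<in> Vtype psi \<and> v \<noteq> 0" if psi: "psi \<in> iso_types T" for psi
  proof -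
    note r = iso_types_rep[OF psi]
    obtain v where "v \<in> rep psi" "v \<noteq> 0"
      using irred_moduleD(5)[OF iso_types_mem(1)[OF psi r]] by blast
    then show ?thesis using r by (intro exI[of _ v]) (auto simp: Vtype_def intro!: vec.span_base)
  qed
  then obtain h where h: "\<And>psi. psi \<in> iso_types T \<Longrightarrow> h psi \<in> Vtype psi \<and> h psi \<noteq> 0" by metis
  have o: "inner (h psi) (h lam) = 0" if "psi \<in> iso_types T" "lam \<in> iso_types T" "psi \<noteq> lam" for psi lam
    using Vtype_orth[OF assms that] h that by blast
  have "inj_on h (iso_types T)"
  proof (rule inj_onI, rule ccontr)
    fix psi lam assume a: "psi \<in> iso_types T" "lam \<in> iso_types T" "h psi = h lam" "psi \<noteq> lam"
    then have "inner (h psi) (h psi) = 0" using o[of psi lam] by simp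
    then show False using h[OF a(1)] by simp
  qed
  moreover have "finite (h ` iso_types T)"
  proof (rule independent_imp_finite, rule pairwise_orthogonal_independent)
    show "pairwise orthogonal (h ` iso_types T)"
      using o by (auto simp: pairwise_def orthogonal_def)
    show "0 \<notin> h ` iso_types T" using h by force
  qed
  ultimately show ?thesis by (rule finite_imageD[rotated])
qed

lemma type_sum_vec:
  assumes "staralg T" "psi \<in> iso_types T" "v \<in> Vtype psi"
  shows "type_sum T f *v v = f psi *s v"
proof -
  have "type_sum T f *v v = (\<Sum>lam\<in>iso_types T. f lam *s (oproj (Vtype lam) *v v))"
    by (simp add: type_sum_def sum_mat_vec e_type_oproj[OF assms(1)])
  also have "\<dots> = (\<Sum>lam\<in>iso_types T. if lam = psi then f psi *s v else 0)"
    using oproj_Vtype[OF assms(1)] assms(2,3) by (intro sum.cong) auto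
  finally show ?thesis using finite_iso_types[OF assms(1)] assms(2) by simp
qed

text \<open>\<open>matrix_inv\<close> is a choice among two-sided inverses; an explicit one, acting
  on each component by the reciprocal scalar, pins it down.\<close>

lemma type_sum_inv:
  assumes "staralg T" "\<And>psi. psi \<in> iso_types T \<Longrightarrow> f psi \<noteq> 0"
  shows "matrix_inv (type_sum T f) = type_sum T (\<lambda>psi. inverse (f psi))"
proof -
  let ?g = "\<lambda>psi. inverse (f psi)"
  have 1: "type_sum T f ** type_sum T ?g = mat 1"
    by (rule Vtype_ext[OF assms(1)]) (simp add: type_sum_vec[OF assms(1)] assms(2))
  have 2: "type_sum T ?g ** type_sum T f = mat 1"
    by (rule Vtype_ext[OF assms(1)]) (simp add: type_sum_vec[OF assms(1)] assms(2))
  have "type_sum T f ** matrix_inv (type_sum T f) = mat 1 \<and> matrix_inv (type_sum T f) ** type_sum T f = mat 1"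
    unfolding matrix_inv_def by (rule someI[of _ "type_sum T ?g"]) (simp add: 1 2)
  then have "matrix_inv (type_sum T f) ** (type_sum T f ** type_sum T ?g) = type_sum T ?g"
    by (simp add: matrix_mul_assoc)
  then show ?thesis by (simp add: 1)
qed

section \<open>Central elements and the double commutant\<close>

definition commutant :: "'v::finite cmat set \<Rightarrow> 'v cmat set" where
  "commutant T = {N. \<forall>M\<in>T. N ** M = M ** N}"

text \<open>An element of the commutant sends an irreducible module to zero or to an isomorphic
  copy. It therefore preserves each homogeneous component, on which \<open>type_sum T f\<close> is a
  scalar.\<close>

lemma type_sum_commutant:
  assumes "staralg T" "N \<in> commutant T"
  shows "N ** type_sum T f = type_sum T f ** N"
proof (rule Vtype_ext[OF assms(1)])
  fix psi v assume psi: "psi \<in> iso_types T" and v: "v \<in> Vtype psi"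
  have comm: "N *v (M *v u) = M *v (N *v u)" if "M \<in> T" for M u
    using assms(2) that unfolding commutant_def matrix_vector_mul_assoc by simp
  have "Vtype psi \<subseteq> {v. N *v v \<in> Vtype psi}"
    unfolding Vtype_def
  proof (rule vec.span_minimal)
    show "vec.subspace {v. N *v v \<in> vec.span (\<Union>psi)}"
      by (auto simp: vec.subspace_def matrix_vector_right_distrib intro: vec.span_zero vec.span_add vec.span_scale)
    have "N *v w \<in> vec.span (\<Union>psi)" if w: "W \<in> psi" "w \<in> W" for w W
    proof (cases "N *v w = 0")
      case False
      note W = iso_types_mem[OF psi w(1)]
      have "img N W \<in> psi" using schur_image[OF W(1) comm w(2) False] W(2) by auto
      moreover have "N *v w \<in> img N W" using w by (auto simp: img_def)
      ultimately show ?thesis by (blast intro: vec.span_base)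
    qed (simp add: vec.span_zero)
    then show "\<Union>psi \<subseteq> {v. N *v v \<in> vec.span (\<Union>psi)}" by blast
  qed
  then show "(N ** type_sum T f) *v v = (type_sum T f ** N) *v v"
    using v by (auto simp: type_sum_vec[OF assms(1) psi])
qed

text \<open>The inner product of matrices is that of their columns, added up, so left multiplication
  has the same adjoint as on vectors.\<close>

lemma inner_adj_mat: "inner (M ** X) Y = inner X (adj M ** Y)" for X Y :: "'v::finite cmat"
proof -
  have *: "inner X Y = (\<Sum>j\<in>UNIV. inner (column j X) (column j Y))" for X Y :: "'v cmat"
    by (simp add: inner_vec_def column_def) (rule sum.swap)
  have "column j (M ** X) = M *v column j X" for j and M X :: "'v cmat"
    by (simp add: vec_eq_iff column_def matrix_matrix_mult_def matrix_vector_mult_def)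
  then show ?thesis by (simp add: * inner_adj)
qed

text \<open>Apply the orthogonal projection of the matrix space onto \<open>T\<close>
  to the identity matrix. The blocks of this projection with respect to the columns lie in the
  commutant of \<open>T\<close>.\<close>
lemma double_commutant:
  assumes "staralg T" and F: "\<And>N. N \<in> commutant T \<Longrightarrow> F ** N = N ** F"
  shows "F \<in> T"
proof -
  note T = assms(1)[unfolded staralg_def, THEN conjunct1]
  \<comment> \<open>The complement of T in the matrix space. As T is closed under adjoints, this is
    stable under left multiplication by T, and so the projection \<open>p\<close> commutes with that
    multiplication.\<close>
  define O' where "O' = {Y. \<forall>X\<in>T. inner X Y = 0}"
  have sub: "subspace T"
  proof -
    have "r *\<^sub>R M = cmult (complex_of_real r) M" for r and M :: "'a cmat"
      unfolding vec_eq_iff vector_scaleR_component cmult_nth by (metis scaleR_conv_of_real)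
    then show ?thesis using subalgD[OF T] subalg_zero[OF T] by (auto simp: subspace_def)
  qed
  have O_add: "Y + Z \<in> O'" if "Y \<in> O'" "Z \<in> O'" for Y Z using that by (simp add: O'_def inner_add_right)
  have O_mul: "M ** Y \<in> O'" if "M \<in> T" "Y \<in> O'" for M Y
    using that assms(1) subalgD[OF T] by (auto simp: O'_def staralg_def inner_adj_mat[of "adj M", simplified, symmetric])
  have O_cm: "cmult c Y \<in> O'" if "Y \<in> O'" for c Y
    using O_mul[of "mat c" Y] that subalg_mat[OF T] cmult_mul(1)[of c "mat 1" Y]
    by (metis cmult_nth mat_vec matrix_eq mul_vec cmult_vec)
  have ex: "\<exists>X. X \<in> T \<and> Y - X \<in> O'" for Y
  proof -
    obtain X Z where "X \<in> span T" "\<And>w. w \<in> span T \<Longrightarrow> orthogonal Z w" "Y = X + Z"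
      using orthogonal_subspace_decomp_exists[of T Y] by metis
    then show ?thesis
      by (intro exI[of _ X])
        (auto simp: O'_def orthogonal_def inner_commute span_base span_eq_iff[THEN iffD2, OF sub])
  qed
  then obtain p where p: "\<And>Y. p Y \<in> T" "\<And>Y. Y - p Y \<in> O'" by metis
  have peq: "p Y = X" if "X \<in> T" "Y - X \<in> O'" for X Y
  proof -
    have "p Y - X \<in> T" using p that by (intro subalg_diff T)
    moreover have "(Y - X) + cmult (-1) (Y - p Y) = p Y - X" by (simp add: vec_eq_iff)
    then have "p Y - X \<in> O'" using O_add[OF that(2) O_cm[OF p(2)]] by metis
    ultimately have "inner (p Y - X) (p Y - X) = 0" by (simp add: O'_def)
    then show ?thesis by simp
  qed
  have p_add: "p (Y + Z) = p Y + p Z" for Y Z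
    using p O_add[OF p(2)[of Y] p(2)[of Z]] by (intro peq subalgD[OF T]) (simp_all add: algebra_simps)
  have p_cm: "p (cmult c Y) = cmult c (p Y)" for c Y
  proof (rule peq)
    have "cmult c Y - cmult c (p Y) = cmult c (Y - p Y)" by (simp add: vec_eq_iff right_diff_distrib)
    then show "cmult c Y - cmult c (p Y) \<in> O'" using O_cm[OF p(2)] by metis
  qed (simp add: subalgD[OF T] p)
  have p_mul: "p (M ** Y) = M ** p Y" if "M \<in> T" for M Y
  proof (rule peq)
    have "M ** Y - M ** p Y = M ** (Y - p Y)" by (simp add: matrix_eq algebra_simps)
    then show "M ** Y - M ** p Y \<in> O'" using O_mul[OF that p(2)] by metis
  qed (simp add: subalgD[OF T] p that)
  have p_sum: "p (sum f I) = (\<Sum>i\<in>I. p (f i))" if "finite I" for f and I :: "'a set"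
    using that
  proof induction
    case empty show ?case using p_cm[of 0 0] by simp
  qed (simp add: p_add)
  \<comment> \<open>The matrix space is a sum of copies of V, one for each column;
    \<open>emb i\<close> includes the i-th copy, and \<open>N i j\<close> below is the block of
    \<open>p\<close> from column i to column j.\<close>
  define emb where "emb = (\<lambda>i (v::complex^'a). (\<chi> r c. if c = i then v $ r else 0) :: 'a cmat)"
  have emb_mul: "M ** emb i v = emb i (M *v v)" for M i v
    by (simp add: emb_def vec_eq_iff matrix_matrix_mult_def matrix_vector_mult_def if_distrib cong: if_cong)
  have emb_sum: "Y = (\<Sum>i\<in>UNIV. emb i (column i Y))" for Y
    by (simp add: emb_def vec_eq_iff column_def)
  have col_mul: "column j (M ** X) = M *v column j X" for j and M X :: "'a cmat"
    by (simp add: vec_eq_iff column_def matrix_matrix_mult_def matrix_vector_mult_def)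
  define N where "N = (\<lambda>i j. matrix (\<lambda>v. column j (p (emb i v))))"
  have N: "N i j *v v = column j (p (emb i v))" for i j v
  proof -
    have "Vector_Spaces.linear (*s) (*s) (\<lambda>v. column j (p (emb i v)))"
    proof (rule Vector_Spaces.linear_iff[THEN iffD2], intro conjI allI vec.vector_space_axioms)
      fix c u v
      have "emb i (u + v) = emb i u + emb i v" by (simp add: emb_def vec_eq_iff)
      then have "p (emb i (u + v)) = p (emb i u) + p (emb i v)" by (simp add: p_add)
      then show "column j (p (emb i (u + v))) = column j (p (emb i u)) + column j (p (emb i v))"
        by (simp add: column_def vec_eq_iff)
      have "emb i (c *s v) = cmult c (emb i v)" by (simp add: emb_def vec_eq_iff)
      then have "p (emb i (c *s v)) = cmult c (p (emb i v))" by (simp add: p_cm)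
      then show "column j (p (emb i (c *s v))) = c *s column j (p (emb i v))"
        by (simp add: column_def vec_eq_iff)
    qed
    then show ?thesis by (simp add: N_def matrix_works)
  qed
  have "N i j \<in> commutant T" for i j
    by (auto simp: commutant_def matrix_eq N p_mul emb_mul[symmetric] col_mul)
  then have FN: "F *v (N i j *v v) = N i j *v (F *v v)" for i j v
    using F unfolding matrix_vector_mul_assoc by simp
  \<comment> \<open>F commutes with every block, hence \<open>p\<close> commutes with left
    multiplication by F although F is not yet known to lie in T. At the identity, which
    \<open>p\<close> fixes, this gives p F = F.\<close>
  have "column j (p (F ** Y)) = F *v column j (p Y)" for j Y
  proof -
    have cs: "column j (\<Sum>i\<in>UNIV. f i) = (\<Sum>i\<in>UNIV. column j (f i))" for f :: "'a \<Rightarrow> 'a cmat"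
      by (simp add: column_def vec_eq_iff)
    have "column j (p (F ** Y)) = (\<Sum>i\<in>UNIV. N i j *v (F *v column i Y))"
      by (subst emb_sum[of "F ** Y"]) (simp add: p_sum cs N col_mul)
    also have "\<dots> = F *v (\<Sum>i\<in>UNIV. N i j *v column i Y)"
      by (simp add: FN mat_vec_sum)
    also have "(\<Sum>i\<in>UNIV. N i j *v column i Y) = column j (p Y)"
      by (subst (2) emb_sum[of Y]) (simp add: p_sum cs N)
    finally show ?thesis .
  qed
  then have "column j (p (F ** mat 1)) = column j (F ** p (mat 1))" for j unfolding col_mul by blast
  moreover have "p (mat 1) = mat 1"
    by (rule peq) (simp_all add: subalgD[OF T] O'_def)
  ultimately have "column j (p F) = column j F" for j by (simp add: col_mul[symmetric])
  then have "p F = F" by (simp add: column_def vec_eq_iff)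
  then show ?thesis using p(1)[of F] by simp
qed

lemma type_sum_in:
  assumes "staralg T"
  shows "type_sum T f \<in> T"
  by (rule double_commutant[OF assms]) (simp add: type_sum_commutant[OF assms])

text \<open>An isomorphism from the representative commutes with M and carries the vanishing to
  every module of the type. This is how a relation checked on one module reaches the whole
  component.\<close>

lemma annihilates_type:
  assumes "M \<in> T" "psi \<in> iso_types T" "\<And>v. v \<in> rep psi \<Longrightarrow> M *v v = 0" "v \<in> Vtype psi"
  shows "M *v v = 0"
proof -
  note R = iso_types_mem[OF assms(2) iso_types_rep[OF assms(2)]]
  have "M *v w = 0" if w: "W \<in> psi" "w \<in> W" for w W
  proof -
    obtain f where f: "Vector_Spaces.linear ((*s)) ((*s)) f" "bij_betw f (rep psi) W"
      "\<forall>M\<in>T. \<forall>v\<in>rep psi. f (M *v v) = M *v f v"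
      using R(2) w(1) unfolding mod_iso_def by blast
    obtain u where u: "u \<in> rep psi" "w = f u" using f(2) w(2) by (auto simp: bij_betw_def)
    then have "M *v w = f (M *v u)" using f(3) assms(1) by simp
    then show ?thesis using assms(3)[OF u(1)] vec.linear_0[OF f(1)] by simp
  qed
  then have "Vtype psi \<subseteq> {v. M *v v = 0}"
    unfolding Vtype_def
    by (intro vec.span_minimal) (auto simp: vec.subspace_def matrix_vector_right_distrib)
  then show ?thesis using assms(4) by blast
qed

section \<open>Tridiagonal pairs of q-Racah type\<close>

text \<open>Idempotents may vanish, and eigenvalues must differ only where both idempotents are
  nonzero. The dual idempotents thus fit without a proof that each distance up to D occurs from
  x.\<close>

locale eigen =
  fixes A :: "'v::finite cmat" and E :: "nat \<Rightarrow> 'v cmat" and th :: "nat \<Rightarrow> complex" and D :: nat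
  assumes E_mult: "i \<le> D \<Longrightarrow> j \<le> D \<Longrightarrow> E i ** E j = (if i = j then E i else 0)"
    and E_one: "(\<Sum>i\<le>D. E i) = mat 1"
    and A_eq: "A = (\<Sum>i\<le>D. cmult (th i) (E i))"
    and th_inj: "i \<le> D \<Longrightarrow> j \<le> D \<Longrightarrow> E i \<noteq> 0 \<Longrightarrow> E j \<noteq> 0 \<Longrightarrow> th i = th j \<Longrightarrow> i = j"
begin

lemma E_E: "i \<le> D \<Longrightarrow> j \<le> D \<Longrightarrow> E i *v (E j *v u) = (if i = j then E i *v u else 0)"
  using arg_cong[OF E_mult[of i j], of "\<lambda>M. M *v u"] by (simp split: if_splits)

lemma E_sum: "(\<Sum>i\<le>D. E i *v u) = u"
  using arg_cong[OF E_one, of "\<lambda>M. M *v u"] by (simp add: sum_mat_vec)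

lemma A_E: "i \<le> D \<Longrightarrow> A *v (E i *v u) = th i *s (E i *v u)"
proof -
  assume i: "i \<le> D"
  have "A *v (E i *v u) = (\<Sum>j\<le>D. if j = i then th i *s (E i *v u) else 0)"
    unfolding A_eq sum_mat_vec by (intro sum.cong) (auto simp: E_E i)
  then show ?thesis using i by simp
qed

lemma E_A: "i \<le> D \<Longrightarrow> E i *v (A *v u) = th i *s (E i *v u)"
proof -
  assume i: "i \<le> D"
  have "E i *v (A *v u) = (\<Sum>j\<le>D. if j = i then th i *s (E i *v u) else 0)"
    unfolding A_eq sum_mat_vec mat_vec_sum by (intro sum.cong) (auto simp: E_E i)
  then show ?thesis using i by simp
qed

lemma E_eqI:
  assumes "\<And>i. i \<le> D \<Longrightarrow> E i *v u = E i *v w"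
  shows "u = w"
  using assms E_sum[of u] E_sum[of w] by (metis (no_types, lifting) atMost_iff sum.cong)

text \<open>Induction on the set of indices at which u has components: applying A minus the
  eigenvalue of one index removes that component and rescales the others by eigenvalue
  differences.\<close>

lemma E_closed:
  assumes W: "vec.subspace W" "\<And>u. u \<in> W \<Longrightarrow> A *v u \<in> W" and u: "u \<in> W" and i: "i \<le> D"
  shows "E i *v u \<in> W"
proof -
  have "\<forall>u\<in>W. u = (\<Sum>j\<in>J. E j *v u) \<longrightarrow> (\<forall>j\<in>J. E j *v u \<in> W)" if "finite J" "J \<subseteq> {..D}" for J
    using that
  proof (induction J)
    case (insert k J)
    show ?case
    proof (intro ballI impI)
      fix u j assume u: "u \<in> W" "u = (\<Sum>j\<in>insert k J. E j *v u)" and j: "j \<in> insert k J"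
      have D: "k \<le> D" "\<And>j. j \<in> J \<Longrightarrow> j \<le> D" using insert.prems by auto
      define v where "v = A *v u - th k *s u"
      have Ev: "E j *v v = (th j - th k) *s (E j *v u)" if "j \<le> D" for j
        by (simp add: v_def matrix_vector_mult_diff_distrib E_A that vec.scale_left_diff_distrib)
      have "v = A *v (\<Sum>j\<in>insert k J. E j *v u) - th k *s (\<Sum>j\<in>insert k J. E j *v u)"
        unfolding v_def using u(2) by metis
      also have "\<dots> = (\<Sum>j\<in>J. (th j - th k) *s (E j *v u))"
        using insert.hyps D
        by (simp add: mat_vec_sum A_E matrix_vector_right_distrib vec.scale_sum_right vec.scale_right_distrib
            vec.scale_left_diff_distrib sum_subtractf)
      also have "\<dots> = (\<Sum>j\<in>J. E j *v v)"
        using D by (intro sum.cong) (auto simp: Ev)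
      finally have "v = (\<Sum>j\<in>J. E j *v v)" .
      moreover have vW: "v \<in> W" unfolding v_def using W u by (simp add: vec.subspace_diff vec.subspace_scale)
      ultimately have EvW: "E j *v v \<in> W" if "j \<in> J" for j using insert.IH insert.prems that by blast
      \<comment> \<open>\<open>th_inj\<close> compares only nonzero idempotents. If E k u = 0 and
        the eigenvalues agree, index k drops out of the sum and the induction hypothesis applies to
        u itself.\<close>
      have EJ: "E j *v u \<in> W" if j: "j \<in> J" for j
      proof (cases "E j *v u = 0 \<or> E k *v u = 0 \<and> th j = th k")
        case True
        then show ?thesis
        proof
          assume z: "E k *v u = 0 \<and> th j = th k"
          show ?thesis
          proof (cases "E j = 0")
            case False
            have "u = (\<Sum>j\<in>J. E j *v u)" using u(2) insert.hyps z by simp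
            then show ?thesis using insert.IH insert.prems u(1) j by blast
          qed (simp add: vec.subspace_0[OF W(1)])
        qed (simp add: vec.subspace_0[OF W(1)])
      next
        case False
        moreover from this have "E j \<noteq> 0" by force
        moreover have "E k *v u \<noteq> 0 \<Longrightarrow> E k \<noteq> 0" by force
        ultimately have "th j \<noteq> th k"
          using th_inj[of j k] D j insert.hyps(2) by metis
        then have "E j *v u = inverse (th j - th k) *s (E j *v v)"
          unfolding Ev[OF D(2)[OF j]] vector_smult_assoc by simp
        then show ?thesis using EvW[OF j] W(1) by (simp add: vec.subspace_scale)
      qed
      show "E j *v u \<in> W"
      proof (cases "j = k")
        case True
        have "E k *v u = u - (\<Sum>j\<in>J. E j *v u)" using u(2) insert.hyps by (simp add: algebra_simps)
        then show ?thesis using True W(1) EJ u(1) by (simp add: vec.subspace_diff vec.subspace_sum)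
      qed (use j EJ in auto)
    qed
  qed simp
  from this[of "{..D}"] show ?thesis using u i E_sum by simp
qed

text \<open>One nonzero vector from each component that W meets makes a basis. Counting for A and
  for B will show that both supports have the same size.\<close>

lemma thin_dim:
  assumes W: "vec.subspace W" "\<And>u. u \<in> W \<Longrightarrow> A *v u \<in> W"
    and thin: "\<And>i u u'. i \<le> D \<Longrightarrow> u \<in> W \<Longrightarrow> u' \<in> W \<Longrightarrow> E i *v u \<noteq> 0 \<Longrightarrow> \<exists>k. E i *v u' = k *s (E i *v u)"
  shows "vec.dim W = card {i. i \<le> D \<and> (\<exists>u\<in>W. E i *v u \<noteq> 0)}"
proof -
  define S where "S = {i. i \<le> D \<and> (\<exists>u\<in>W. E i *v u \<noteq> 0)}"
  have SD: "i \<le> D" if "i \<in> S" for i using that by (simp add: S_def)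
  define h where "h = (\<lambda>i. SOME u. u \<in> W \<and> E i *v u \<noteq> 0)"
  have h: "h i \<in> W \<and> E i *v h i \<noteq> 0" if "i \<in> S" for i
  proof -
    have "\<exists>u. u \<in> W \<and> E i *v u \<noteq> 0" using that unfolding S_def by blast
    then show ?thesis unfolding h_def by (rule someI_ex)
  qed
  define e where "e = (\<lambda>i. E i *v h i)"
  have Ee: "E j *v e i = (if j = i then e i else 0)" if "i \<in> S" "j \<le> D" for i j
    using SD that by (auto simp: e_def E_E)
  have e0: "e i \<noteq> 0" "e i \<in> W" if "i \<in> S" for i using h[OF that] SD[OF that] E_closed[OF W] by (auto simp: e_def)
  have inj: "inj_on e S"
  proof (rule inj_onI)
    fix i j assume a: "i \<in> S" "j \<in> S" "e i = e j"
    then show "i = j" using Ee[of i i] Ee[of j i] e0[of i] SD by (auto split: if_splits)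
  qed
  have "vec.independent (e ` S)"
    unfolding vec.independent_explicit_finite_subsets
  proof (intro allI impI ballI)
    fix R k v assume R: "R \<subseteq> e ` S" "finite R" and z: "(\<Sum>v\<in>R. k v *s v) = 0" and v: "v \<in> R"
    obtain i where i: "i \<in> S" "v = e i" using R v by auto
    have "E i *v (k w *s w) = (if w = v then k v *s v else 0)" if "w \<in> R" for w
    proof -
      obtain j where j: "j \<in> S" "w = e j" using R \<open>w \<in> R\<close> by auto
      then show ?thesis using i Ee[of j i] inj SD by (auto simp: inj_on_def)
    qed
    then have "E i *v (\<Sum>v\<in>R. k v *s v) = (\<Sum>w\<in>R. if w = v then k v *s v else 0)"
      unfolding mat_vec_sum by (intro sum.cong) auto
    then show "k v = 0" using z R(2) v e0[OF i(1)] i(2) by simp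
  qed
  moreover have "W \<subseteq> vec.span (e ` S)"
  proof
    fix u assume u: "u \<in> W"
    have "E i *v u \<in> vec.span (e ` S)" if "i \<le> D" for i
    proof (cases "E i *v u = 0")
      case False
      then have i: "i \<in> S" using u that unfolding S_def by blast
      obtain k where "E i *v u = k *s e i"
        using thin[of i "h i" u] h[OF i] u SD[OF i] by (auto simp: e_def)
      then show ?thesis using vec.span_scale[OF vec.span_base[OF imageI[OF i, of e]], of k] by simp
    qed (simp add: vec.span_zero)
    then show "u \<in> vec.span (e ` S)"
      using vec.span_sum[of "{..D}" "\<lambda>i. E i *v u" "e ` S"] by (simp add: E_sum)
  qed
  moreover have "e ` S \<subseteq> W" using e0 by blast
  ultimately have "vec.dim W = card (e ` S)" by (intro vec.dim_unique) auto
  then show ?thesis using inj by (simp add: card_image S_def)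
qed

lemma rev: "eigen A (\<lambda>i. E (D - i)) (\<lambda>i. th (D - i)) D"
proof
  have r: "bij_betw (\<lambda>i. D - i) {..D} {..D}"
    by (rule bij_betw_byWitness[where f' = "\<lambda>i. D - i"]) auto
  show "(\<Sum>i\<le>D. E (D - i)) = mat 1"
    using sum.reindex_bij_betw[OF r, of E] E_one by simp
  show "A = (\<Sum>i\<le>D. cmult (th (D - i)) (E (D - i)))"
    using sum.reindex_bij_betw[OF r, of "\<lambda>i. cmult (th i) (E i)"] A_eq by simp
  fix i j assume i: "i \<le> D" and j: "j \<le> D"
  show "E (D - i) ** E (D - j) = (if i = j then E (D - i) else 0)"
    using E_mult[of "D - i" "D - j"] i j by auto
  assume "E (D - i) \<noteq> 0" "E (D - j) \<noteq> 0" "th (D - i) = th (D - j)"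
  then show "i = j" using th_inj[of "D - i" "D - j"] i j by auto
qed

lemma cong_th: "(\<And>i. i \<le> D \<Longrightarrow> th' i = th i) \<Longrightarrow> eigen A E th' D"
  using E_mult E_one A_eq th_inj by unfold_locales simp_all

end

lemma lev_rev: "i \<le> D \<Longrightarrow> lev q (inverse s) D i = lev q s D (D - i)"
proof -
  assume "i \<le> D"
  then have "2 * int (D - i) - int D = int D - 2 * int i" "int D - 2 * int (D - i) = 2 * int i - int D" by auto
  then show ?thesis unfolding lev_def by simp
qed

text \<open>The idempotents and the vanishing conditions live on the whole space, as they come from
  the graph; irreducibility concerns W and is stated through subspaces invariant under A and B. No
  operator has to be restricted to W.\<close>

locale tridiag =
  a: eigen A E "lev q s D" D + b: eigen B Es "lev q t D" D
  for q s t :: complex and A B :: "'v::finite cmat" and E Es :: "nat \<Rightarrow> 'v cmat" and D :: nat +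
  fixes W :: "'v cvec set"
  assumes E_B_E: "i \<le> D \<Longrightarrow> j \<le> D \<Longrightarrow> Suc i < j \<or> Suc j < i \<Longrightarrow> E i ** B ** E j = 0"
    and Es_A_Es: "i \<le> D \<Longrightarrow> j \<le> D \<Longrightarrow> Suc i < j \<or> Suc j < i \<Longrightarrow> Es i ** A ** Es j = 0"
    and nz: "q \<noteq> 0" "s \<noteq> 0" "t \<noteq> 0" and q4: "q ^ 4 \<noteq> 1"
    and W: "vec.subspace W" and WA: "\<And>u. u \<in> W \<Longrightarrow> A *v u \<in> W" and WB: "\<And>u. u \<in> W \<Longrightarrow> B *v u \<in> W"
    and irr: "\<And>U. vec.subspace U \<Longrightarrow> (\<And>u. u \<in> U \<Longrightarrow> A *v u \<in> U) \<Longrightarrow> (\<And>u. u \<in> U \<Longrightarrow> B *v u \<in> U)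
        \<Longrightarrow> U \<subseteq> W \<Longrightarrow> U = {0} \<or> U = W"
begin

lemma dual: "tridiag q t s B A Es E D W"
  using E_B_E Es_A_Es nz q4 W WA WB irr by unfold_locales auto

text \<open>Reversal replaces s by its inverse and leaves the dual order alone, so results at the
  lower end of the E-support also give the upper end.\<close>

lemma revE: "tridiag q (inverse s) t A B (\<lambda>i. E (D - i)) Es D W"
proof -
  interpret r: eigen A "\<lambda>i. E (D - i)" "lev q (inverse s) D" D
    by (rule eigen.cong_th[OF a.rev]) (simp add: lev_rev)
  show ?thesis
  proof unfold_locales
    fix i j assume "i \<le> D" "j \<le> D" "Suc i < j \<or> Suc j < i"
    then show "E (D - i) ** B ** E (D - j) = 0" by (intro E_B_E) auto
  qed (use Es_A_Es nz q4 W WA WB irr in auto)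
qed

lemma EBE: "i \<le> D \<Longrightarrow> j \<le> D \<Longrightarrow> Suc i < j \<or> Suc j < i \<Longrightarrow> E i *v (B *v (E j *v u)) = 0"
  using arg_cong[OF E_B_E[of i j], of "\<lambda>M. M *v u"] by simp

lemma EsAEs: "i \<le> D \<Longrightarrow> j \<le> D \<Longrightarrow> Suc i < j \<or> Suc j < i \<Longrightarrow> Es i *v (A *v (Es j *v u)) = 0"
  using arg_cong[OF Es_A_Es[of i j], of "\<lambda>M. M *v u"] by simp

lemma EsA_sum: "i \<le> D \<Longrightarrow> Es i *v (A *v u) = (\<Sum>j\<le>D. Es i *v (A *v (Es j *v u)))"
  by (simp add: mat_vec_sum[symmetric] b.E_sum)

lemma EsW: "u \<in> W \<Longrightarrow> i \<le> D \<Longrightarrow> Es i *v u \<in> W"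
  using b.E_closed[OF W WB] .

text \<open>If A never raises index n on W, the vectors of W without components above n form a
  subspace invariant under A and B, nonzero because of u and proper because of v.\<close>

lemma cut:
  assumes n: "n < D" "\<And>u. u \<in> W \<Longrightarrow> Es (Suc n) *v (A *v (Es n *v u)) = 0"
    and lo: "i \<le> n" "u \<in> W" "Es i *v u \<noteq> 0" and hi: "n < j" "j \<le> D" "v \<in> W" "Es j *v v \<noteq> 0"
  shows False
proof -
  let ?U = "{u \<in> W. \<forall>m. n < m \<and> m \<le> D \<longrightarrow> Es m *v u = 0}"
  have "?U = {0} \<or> ?U = W"
  proof (rule irr)
    show "vec.subspace ?U" using W by (auto simp: vec.subspace_def matrix_vector_right_distrib)
    show "B *v u \<in> ?U" if "u \<in> ?U" for u using that WB by (auto simp: b.E_A)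
    show "A *v u \<in> ?U" if u: "u \<in> ?U" for u
    proof -
      have "Es m *v (A *v u) = 0" if m: "n < m" "m \<le> D" for m
      proof -
        have "Es m *v (A *v (Es k *v u)) = 0" if "k \<le> D" for k
        proof (cases "n < k")
          case True then show ?thesis using u that by simp
        next
          case False
          then show ?thesis using n(2)[of u] u m EsAEs[of m k u] that
            by (cases "k = n \<and> m = Suc n") auto
        qed
        then show ?thesis by (subst EsA_sum[OF m(2)]) simp
      qed
      then show ?thesis using u WA by auto
    qed
  qed auto
  moreover have "Es i *v u \<in> ?U" using lo n EsW by (auto simp: b.E_E)
  ultimately have "?U = W" using lo by auto
  then show False using hi by blast
qed

text \<open>At a gap in the support A could not raise any further, which \<open>cut\<close> forbids
  between two occupied indices.\<close>

lemma support_interval: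
  assumes "W \<noteq> {0}"
  obtains r d where "r + d \<le> D" "{i. i \<le> D \<and> (\<exists>u\<in>W. Es i *v u \<noteq> 0)} = {r..r + d}"
proof -
  let ?S = "{i. i \<le> D \<and> (\<exists>u\<in>W. Es i *v u \<noteq> 0)}"
  obtain u where u: "u \<in> W" "u \<noteq> 0" using assms vec.subspace_0[OF W] by blast
  then obtain i where "i \<le> D" "Es i *v u \<noteq> 0" using b.E_eqI[of u 0] by auto
  then have ne: "?S \<noteq> {}" and fin: "finite ?S" using u by auto
  note mm = Min_in[OF fin ne] Max_in[OF fin ne]
  have "j \<in> ?S" if "Min ?S \<le> j" "j \<le> Max ?S" for j
  proof (rule ccontr)
    assume j: "j \<notin> ?S"
    have "j \<le> D" using that mm by auto
    then have z: "Es j *v u = 0" if "u \<in> W" for u using j that by blast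
    have "j \<noteq> Max ?S" using j mm by metis
    then have lt: "j < Max ?S" using that by simp
    obtain u v where "u \<in> W" "Es (Min ?S) *v u \<noteq> 0" "v \<in> W" "Es (Max ?S) *v v \<noteq> 0" using mm by blast
    then show False using cut[of j "Min ?S" u "Max ?S" v] lt that mm z by auto
  qed
  then have sup: "{Min ?S..Max ?S} \<subseteq> ?S" by (meson atLeastAtMost_iff subsetI)
  have sub: "?S \<subseteq> {Min ?S..Max ?S}"
  proof
    fix i assume "i \<in> ?S"
    then show "i \<in> {Min ?S..Max ?S}" using Max_ge[OF fin] Min_le[OF fin] by (simp only: atLeastAtMost_iff)
  qed
  have le: "Min ?S \<le> Max ?S" using Max_ge[OF fin mm(1)] .
  have "Max ?S \<le> D" using mm(2) by blast
  then have "Min ?S + (Max ?S - Min ?S) \<le> D" using le by (simp only: le_add_diff_inverse)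
  moreover have "?S = {Min ?S..Min ?S + (Max ?S - Min ?S)}"
    unfolding le_add_diff_inverse[OF le] by (rule subset_antisym[OF sub sup])
  ultimately show ?thesis by (rule that)
qed

end

section \<open>Thin modules and the transfer of thinness to the other family of idempotents\<close>

locale thin_tridiag = tridiag +
  fixes rho d :: nat
  assumes thin_s: "i \<le> D \<Longrightarrow> u \<in> W \<Longrightarrow> u' \<in> W \<Longrightarrow> Es i *v u \<noteq> 0 \<Longrightarrow> \<exists>k. Es i *v u' = k *s (Es i *v u)"
    and rho_d: "rho + d \<le> D"
    and supp_s: "{i. i \<le> D \<and> (\<exists>u\<in>W. Es i *v u \<noteq> 0)} = {rho..rho + d}"
begin

lemma Es_zero: "i \<le> D \<Longrightarrow> i < rho \<or> rho + d < i \<Longrightarrow> u \<in> W \<Longrightarrow> Es i *v u = 0"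
proof (rule ccontr)
  assume "i \<le> D" "i < rho \<or> rho + d < i" "u \<in> W" "Es i *v u \<noteq> 0"
  moreover from this have "i \<in> {rho..rho + d}" unfolding supp_s[symmetric] by blast
  ultimately show False by auto
qed

lemma Es_nonzero: "rho \<le> i \<Longrightarrow> i \<le> rho + d \<Longrightarrow> \<exists>u\<in>W. Es i *v u \<noteq> 0"
proof -
  assume "rho \<le> i" "i \<le> rho + d"
  then have "i \<in> {rho..rho + d}" by simp
  then show ?thesis unfolding supp_s[symmetric] by simp
qed

lemma ex_w0: obtains w0 where "w0 \<in> W" "w0 \<noteq> 0" "Es rho *v w0 = w0"
proof -
  obtain u where "u \<in> W" "Es rho *v u \<noteq> 0" using Es_nonzero[of rho] by auto
  then show ?thesis using that[of "Es rho *v u"] EsW rho_d by (simp add: b.E_E)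
qed

lemma Es_w0: "Es rho *v w0 = w0 \<Longrightarrow> i \<le> D \<Longrightarrow> Es i *v w0 = (if i = rho then w0 else 0)"
  using b.E_E[of i rho w0] rho_d by auto

lemma raise_nonzero: "i < d \<Longrightarrow> \<exists>u\<in>W. Es (Suc (rho + i)) *v (A *v (Es (rho + i) *v u)) \<noteq> 0"
proof (rule ccontr)
  assume i: "i < d" and "\<not> ?thesis"
  moreover obtain u v where "u \<in> W" "Es rho *v u \<noteq> 0" "v \<in> W" "Es (rho + d) *v v \<noteq> 0"
    using Es_nonzero[of rho] Es_nonzero[of "rho + d"] by auto
  ultimately show False using cut[of "rho + i" rho u "rho + d" v] rho_d by auto
qed

text \<open>Induction over the layers from rho upwards: for a suitable x in K the component of A x
  in the next layer is nonzero, equals A x minus components already in K, and spans its layer by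
  thinness.\<close>

lemma cyclic:
  assumes K: "vec.subspace K" "K \<subseteq> W" "\<And>u. u \<in> K \<Longrightarrow> A *v u \<in> K"
    and w0: "w0 \<in> K" "w0 \<noteq> 0" "Es rho *v w0 = w0"
  shows "K = W"
proof -
  have "\<forall>j\<le>i. \<forall>u\<in>W. Es (rho + j) *v u \<in> K" if "i \<le> d" for i
    using that
  proof (induction i)
    case 0
    have "Es rho *v u \<in> K" if "u \<in> W" for u
    proof -
      obtain k where "Es rho *v u = k *s w0"
        using thin_s[of rho w0 u] \<open>u \<in> W\<close> w0 subsetD[OF K(2) w0(1)] rho_d by auto
      then show ?thesis using vec.subspace_scale[OF K(1) w0(1)] by simp
    qed
    then show ?case by simp
  next
    case (Suc i)
    then have IH: "\<And>j u. j \<le> i \<Longrightarrow> u \<in> W \<Longrightarrow> Es (rho + j) *v u \<in> K" by simp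
    obtain w where w: "w \<in> W" "Es (Suc (rho + i)) *v (A *v (Es (rho + i) *v w)) \<noteq> 0"
      using raise_nonzero[OF Suc_le_lessD[OF Suc.prems]] by blast
    define x where "x = Es (rho + i) *v w"
    have x: "x \<in> K" "x \<in> W" using IH w(1) K(2) by (auto simp: x_def)
    have "Es (rho + Suc i) *v (A *v x) = A *v x - (\<Sum>m\<in>{..D} - {rho + Suc i}. Es m *v (A *v x))"
      using b.E_sum[of "A *v x"] Suc.prems rho_d
      by (subst (asm) sum.remove[of _ "rho + Suc i"]) (auto simp: algebra_simps)
    moreover have "Es m *v (A *v x) \<in> K" if "m \<le> D" "m \<noteq> rho + Suc i" for m
    proof -
      consider "m < rho" | "m > Suc (rho + i)" | "rho \<le> m" "m \<le> rho + i"
        using \<open>m \<noteq> rho + Suc i\<close> by linarith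
      then show ?thesis
      proof cases
        case 1 then show ?thesis using Es_zero[of m] WA x that by (simp add: vec.subspace_0[OF K(1)])
      next
        case 2 then show ?thesis using EsAEs[of m "rho + i" w] that by (simp add: x_def vec.subspace_0[OF K(1)])
      next
        case 3 then show ?thesis using IH[of "m - rho" "A *v x"] WA x by simp
      qed
    qed
    ultimately have y: "Es (rho + Suc i) *v (A *v x) \<in> K"
      using K(1,3) x by (auto intro!: vec.subspace_diff vec.subspace_sum)
    have "Es (rho + Suc i) *v u \<in> K" if "u \<in> W" for u
    proof -
      have "rho + Suc i \<le> D" "Es (rho + Suc i) *v (A *v x) \<noteq> 0" using Suc.prems rho_d w(2) by (simp_all add: x_def)
      then obtain k where "Es (rho + Suc i) *v u = k *s (Es (rho + Suc i) *v (A *v x))"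
        using thin_s[of "rho + Suc i" "A *v x" u] \<open>u \<in> W\<close> WA x(2) by blast
      then show ?thesis using vec.subspace_scale[OF K(1) y] by simp
    qed
    then show ?case using IH by (metis le_Suc_eq)
  qed
  then have *: "Es (rho + j) *v u \<in> K" if "j \<le> d" "u \<in> W" for j u using that by blast
  have "Es i *v u \<in> K" if "i \<le> D" "u \<in> W" for i u
  proof (cases "rho \<le> i \<and> i \<le> rho + d")
    case True
    then show ?thesis using *[of "i - rho" u] that by auto
  qed (use Es_zero[of i u] that vec.subspace_0[OF K(1)] in auto)
  then have "u \<in> K" if "u \<in> W" for u
    using vec.subspace_sum[OF K(1), of "{..D}" "\<lambda>i. Es i *v u"] that by (simp add: b.E_sum)
  then show ?thesis using K(2) by blast
qed

text \<open>The vectors u with this property form an A-invariant subspace containing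
  \<open>w0\<close>, so cyclicity applies. Thinness is thereby carried from the \<open>Es\<close> to
  the \<open>E\<close>.\<close>

lemma E_span:
  assumes "w0 \<in> W" "w0 \<noteq> 0" "Es rho *v w0 = w0" "i \<le> D" "u \<in> W"
  obtains k where "E i *v u = k *s (E i *v w0)"
proof -
  let ?K = "{u \<in> W. \<exists>k. E i *v u = k *s (E i *v w0)}"
  have "?K = W"
  proof (rule cyclic)
    show "vec.subspace ?K"
      unfolding vec.subspace_def
    proof (intro conjI ballI allI)
      show "0 \<in> ?K"
        using vec.subspace_0[OF W] by (auto intro: exI[of _ 0])
      fix x y c assume x: "x \<in> ?K" and y: "y \<in> ?K"
      then obtain k l where "E i *v x = k *s (E i *v w0)" "E i *v y = l *s (E i *v w0)" by blast
      then have "E i *v (x + y) = (k + l) *s (E i *v w0)" "E i *v (c *s x) = (c * k) *s (E i *v w0)"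
        by (simp_all add: matrix_vector_right_distrib vec.scale_left_distrib)
      then show "x + y \<in> ?K" "c *s x \<in> ?K"
        using x y vec.subspace_add[OF W] vec.subspace_scale[OF W] by blast+
    qed
    show "w0 \<in> ?K" using assms by (auto intro: exI[of _ 1])
    show "A *v u \<in> ?K" if "u \<in> ?K" for u
      using that WA assms(4) by (auto simp: a.E_A)
  qed (use assms in auto)
  then show ?thesis using that assms(5) by blast
qed

lemma thin_E:
  assumes "i \<le> D" "u \<in> W" "u' \<in> W" "E i *v u \<noteq> 0"
  shows "\<exists>k. E i *v u' = k *s (E i *v u)"
proof -
  obtain w0 where w0: "w0 \<in> W" "w0 \<noteq> 0" "Es rho *v w0 = w0" by (rule ex_w0)
  obtain k l where "E i *v u = k *s (E i *v w0)" "E i *v u' = l *s (E i *v w0)"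
    using E_span[OF w0 assms(1)] assms(2,3) by metis
  then show ?thesis using assms(4) by (intro exI[of _ "l / k"]) auto
qed

lemma E_w0_nonzero:
  assumes "w0 \<in> W" "w0 \<noteq> 0" "Es rho *v w0 = w0" "i \<le> D" "u \<in> W" "E i *v u \<noteq> 0"
  shows "E i *v w0 \<noteq> 0"
  using E_span[OF assms(1-5)] assms(6) by force

lemma W_nonzero: "W \<noteq> {0}"
proof -
  obtain w0 where "w0 \<in> W" "w0 \<noteq> 0" by (rule ex_w0)
  then show ?thesis by blast
qed

text \<open>The dimension of W, counted along the \<open>E\<close> and along the \<open>Es\<close>,
  forces the two supports to have the same length.\<close>

lemma dual_support:
  obtains tau where "tau + d \<le> D" "{i. i \<le> D \<and> (\<exists>u\<in>W. E i *v u \<noteq> 0)} = {tau..tau + d}"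
proof -
  obtain tau d' where t: "tau + d' \<le> D" "{i. i \<le> D \<and> (\<exists>u\<in>W. E i *v u \<noteq> 0)} = {tau..tau + d'}"
    by (rule tridiag.support_interval[OF dual W_nonzero])
  have "card {tau..tau + d'} = card {rho..rho + d}"
    using a.thin_dim[OF W WA thin_E] b.thin_dim[OF W WB thin_s] unfolding t(2) supp_s by simp
  then have "d' = d" by simp
  then show ?thesis using that t by blast
qed

end

section \<open>The Askey-Wilson relations\<close>

text \<open>The first identity will remove from X the entries two steps off the dual diagonal, the
  second its entries one step off the diagonal with respect to the \<open>E\<close>.\<close>

lemma lev_recurrence:
  assumes "q \<noteq> 0" "s \<noteq> 0"
  shows "lev q s D i + lev q s D (Suc (Suc i)) = (q^2 + inverse q ^ 2) * lev q s D (Suc i)"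
    and "(lev q s D i)^2 - (q^2 + inverse q ^ 2) * lev q s D i * lev q s D (Suc i) + (lev q s D (Suc i))^2
      + (q^2 - inverse q ^ 2)^2 = 0"
proof -
  \<comment> \<open>The first summand at index i; a shift by k multiplies it by q^(2k), so no
    integer exponents remain in the identities.\<close>
  define T where "T = s * q powi (2 * int i - int D)"
  have T: "T \<noteq> 0" using assms by (simp add: T_def)
  have l: "lev q s D (i + k) = T * q ^ (2 * k) + inverse T * inverse q ^ (2 * k)" for k
  proof -
    have 1: "2 * int (i + k) - int D = (2 * int i - int D) + int (2 * k)"
      and 2: "int D - 2 * int (i + k) = - (2 * int i - int D) + - int (2 * k)" by simp_all
    have 3: "q powi ((2 * int i - int D) + int (2 * k)) = q powi (2 * int i - int D) * q ^ (2 * k)"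
      using assms by (simp only: power_int_add power_int_of_nat simp_thms)
    have "- (2 * int i - int D) + - int (2 * k) = - ((2 * int i - int D) + int (2 * k))" by simp
    then have 4: "q powi (- (2 * int i - int D) + - int (2 * k)) = inverse (q powi (2 * int i - int D) * q ^ (2 * k))"
      by (simp only: power_int_minus 3)
    show ?thesis
      unfolding lev_def 1 2 3 4 T_def by (simp add: power_inverse)
  qed
  have l0: "lev q s D i = T + inverse T" and l1: "lev q s D (Suc i) = T * q ^ 2 + inverse T * inverse q ^ 2"
    and l2: "lev q s D (Suc (Suc i)) = T * q ^ 4 + inverse T * inverse q ^ 4"
    using l[of 0] l[of 1] l[of 2] by simp_all
  show "lev q s D i + lev q s D (Suc (Suc i)) = (q^2 + inverse q ^ 2) * lev q s D (Suc i)"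
    unfolding l0 l1 l2 using assms T by (simp add: field_simps power2_eq_square power4_eq_xxxx)
  show "(lev q s D i)^2 - (q^2 + inverse q ^ 2) * lev q s D i * lev q s D (Suc i) + (lev q s D (Suc i))^2
      + (q^2 - inverse q ^ 2)^2 = 0"
    unfolding l0 l1 using assms T by (simp add: field_simps power2_eq_square)
qed

text \<open>The linear system satisfied by the corner entries \<open>x, y, z\<close> and the coefficients of the
  Askey-Wilson relations; here \<open>p\<close> stands for \<open>q ^ d\<close>.\<close>
lemma aw_scalars:
  fixes a b p q k x y z e m ms :: complex
  assumes nz: "q \<noteq> 0" "p \<noteq> 0" "a \<noteq> 0" "b \<noteq> 0"
    and T: "T0 = a / p + p / a" "T1 = a * q^2 / p + p / (a * q^2)"
      "U0 = a * p + 1 / (a * p)" "U1 = a * p / q^2 + q^2 / (a * p)"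
      "S0 = b / p + p / b" "S1 = b * q^2 / p + p / (b * q^2)"
    and neq: "T0 \<noteq> T1" "U0 \<noteq> U1" "S0 \<noteq> S1" "T0 \<noteq> U0" "q^2 \<noteq> 1"
    and R1: "(x - T0) * (S0 - S1) = (y - S0) * (T0 - T1)"
    and R2: "(x - U0) * (S0 - S1) = (z - S0) * (U0 - U1)"
    and P: "\<And>t. P t = (2 - (q^2 + inverse q ^ 2)) * t^2 + (q^2 - inverse q ^ 2)^2"
    and P1: "P T0 * y = e * T0 + m" and P2: "P U0 * z = e * U0 + m" and P3: "P S0 * x = e * S0 + ms"
    and k: "(S0 - S1) * (x - U0) = (q - 1 / q) * (p - 1 / p) * (k - a * p / (b * q) - b * q / (a * p))"
    and L: "L = q * p + 1 / (q * p)"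
  shows "e = - (k * L + (a + 1 / a) * (b + 1 / b)) * (q - 1 / q)^2"
    and "m = ((b + 1 / b) * L + k * (a + 1 / a)) * (q - 1 / q) * (q^2 - 1 / q^2)"
    and "ms = ((a + 1 / a) * L + (b + 1 / b) * k) * (q - 1 / q) * (q^2 - 1 / q^2)"
proof -
  \<comment> \<open>F is \<phi>_1 divided by (q - 1/q)(p - 1/p), that is, the part of \<kappa>
    beyond its two explicit terms; h and r abbreviate the factors of that denominator.\<close>
  define F where "F = k - a * p / (b * q) - b * q / (a * p)"
  define h where "h = q - 1 / q"
  define r where "r = p - 1 / p"
  have h0: "h \<noteq> 0" using nz neq(5) by (auto simp: h_def field_simps power2_eq_square)
  \<comment> \<open>The diagonal coefficient of X factors at t + 1/t, and at the ends one factor is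
    a multiple of T0 - T1, U0 - U1 or S0 - S1. The equations \<open>R1\<close>, \<open>R2\<close>
    and \<open>k\<close> can then be inserted without any division.\<close>
  have Pf: "P (t + 1 / t) = - (h^2) * (t * q - 1 / (t * q)) * (t / q - q / t)" if "t \<noteq> 0" for t
    unfolding P h_def using nz that by (simp add: field_simps power2_eq_square)
  have T01: "T0 - T1 = - h * (a / p * q - 1 / (a / p * q))"
    unfolding T h_def using nz by (simp add: field_simps power2_eq_square)
  have U01: "U0 - U1 = h * (a * p / q - q / (a * p))"
    unfolding T h_def using nz by (simp add: field_simps power2_eq_square)
  have S01: "S0 - S1 = - h * (b / p * q - 1 / (b / p * q))"
    unfolding T h_def using nz by (simp add: field_simps power2_eq_square)
  have TU: "T0 - U0 = - (a - 1 / a) * r"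
    unfolding T r_def using nz by (simp add: field_simps power2_eq_square)
  have PT: "P T0 = - (h^2) * (a / p * q - 1 / (a / p * q)) * (a / p / q - q / (a / p))"
    using Pf[of "a / p"] nz by (simp add: T)
  have PU: "P U0 = - (h^2) * (a * p * q - 1 / (a * p * q)) * (a * p / q - q / (a * p))"
    using Pf[of "a * p"] nz by (simp add: T)
  have PS: "P S0 = - (h^2) * (b / p * q - 1 / (b / p * q)) * (b / p / q - q / (b / p))"
    using Pf[of "b / p"] nz by (simp add: T)
  have k': "(S0 - S1) * (x - U0) = h * r * F" using k by (simp add: h_def r_def F_def)
  have z: "P U0 * z = P U0 * S0 - h^2 * (a * p * q - 1 / (a * p * q)) * r * F"
  proof -
    have "P U0 * (z - S0) = - h * (a * p * q - 1 / (a * p * q)) * ((z - S0) * (U0 - U1))"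
      unfolding PU U01 by (simp add: power2_eq_square)
    also have "(z - S0) * (U0 - U1) = h * r * F" using k' R2 by (simp add: mult.commute)
    finally show ?thesis by (simp add: algebra_simps power2_eq_square)
  qed
  have y: "P T0 * y = P T0 * S0 + h * (a / p / q - q / (a / p)) * (h * r * F + (U0 - T0) * (S0 - S1))"
  proof -
    have "P T0 * (y - S0) = h * (a / p / q - q / (a / p)) * ((y - S0) * (T0 - T1))"
      unfolding PT T01 by (simp add: power2_eq_square)
    also have "(y - S0) * (T0 - T1) = (x - T0) * (S0 - S1)" using R1 by simp
    also have "\<dots> = h * r * F + (U0 - T0) * (S0 - S1)" using k' by (simp add: algebra_simps)
    finally show ?thesis by (simp add: algebra_simps)
  qed
  have x: "P S0 * x = P S0 * U0 + h * (b / p / q - q / (b / p)) * (h * r * F)"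
  proof -
    have "P S0 * (x - U0) = h * (b / p / q - q / (b / p)) * ((S0 - S1) * (x - U0))"
      unfolding PS S01 by (simp add: power2_eq_square)
    then show ?thesis unfolding k' by (simp add: algebra_simps)
  qed
  let ?e = "- (k * L + (a + 1 / a) * (b + 1 / b)) * h^2"
  \<comment> \<open>Subtracting the two diagonal equations removes m, and e can be read off because
    T0 and U0 differ.\<close>
  have "e * (T0 - U0) = P T0 * y - P U0 * z" using P1 P2 by (simp add: algebra_simps)
  also have "\<dots> = ?e * (T0 - U0)"
    unfolding z y unfolding PT PU S01 TU minus_diff_eq[symmetric, of U0 T0] unfolding T F_def r_def L h_def
    using nz by (simp add: field_simps power2_eq_square)
  finally have e: "e = ?e" using neq(4) by simp
  then show "e = - (k * L + (a + 1 / a) * (b + 1 / b)) * (q - 1 / q)^2" by (simp add: h_def)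
  have "m = P U0 * z - ?e * U0" using P2 e by (simp add: algebra_simps)
  also have "\<dots> = ((b + 1 / b) * L + k * (a + 1 / a)) * (q - 1 / q) * (q^2 - 1 / q^2)"
    unfolding z unfolding PU unfolding T F_def r_def L h_def
    using nz by (simp add: field_simps power2_eq_square)
  finally show "m = ((b + 1 / b) * L + k * (a + 1 / a)) * (q - 1 / q) * (q^2 - 1 / q^2)" .
  have "ms = P S0 * x - ?e * S0" using P3 e by (simp add: algebra_simps)
  also have "\<dots> = ((a + 1 / a) * L + (b + 1 / b) * k) * (q - 1 / q) * (q^2 - 1 / q^2)"
    unfolding x unfolding PS unfolding T F_def r_def L h_def
    using nz by (simp add: field_simps power2_eq_square)
  finally show "ms = ((a + 1 / a) * L + (b + 1 / b) * k) * (q - 1 / q) * (q^2 - 1 / q^2)" .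
qed

text \<open>The expression X evaluated at u; exchanging A and B gives Y. It is a function of vectors
  because the linear relation for it is claimed on W alone.\<close>

definition aw :: "complex \<Rightarrow> 'v::finite cmat \<Rightarrow> 'v cmat \<Rightarrow> 'v cvec \<Rightarrow> 'v cvec" where
  "aw q A B u = A *v (A *v (B *v u)) - (q^2 + inverse q ^ 2) *s (A *v (B *v (A *v u)))
     + B *v (A *v (A *v u)) + ((q^2 - inverse q ^ 2)^2) *s (B *v u)"

lemma aw_add: "aw q A B (u + w) = aw q A B u + aw q A B w"
  by (simp add: aw_def matrix_vector_right_distrib vec.scale_right_distrib)

lemma aw_scale: "aw q A B (c *s u) = c *s aw q A B u"
  by (simp add: aw_def vec_eq_iff algebra_simps)

lemma aw_sum: "aw q A B (sum f I) = (\<Sum>i\<in>I. aw q A B (f i))"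
  by (simp add: aw_def mat_vec_sum vec.scale_sum_right sum.distrib sum_subtractf)

text \<open>The terms with \<rho> cancel, and so do BA^2B on the left and AB^2A on the right; both
  sides become A^2B^2 - B^2A^2 - \<beta>(ABAB - BABA).\<close>

lemma aw_commutator:
  "aw q A B (B *v u) - B *v aw q A B u = A *v aw q B A u - aw q B A (A *v u)"
  by (simp add: aw_def matrix_vector_right_distrib matrix_vector_mult_diff_distrib)

context tridiag
begin

lemma E_aw:
  assumes "i \<le> D" "j \<le> D"
  shows "E j *v aw q A B (E i *v u) = ((lev q s D j)^2 - (q^2 + inverse q ^ 2) * lev q s D j * lev q s D i
      + (lev q s D i)^2 + (q^2 - inverse q ^ 2)^2) *s (E j *v (B *v (E i *v u)))"
  using assms
  by (simp add: aw_def matrix_vector_right_distrib matrix_vector_mult_diff_distrib a.E_A a.A_E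
      vec_eq_iff algebra_simps power2_eq_square)

text \<open>Beyond neighbours the entry of B vanishes; between neighbours the coefficient in
  \<open>E_aw\<close> is the quadratic expression that \<open>lev_recurrence\<close> makes
  zero.\<close>

lemma E_aw_zero: "i \<le> D \<Longrightarrow> j \<le> D \<Longrightarrow> i \<noteq> j \<Longrightarrow> E j *v aw q A B (E i *v u) = 0"
proof -
  assume i: "i \<le> D" "j \<le> D" "i \<noteq> j"
  then consider "Suc i < j \<or> Suc j < i" | "j = Suc i" | "i = Suc j" by linarith
  then show ?thesis
  proof cases
    case 1 then show ?thesis using E_aw[OF i(1,2)] EBE[of j i] i by auto
  next
    case 2
    then show ?thesis unfolding E_aw[OF i(1,2)]
      using lev_recurrence(2)[OF nz(1,2), of D i] by (simp add: algebra_simps)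
  next
    case 3
    then show ?thesis unfolding E_aw[OF i(1,2)]
      using lev_recurrence(2)[OF nz(1,2), of D j] by (simp add: algebra_simps)
  qed
qed

text \<open>X is block diagonal for the \<open>E i\<close>, and A is a scalar on each block.\<close>

lemma aw_A: "aw q A B (A *v u) = A *v aw q A B u"
proof -
  have "aw q A B (A *v (E i *v u)) = A *v aw q A B (E i *v u)" if i: "i \<le> D" for i
  proof (rule a.E_eqI)
    fix j assume j: "j \<le> D"
    show "E j *v aw q A B (A *v (E i *v u)) = E j *v (A *v aw q A B (E i *v u))"
      using E_aw_zero[OF i j, of u] by (cases "i = j") (auto simp: a.A_E i aw_scale a.E_A j)
  qed
  then have "(\<Sum>i\<le>D. aw q A B (A *v (E i *v u))) = (\<Sum>i\<le>D. A *v aw q A B (E i *v u))"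
    by (intro sum.cong) auto
  then show ?thesis by (simp only: aw_sum[symmetric] mat_vec_sum[symmetric] a.E_sum)
qed

text \<open>At distance two A passes only through the index k in between, where the coefficient is
  the sum of the outer dual eigenvalues minus \<beta> times the middle one, zero by the recurrence.
  Farther apart there is no such k.\<close>

lemma Es_aw:
  assumes m: "m \<le> D" and n: "n \<le> D" and far: "Suc n < m \<or> Suc m < n"
  shows "Es m *v aw q A B (Es n *v u) = 0"
proof -
  let ?b = "q^2 + inverse q ^ 2" and ?l = "lev q t D"
  have AkA: "Es m *v (A *v (A *v (Es n *v u))) = (\<Sum>k\<le>D. Es m *v (A *v (Es k *v (A *v (Es n *v u)))))"
    by (simp only: mat_vec_sum[symmetric] b.E_sum)
  have ABA: "Es m *v (A *v (B *v (A *v (Es n *v u)))) = (\<Sum>k\<le>D. ?l k *s (Es m *v (A *v (Es k *v (A *v (Es n *v u))))))"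
  proof -
    have "B *v (A *v (Es n *v u)) = (\<Sum>k\<le>D. ?l k *s (Es k *v (A *v (Es n *v u))))"
      unfolding b.A_eq sum_mat_vec cmult_vec ..
    then show ?thesis by (simp only: mat_vec_sum mat_vec_scale)
  qed
  have "Es m *v aw q A B (Es n *v u) = (?l n + ?l m) *s (Es m *v (A *v (A *v (Es n *v u))))
      - ?b *s (Es m *v (A *v (B *v (A *v (Es n *v u)))))"
    using EsAEs[OF m n, of u] far m n b.E_E[OF m n, of u]
    by (cases "m = n") (simp_all add: aw_def matrix_vector_right_distrib matrix_vector_mult_diff_distrib b.E_A b.A_E
        vec.scale_left_distrib)
  also have "\<dots> = (\<Sum>k\<le>D. (?l n + ?l m - ?b * ?l k) *s (Es m *v (A *v (Es k *v (A *v (Es n *v u))))))"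
    unfolding AkA ABA vec.scale_sum_right sum_subtractf[symmetric]
    by (simp add: vec.scale_left_diff_distrib)
  also have "\<dots> = 0"
  proof (intro sum.neutral ballI)
    fix k assume "k \<in> {..D}"
    then have k: "k \<le> D" by simp
    consider "Suc k < m \<or> Suc m < k" | "Suc n < k \<or> Suc k < n" | "m = Suc k" "k = Suc n" | "n = Suc k" "k = Suc m"
      using far by linarith
    then show "(?l n + ?l m - ?b * ?l k) *s (Es m *v (A *v (Es k *v (A *v (Es n *v u))))) = 0"
    proof cases
      case 1 then show ?thesis using EsAEs[OF m k] by auto
    next
      case 2 then show ?thesis using EsAEs[OF k n] by auto
    next
      case 3 then show ?thesis using lev_recurrence(1)[OF nz(1,3), of D n] by simp
    next
      case 4 then show ?thesis using lev_recurrence(1)[OF nz(1,3), of D m] by (simp add: add.commute)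
    qed
  qed
  finally show ?thesis .
qed

end

section \<open>Leonard systems: both supports are intervals of the same length\<close>

locale leonard = thin_tridiag +
  fixes tau :: nat
  assumes tau_d: "tau + d \<le> D"
    and supp_E: "{i. i \<le> D \<and> (\<exists>u\<in>W. E i *v u \<noteq> 0)} = {tau..tau + d}"
begin

lemma leonard_dual: "leonard q t s B A Es E D W tau d rho"
proof -
  interpret d: tridiag q t s B A Es E D W by (rule dual)
  show ?thesis
    by unfold_locales (use thin_E tau_d supp_E rho_d supp_s in auto)
qed

lemma leonard_rev: "leonard q (inverse s) t A B (\<lambda>i. E (D - i)) Es D W rho d (D - (tau + d))"
proof -
  interpret r: tridiag q "inverse s" t A B "\<lambda>i. E (D - i)" Es D W by (rule revE)
  have "i \<le> D \<and> (\<exists>u\<in>W. E (D - i) *v u \<noteq> 0) \<longleftrightarrow> i \<le> D \<and> D - i \<in> {tau..tau + d}" for i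
    unfolding supp_E[symmetric] by auto
  moreover have "i \<le> D \<and> D - i \<in> {tau..tau + d} \<longleftrightarrow> i \<in> {D - (tau + d)..D - (tau + d) + d}" for i
    using tau_d by auto
  ultimately have "{i. i \<le> D \<and> (\<exists>u\<in>W. E (D - i) *v u \<noteq> 0)} = {D - (tau + d)..D - (tau + d) + d}"
    by blast
  then show ?thesis
    by unfold_locales (use thin_s rho_d supp_s tau_d in auto)
qed

lemma E_nonzero: "tau \<le> i \<Longrightarrow> i \<le> tau + d \<Longrightarrow> \<exists>u\<in>W. E i *v u \<noteq> 0"
  by (rule thin_tridiag.Es_nonzero[OF leonard.axioms(1)[OF leonard_dual]])

lemma E_zero: "i \<le> D \<Longrightarrow> i < tau \<or> tau + d < i \<Longrightarrow> u \<in> W \<Longrightarrow> E i *v u = 0"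
  by (rule thin_tridiag.Es_zero[OF leonard.axioms(1)[OF leonard_dual]])

lemma lev_distinct:
  assumes "tau \<le> i" "i \<le> tau + d" "tau \<le> j" "j \<le> tau + d" "i \<noteq> j"
  shows "lev q s D i \<noteq> lev q s D j"
proof -
  have "E i \<noteq> 0" "E j \<noteq> 0" using E_nonzero[of i] E_nonzero[of j] assms by force+
  then show ?thesis using a.th_inj[of i j] assms tau_d by auto
qed

lemma ex_corner:
  obtains x where "\<And>u. u \<in> W \<Longrightarrow> Es rho *v (A *v (Es rho *v u)) = x *s (Es rho *v u)"
proof -
  obtain w0 where w0: "w0 \<in> W" "w0 \<noteq> 0" "Es rho *v w0 = w0" by (rule ex_w0)
  have r: "rho \<le> D" using rho_d by simp
  obtain x where x: "Es rho *v (A *v w0) = x *s w0"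
    using thin_s[OF r w0(1) WA[OF w0(1)]] w0 by auto
  show ?thesis
  proof (rule that)
    fix u assume "u \<in> W"
    then obtain k where "Es rho *v u = k *s w0" using thin_s[OF r w0(1)] w0 by force
    then show "Es rho *v (A *v (Es rho *v u)) = x *s (Es rho *v u)"
      by (simp add: x mult.commute)
  qed
qed

text \<open>Both sides evaluate \<open>E\<^sub>\<tau> B A w\<^sub>0\<close>, once by letting \<open>A\<close> act on \<open>w\<^sub>0\<close> and once by
  letting \<open>E\<^sub>\<tau> B\<close> act from the left.\<close>
lemma corner:
  assumes d: "1 \<le> d"
    and x: "\<And>u. u \<in> W \<Longrightarrow> Es rho *v (A *v (Es rho *v u)) = x *s (Es rho *v u)"
    and y: "\<And>u. u \<in> W \<Longrightarrow> E tau *v (B *v (E tau *v u)) = y *s (E tau *v u)"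
  shows "(x - lev q s D tau) * (lev q t D rho - lev q t D (Suc rho))
    = (y - lev q t D rho) * (lev q s D tau - lev q s D (Suc tau))"
proof -
  obtain w0 where w0: "w0 \<in> W" "w0 \<noteq> 0" "Es rho *v w0 = w0" by (rule ex_w0)
  have r: "rho \<le> D" "Suc rho \<le> D" "tau \<le> D" "Suc tau \<le> D" using rho_d tau_d d by auto
  let ?f = "E tau *v w0"
  have f: "?f \<noteq> 0" using E_w0_nonzero[OF w0 r(3)] E_nonzero[of tau] by auto
  have Bw0: "B *v w0 = lev q t D rho *s w0" using b.A_E[OF r(1), of w0] w0 by simp
  \<comment> \<open>A w0 lives in the layers rho and rho + 1. Its part at rho is x w0, so the other
    part is A w0 - x w0, and B A w0 becomes a combination of w0 and A w0.\<close>
  have Aw0: "Es i *v (A *v w0) = (if i = rho then x *s w0 else if i = Suc rho then A *v w0 - x *s w0 else 0)"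
    if i: "i \<le> D" for i
  proof -
    have far: "Es k *v (A *v w0) = 0" if "k \<le> D" "k \<noteq> rho" "k \<noteq> Suc rho" for k
    proof (cases "k < rho")
      case True then show ?thesis using Es_zero[of k] WA w0 that by auto
    next
      case False then show ?thesis using EsAEs[of k rho w0] w0 r that by auto
    qed
    have lo: "Es rho *v (A *v w0) = x *s w0" using x[OF w0(1)] w0 by simp
    have "A *v w0 = (\<Sum>k\<le>D. Es k *v (A *v w0))" by (simp add: b.E_sum)
    also have "\<dots> = (\<Sum>k\<in>{rho, Suc rho}. Es k *v (A *v w0))"
      using r far by (intro sum.mono_neutral_right) auto
    finally have "A *v w0 = x *s w0 + Es (Suc rho) *v (A *v w0)" using lo by simp
    then have "Es (Suc rho) *v (A *v w0) = A *v w0 - x *s w0" by (simp add: algebra_simps)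
    then show ?thesis using far lo i by auto
  qed
  have "B *v (A *v w0) = (\<Sum>i\<le>D. lev q t D i *s (Es i *v (A *v w0)))"
    unfolding b.A_eq sum_mat_vec cmult_vec ..
  also have "\<dots> = (\<Sum>i\<in>{rho, Suc rho}. lev q t D i *s (Es i *v (A *v w0)))"
    using r by (intro sum.mono_neutral_right) (auto simp: Aw0)
  also have "\<dots> = (lev q t D rho * x) *s w0 + lev q t D (Suc rho) *s (A *v w0 - x *s w0)"
    using r by (simp add: Aw0)
  finally have BA: "B *v (A *v w0) = (lev q t D rho * x) *s w0 + lev q t D (Suc rho) *s (A *v w0 - x *s w0)" .
  have 1: "E tau *v (B *v (A *v w0)) = (lev q t D rho * x + lev q t D (Suc rho) * (lev q s D tau - x)) *s ?f"
    unfolding BA by (simp add: matrix_vector_right_distrib matrix_vector_mult_diff_distrib a.E_A r vec_eq_iff algebra_simps)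
  have EB: "E tau *v (B *v u) = y *s (E tau *v u) + E tau *v (B *v (E (Suc tau) *v u))" if u: "u \<in> W" for u
  proof -
    have z: "E tau *v (B *v (E k *v u)) = 0" if "k \<le> D" "k \<noteq> tau" "k \<noteq> Suc tau" for k
    proof (cases "k < tau")
      case True then show ?thesis using E_zero[of k u] u that by auto
    next
      case False then show ?thesis using EBE[of tau k u] r that by auto
    qed
    have "E tau *v (B *v u) = (\<Sum>k\<le>D. E tau *v (B *v (E k *v u)))"
      by (simp only: mat_vec_sum[symmetric] a.E_sum)
    also have "\<dots> = (\<Sum>k\<in>{tau, Suc tau}. E tau *v (B *v (E k *v u)))"
      using r z by (intro sum.mono_neutral_right) auto
    finally show ?thesis using y[OF u] by simp
  qed
  have "E tau *v (B *v (A *v w0)) = (lev q s D tau * y) *s ?f + lev q s D (Suc tau) *s (E tau *v (B *v (E (Suc tau) *v w0)))"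
    using EB[OF WA[OF w0(1)]] r by (simp add: a.E_A mult.commute)
  \<comment> \<open>The off-diagonal entry of B is unknown. Applying the splitting \<open>EB\<close>
    to w0, on which B is a scalar, eliminates it.\<close>
  also have "E tau *v (B *v (E (Suc tau) *v w0)) = (lev q t D rho - y) *s ?f"
    using EB[OF w0(1)] by (simp add: Bw0 vec.scale_left_diff_distrib algebra_simps)
  finally have 2: "E tau *v (B *v (A *v w0)) = (lev q s D tau * y + lev q s D (Suc tau) * (lev q t D rho - y)) *s ?f"
    by (simp add: vec.scale_left_distrib vec.scale_left_diff_distrib right_diff_distrib)
  from 1 2 f have "lev q t D rho * x + lev q t D (Suc rho) * (lev q s D tau - x)
      = lev q s D tau * y + lev q s D (Suc tau) * (lev q t D rho - y)" by (metis vector_mul_rcancel)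
  then show ?thesis by (simp add: algebra_simps)
qed

lemma raise_w0:
  assumes "1 \<le> d" "w0 \<in> W" "w0 \<noteq> 0" "Es rho *v w0 = w0"
  shows "Es (Suc rho) *v (A *v w0) \<noteq> 0"
proof
  assume z: "Es (Suc rho) *v (A *v w0) = 0"
  obtain u where u: "u \<in> W" "Es (Suc rho) *v (A *v (Es rho *v u)) \<noteq> 0"
    using raise_nonzero[of 0] assms(1) by auto
  obtain k where "Es rho *v u = k *s w0" using thin_s[of rho w0 u] assms rho_d u(1) by force
  then show False using u z by simp
qed

text \<open>\<open>X\<close> commutes with \<open>A\<close>, and \<open>X w\<^sub>0\<close> has components only at \<open>\<rho>\<close> and \<open>\<rho> + 1\<close>.\<close>
lemma aw_linear:
  assumes d: "1 \<le> d"
  obtains e m where "\<And>u. u \<in> W \<Longrightarrow> aw q A B u = e *s (A *v u) + m *s u"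
proof -
  obtain w0 where w0: "w0 \<in> W" "w0 \<noteq> 0" "Es rho *v w0 = w0" by (rule ex_w0)
  have r: "rho \<le> D" "Suc rho \<le> D" using rho_d d by auto
  have Xw: "aw q A B w0 \<in> W"
    unfolding aw_def using W w0 WA WB by (intro vec.subspace_add vec.subspace_diff vec.subspace_scale) auto
  note Aw = WA[OF w0(1)]
  \<comment> \<open>e is fixed by the layer rho + 1, where A w0 does not vanish; the constant k - e
    * l then matches the layer rho.\<close>
  obtain e where e: "Es (Suc rho) *v aw q A B w0 = e *s (Es (Suc rho) *v (A *v w0))"
    using thin_s[OF r(2) Aw Xw raise_w0[OF d w0]] by blast
  obtain k l where kl: "Es rho *v aw q A B w0 = k *s w0" "Es rho *v (A *v w0) = l *s w0"
    using thin_s[OF r(1) w0(1) Xw] thin_s[OF r(1) w0(1) Aw] w0 by auto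
  let ?K = "{u \<in> W. aw q A B u = e *s (A *v u) + (k - e * l) *s u}"
  have "aw q A B w0 = e *s (A *v w0) + (k - e * l) *s w0"
  proof (rule b.E_eqI)
    fix i assume i: "i \<le> D"
    consider "i < rho" | "i = rho" | "i = Suc rho" | "Suc rho < i" by linarith
    then show "Es i *v aw q A B w0 = Es i *v (e *s (A *v w0) + (k - e * l) *s w0)"
    proof cases
      case 1
      then show ?thesis using Es_zero[OF i _ Xw] Es_zero[OF i _ Aw] Es_zero[OF i _ w0(1)]
        by (simp add: matrix_vector_right_distrib matrix_vector_mult_diff_distrib)
    next
      case 2
      then show ?thesis by (simp add: matrix_vector_right_distrib kl w0 vec_eq_iff algebra_simps)
    next
      case 3
      then show ?thesis by (simp add: matrix_vector_right_distrib matrix_vector_mult_diff_distrib e Es_w0[OF w0(3)] r)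
    next
      case 4
      then show ?thesis
        using Es_aw[OF i r(1), of w0] EsAEs[OF i r(1), of w0] w0 i
        by (simp add: matrix_vector_right_distrib matrix_vector_mult_diff_distrib Es_w0[OF w0(3)])
    qed
  qed
  then have w0K: "w0 \<in> ?K" using w0 by simp
  have "?K = W"
  proof (rule cyclic[OF _ _ _ w0K w0(2,3)])
    show "vec.subspace ?K"
      unfolding vec.subspace_def
    proof (intro conjI ballI allI)
      show "0 \<in> ?K" using vec.subspace_0[OF W] aw_scale[of q A B 0 0] by simp
      fix x y c assume x: "x \<in> ?K" and y: "y \<in> ?K"
      then show "x + y \<in> ?K"
        using vec.subspace_add[OF W] by (simp add: aw_add matrix_vector_right_distrib vec.scale_right_distrib)
      show "c *s x \<in> ?K"
        using x vec.subspace_scale[OF W] by (simp add: aw_scale vec.scale_right_distrib mult_ac)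
    qed
    show "A *v u \<in> ?K" if "u \<in> ?K" for u
      using that WA by (simp add: aw_A matrix_vector_right_distrib matrix_vector_mult_diff_distrib)
  qed auto
  then have "aw q A B u = e *s (A *v u) + (k - e * l) *s u" if "u \<in> W" for u using that by blast
  then show ?thesis by (rule that)
qed

text \<open>Compression by \<open>E i\<close> turns X into the diagonal entry y of B times the
  coefficient of \<open>E_aw\<close> at equal indices.\<close>

lemma aw_diag:
  assumes aw: "\<And>u. u \<in> W \<Longrightarrow> aw q A B u = e *s (A *v u) + m *s u"
    and i: "tau \<le> i" "i \<le> tau + d"
    and y: "\<And>u. u \<in> W \<Longrightarrow> E i *v (B *v (E i *v u)) = y *s (E i *v u)"
  shows "((2 - (q^2 + inverse q ^ 2)) * (lev q s D i)^2 + (q^2 - inverse q ^ 2)^2) * y = e * lev q s D i + m"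
proof -
  have iD: "i \<le> D" using i tau_d by simp
  obtain u where u: "u \<in> W" "E i *v u \<noteq> 0" using E_nonzero[OF i] by blast
  have EiW: "E i *v u \<in> W" using a.E_closed[OF W WA u(1) iD] .
  have "(e * lev q s D i + m) *s (E i *v u) = E i *v aw q A B (E i *v u)"
    using aw[OF EiW] iD by (simp add: matrix_vector_right_distrib a.A_E a.E_E vec.scale_left_distrib)
  also have "\<dots> = (((2 - (q^2 + inverse q ^ 2)) * (lev q s D i)^2 + (q^2 - inverse q ^ 2)^2) * y) *s (E i *v u)"
    unfolding E_aw[OF iD iD] y[OF u(1)] by (simp add: algebra_simps power2_eq_square)
  finally show ?thesis using u(2) by (metis vector_mul_rcancel)
qed

text \<open>By \<open>aw_commutator\<close>, e and e' give the same multiple of [A, B] w0. That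
  vector is nonzero: in layer rho + 1 it is the component of A w0 times a difference of dual
  eigenvalues.\<close>

lemma aw_coeff_eq:
  assumes d: "1 \<le> d" and X: "\<And>u. u \<in> W \<Longrightarrow> aw q A B u = e *s (A *v u) + m *s u"
    and Y: "\<And>u. u \<in> W \<Longrightarrow> aw q B A u = e' *s (B *v u) + m' *s u"
  shows "e' = e"
proof -
  obtain w0 where w0: "w0 \<in> W" "w0 \<noteq> 0" "Es rho *v w0 = w0" by (rule ex_w0)
  have r: "rho \<le> D" "Suc rho \<le> D" using rho_d d by auto
  have Bw0: "B *v w0 = lev q t D rho *s w0" using b.A_E[OF r(1), of w0] w0 by simp
  let ?c = "A *v (B *v w0) - B *v (A *v w0)"
  have "e *s ?c = e' *s ?c"
    using aw_commutator[of q A B w0] X[OF w0(1)] X[OF WB[OF w0(1)]] Y[OF w0(1)] Y[OF WA[OF w0(1)]]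
    by (simp add: matrix_vector_right_distrib vec.scale_right_diff_distrib)
  moreover have "Es (Suc rho) *v ?c = (lev q t D rho - lev q t D (Suc rho)) *s (Es (Suc rho) *v (A *v w0))"
    using r by (simp add: matrix_vector_mult_diff_distrib Bw0 b.E_A vec.scale_left_diff_distrib)
  moreover have "lev q t D rho \<noteq> lev q t D (Suc rho)"
    using leonard.lev_distinct[OF leonard_dual, of rho "Suc rho"] d by simp
  ultimately have "?c \<noteq> 0" using raise_w0[OF d w0] by force
  then show ?thesis using \<open>e *s ?c = e' *s ?c\<close> by (metis vector_mul_rcancel)
qed

end

section \<open>Eigenvalues in the parameters of the module, and the coefficients of the
  relations\<close>

lemma lev_shift:
  assumes "q \<noteq> 0" "s \<noteq> 0"
  shows "lev q s D (tau + i) = lev q (s * q powi (2 * int tau + int d - int D)) d i"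
proof -
  have "2 * int (tau + i) - int D = (2 * int tau + int d - int D) + (2 * int i - int d)"
    "int D - 2 * int (tau + i) = - (2 * int tau + int d - int D) + (int d - 2 * int i)" by simp_all
  then have "q powi (2 * int (tau + i) - int D) = q powi (2 * int tau + int d - int D) * q powi (2 * int i - int d)"
    "q powi (int D - 2 * int (tau + i)) = inverse (q powi (2 * int tau + int d - int D)) * q powi (int d - 2 * int i)"
    using assms by (simp_all only: power_int_add power_int_minus simp_thms)
  then show ?thesis unfolding lev_def by simp
qed

lemma lev_ends:
  assumes "q \<noteq> 0" "s \<noteq> 0" "1 \<le> d"
  shows "lev q s d 0 = s / q ^ d + q ^ d / s" "lev q s d 1 = s * q^2 / q ^ d + q ^ d / (s * q^2)"
    "lev q s d d = s * q ^ d + 1 / (s * q ^ d)" "lev q s d (d - 1) = s * q ^ d / q^2 + q^2 / (s * q ^ d)"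
proof -
  have m: "q powi (- int d) = 1 / q ^ d"
    by (simp add: power_int_minus power_int_of_nat field_simps)
  show "lev q s d 0 = s / q ^ d + q ^ d / s"
    by (simp add: lev_def m power_int_of_nat field_simps)
  have "q powi (2 - int d) = q^2 / q ^ d" "q powi (int d - 2) = q ^ d / q^2"
    using assms by (simp_all add: power_int_diff)
  then show "lev q s d 1 = s * q^2 / q ^ d + q ^ d / (s * q^2)"
    by (simp add: lev_def field_simps)
  show "lev q s d d = s * q ^ d + 1 / (s * q ^ d)"
    by (simp add: lev_def m field_simps)
  have "2 * int (d - 1) - int d = int d - 2" "int d - 2 * int (d - 1) = 2 - int d" using assms by auto
  then show "lev q s d (d - 1) = s * q ^ d / q^2 + q^2 / (s * q ^ d)"
    unfolding lev_def using assms by (simp add: power_int_diff field_simps)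
qed

text \<open>Substituting the third relation, which defines \<open>C\<close>, into the first.\<close>
lemma aw_to_cyclic:
  fixes A B :: "'v::finite cmat"
  assumes q: "q \<noteq> 0" "q ^ 4 \<noteq> 1"
    and C: "\<And>u. C u = g *s u - (1 / (q^2 - inverse q ^ 2)) *s (q *s (A *v (B *v u)) - inverse q *s (B *v (A *v u)))"
    and Y: "aw q B A u = e *s (B *v u) + m *s u"
    and e: "e = - g * (q - 1 / q) * (q^2 - 1 / q^2)" and m: "m = h * (q^2 - 1 / q^2)^2"
  shows "A *v u + (1 / (q^2 - inverse q ^ 2)) *s (q *s (B *v C u) - inverse q *s C (B *v u)) = h *s u"
proof -
  define r where "r = q^2 - inverse q ^ 2"
  have r: "r \<noteq> 0"
  proof
    assume "r = 0"
    then have "q ^ 2 * q ^ 2 = inverse q ^ 2 * q ^ 2" by (simp add: r_def)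
    then show False using q by (simp add: field_simps power2_eq_square power4_eq_xxxx)
  qed
  have r': "q^2 - 1 / q^2 = r" by (simp add: r_def field_simps)
  have "(A *v u + (1 / r) *s (q *s (B *v C u) - inverse q *s C (B *v u))) $ i = h * u $ i" for i
  proof -
    \<comment> \<open>In coordinates the noncommuting words become independent complex numbers, so
      the identity can be checked by commutative algebra.\<close>
    define Ai BAB BBA ABB Bi ui where "Ai = (A *v u) $ i" and "BAB = (B *v (A *v (B *v u))) $ i"
      and "BBA = (B *v (B *v (A *v u))) $ i" and "ABB = (A *v (B *v (B *v u))) $ i"
      and "Bi = (B *v u) $ i" and "ui = u $ i"
    note defs = Ai_def BAB_def BBA_def ABB_def Bi_def ui_def
    have "aw q B A u $ i = BBA - (q^2 + inverse q ^ 2) * BAB + ABB + r^2 * Ai"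
      by (simp add: aw_def defs r_def algebra_simps)
    then have Yi: "BBA - (q^2 + inverse q ^ 2) * BAB + ABB + r^2 * Ai = - g * (q - 1 / q) * r * Bi + h * r^2 * ui"
      using arg_cong[OF Y, of "\<lambda>v. v $ i"] by (simp add: defs e m r')
    have "(A *v u + (1 / r) *s (q *s (B *v C u) - inverse q *s C (B *v u))) $ i
      = Ai + (1 / r) * (q * (g * Bi - (1 / r) * (q * BAB - inverse q * BBA))
        - inverse q * (g * Bi - (1 / r) * (q * ABB - inverse q * BAB)))"
      unfolding C r_def[symmetric] by (simp add: defs matrix_vector_mult_diff_distrib algebra_simps diff_divide_distrib)
    also have "r^2 * \<dots> = (BBA - (q^2 + inverse q ^ 2) * BAB + ABB + r^2 * Ai) + g * (q - 1 / q) * r * Bi"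
      using q r by (simp add: field_simps power2_eq_square)
    also have "\<dots> = r^2 * (h * ui)" unfolding Yi by (simp add: algebra_simps)
    finally show ?thesis using r by (simp add: ui_def)
  qed
  then show ?thesis unfolding r_def[symmetric] by (simp add: vec_eq_iff)
qed

context leonard
begin

lemma aw_coefficients:
  assumes d: "1 \<le> d"
    and x: "\<And>u. u \<in> W \<Longrightarrow> Es rho *v (A *v (Es rho *v u)) = x *s (Es rho *v u)"
    and a': "a' = s * q powi (2 * int tau + int d - int D)" and b': "b' = t * q powi (2 * int rho + int d - int D)"
    and k: "k = a' / b' * q ^ (d - 1) + b' / a' * q powi (1 - int d)
      + (lev q b' d 0 - lev q b' d 1) * (x - lev q a' d d) / ((q - inverse q) * (q ^ d - q powi (- int d)))"
    and L: "L = q ^ (d + 1) + inverse (q ^ (d + 1))"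
    and u: "u \<in> W"
  defines "e \<equiv> - (k * L + (a' + inverse a') * (b' + inverse b')) * (q - 1 / q)^2"
  shows "aw q A B u = e *s (A *v u) + (((b' + inverse b') * L + k * (a' + inverse a')) * (q - 1 / q) * (q^2 - 1 / q^2)) *s u"
    and "aw q B A u = e *s (B *v u) + (((a' + inverse a') * L + (b' + inverse b') * k) * (q - 1 / q) * (q^2 - 1 / q^2)) *s u"
proof -
  interpret dl: leonard q t s B A Es E D W tau d rho by (rule leonard_dual)
  \<comment> \<open>Reversal supplies the equations at the upper end tau + d. Below, x belongs to
    layer rho of the dual order, y and z to the lower and upper end of the E-support.\<close>
  interpret rv: leonard q "inverse s" t A B "\<lambda>i. E (D - i)" Es D W rho d "D - (tau + d)" by (rule leonard_rev)
  interpret rvd: leonard q t "inverse s" B A Es "\<lambda>i. E (D - i)" D W "D - (tau + d)" d rho by (rule rv.leonard_dual)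
  obtain e0 m where X: "\<And>u. u \<in> W \<Longrightarrow> aw q A B u = e0 *s (A *v u) + m *s u" by (rule aw_linear[OF d]) blast
  obtain e1 ms where Y1: "\<And>u. u \<in> W \<Longrightarrow> aw q B A u = e1 *s (B *v u) + ms *s u" by (rule dl.aw_linear[OF d]) blast
  have "e1 = e0" by (rule aw_coeff_eq[OF d X Y1])
  then have Y: "\<And>u. u \<in> W \<Longrightarrow> aw q B A u = e0 *s (B *v u) + ms *s u" using Y1 by simp
  obtain y where y: "\<And>u. u \<in> W \<Longrightarrow> E tau *v (B *v (E tau *v u)) = y *s (E tau *v u)" by (rule dl.ex_corner) blast
  obtain z where z: "\<And>u. u \<in> W \<Longrightarrow> E (D - (D - (tau + d))) *v (B *v (E (D - (D - (tau + d))) *v u))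
      = z *s (E (D - (D - (tau + d))) *v u)" by (rule rvd.ex_corner) blast
  have D: "D - (D - (tau + d)) = tau + d" "D - Suc (D - (tau + d)) = tau + (d - 1)" using tau_d d by auto
  have a0: "a' \<noteq> 0" "b' \<noteq> 0" using nz by (simp_all add: a' b')
  have la: "lev q s D (tau + i) = lev q a' d i" and lb: "lev q t D (rho + i) = lev q b' d i" for i
    using lev_shift[of q] nz by (simp_all add: a' b')
  have q2: "q^2 \<noteq> 1"
  proof
    assume "q^2 = 1"
    then have "(q^2)^2 = 1" by simp
    then show False using q4 by (simp add: power_mult[symmetric])
  qed
  let ?p = "q ^ d"
  \<comment> \<open>A factor of the denominator of \<kappa>. If it vanished, the eigenvalues at the
    two ends of the module would coincide.\<close>
  have p1: "?p - 1 / ?p \<noteq> 0"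
  proof
    assume "?p - 1 / ?p = 0"
    then have "1 / ?p = ?p" by simp
    then have "a' / ?p = a' * ?p" "?p / a' = 1 / (a' * ?p)"
      by (metis times_divide_eq_right mult.right_neutral, metis divide_divide_eq_left mult.commute)
    then have "lev q a' d 0 = lev q a' d d"
      unfolding lev_ends[OF nz(1) a0(1) d] by simp
    then show False using lev_distinct[of tau "tau + d"] la[of 0] la[of d] d by simp
  qed
  have qi: "q - 1 / q \<noteq> 0" using q2 nz(1) by (simp add: field_simps power2_eq_square)
  define P where "P = (\<lambda>v. (2 - (q^2 + inverse q ^ 2)) * v^2 + (q^2 - inverse q ^ 2)^2)"
  have P1: "P (lev q a' d 0) * y = e0 * lev q a' d 0 + m"
    using aw_diag[OF X _ _ y] la[of 0] by (simp add: P_def)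
  have P2: "P (lev q a' d d) * z = e0 * lev q a' d d + m"
    using aw_diag[OF X _ _ z[unfolded D]] la[of d] by (simp add: P_def)
  have P3: "P (lev q b' d 0) * x = e0 * lev q b' d 0 + ms"
    using dl.aw_diag[OF Y _ _ x] lb[of 0] by (simp add: P_def)
  have R1: "(x - lev q a' d 0) * (lev q b' d 0 - lev q b' d 1) = (y - lev q b' d 0) * (lev q a' d 0 - lev q a' d 1)"
    using corner[OF d x y] la[of 0] la[of 1] lb[of 0] lb[of 1] by simp
  have "(x - lev q (inverse s) D (D - (tau + d))) * (lev q t D rho - lev q t D (Suc rho))
    = (z - lev q t D rho) * (lev q (inverse s) D (D - (tau + d)) - lev q (inverse s) D (Suc (D - (tau + d))))"
    by (rule rv.corner[OF d x z])
  moreover have "lev q (inverse s) D (D - (tau + d)) = lev q a' d d"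
    "lev q (inverse s) D (Suc (D - (tau + d))) = lev q a' d (d - 1)"
    using tau_d d by (simp_all add: lev_rev D la[symmetric])
  ultimately have R2: "(x - lev q a' d d) * (lev q b' d 0 - lev q b' d 1)
      = (z - lev q b' d 0) * (lev q a' d d - lev q a' d (d - 1))"
    using lb[of 0] lb[of 1] by simp
  have n: "lev q a' d 0 \<noteq> lev q a' d 1" "lev q a' d d \<noteq> lev q a' d (d - 1)" "lev q b' d 0 \<noteq> lev q b' d 1"
    "lev q a' d 0 \<noteq> lev q a' d d"
    using lev_distinct[of tau "tau + 1"] lev_distinct[of "tau + d" "tau + (d - 1)"]
      dl.lev_distinct[of rho "rho + 1"] lev_distinct[of tau "tau + d"]
      la[of 0] la[of 1] la[of d] la[of "d - 1"] lb[of 0] lb[of 1] d by auto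
  have "q powi (1 - int d) = q / ?p" "q ^ (d - 1) = ?p / q" "q powi (- int d) = 1 / ?p"
    using nz(1) d by (simp_all add: power_int_diff power_int_minus field_simps power_eq_if)
  then have k': "k = a' * ?p / (b' * q) + b' * q / (a' * ?p)
      + (lev q b' d 0 - lev q b' d 1) * (x - lev q a' d d) / ((q - 1 / q) * (?p - 1 / ?p))"
    unfolding k by (simp add: field_simps)
  have kk: "(lev q b' d 0 - lev q b' d 1) * (x - lev q a' d d)
      = (q - 1 / q) * (?p - 1 / ?p) * (k - a' * ?p / (b' * q) - b' * q / (a' * ?p))"
    unfolding k' using qi p1 by simp
  have L': "L = q * ?p + 1 / (q * ?p)" by (simp add: L field_simps)
  have p0: "?p \<noteq> 0" using nz by simp
  note sc = aw_scalars[OF nz(1) p0 a0 lev_ends[OF nz(1) a0(1) d] lev_ends(1,2)[OF nz(1) a0(2) d] n q2 R1 R2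
      fun_cong[OF P_def] P1 P2 P3 kk L']
  show "aw q A B u = e *s (A *v u) + (((b' + inverse b') * L + k * (a' + inverse a')) * (q - 1 / q) * (q^2 - 1 / q^2)) *s u"
    using X[OF u] sc(1,2) by (simp add: e_def inverse_eq_divide)
  show "aw q B A u = e *s (B *v u) + (((a' + inverse a') * L + (b' + inverse b') * k) * (q - 1 / q) * (q^2 - 1 / q^2)) *s u"
    using Y[OF u] sc(1,3) by (simp add: e_def inverse_eq_divide)
qed

end

section \<open>The Bose-Mesner algebra\<close>

lemma gen_alg_commute:
  assumes "M \<in> gen_alg {A}" "N \<in> gen_alg {A}"
  shows "M ** N = N ** M"
proof -
  have 1: "subalg {N. N ** K = K ** N}" for K :: "'a cmat"
    by (auto simp: subalg_def matrix_eq matrix_vector_mult_add_rdistrib matrix_vector_right_distrib)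
  have "N ** A = A ** N" if "N \<in> gen_alg {A}" for N
    using gen_alg_induct[OF that 1[of A]] by simp
  then have "M \<in> {N'. N' ** N = N ** N'}"
    using gen_alg_induct[OF assms(1) 1[of N]] assms(2) by simp
  then show ?thesis by simp
qed

lemma gen_alg_transpose:
  assumes "transpose A = A" "M \<in> gen_alg {A}"
  shows "transpose M = M"
proof -
  note T = subalg_gen_alg[of "{A}"]
  have "transpose (M + N) = transpose M + transpose N" "transpose (cmult c M) = cmult c (transpose M)"
    for c and M N :: "'a cmat"
    by (simp_all add: transpose_def vec_eq_iff)
  moreover have "transpose (M ** N) = M ** N"
    if "transpose M = M" "transpose N = N" "M \<in> gen_alg {A}" "N \<in> gen_alg {A}" for M N
    using that gen_alg_commute[of M A N] by (simp add: matrix_transpose_mul)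
  ultimately have "subalg {M \<in> gen_alg {A}. transpose M = M}"
    using subalgD[OF T] by (auto simp: subalg_def)
  then have "M \<in> {M \<in> gen_alg {A}. transpose M = M}"
    by (rule gen_alg_induct[OF assms(2)]) (auto simp: assms(1) gen_alg_gen)
  then show ?thesis by simp
qed

text \<open>\<open>N = M - M\<^sup>* M\<close> satisfies \<open>N\<^sup>* N = 0\<close>.\<close>
lemma normal_idempotent_adj:
  assumes idem: "M ** M = M" and normal: "adj M ** M = M ** adj M"
  shows "adj M = (M :: 'v::finite cmat)"
proof -
  have i: "M *v (M *v u) = M *v u" for u using arg_cong[OF idem, of "\<lambda>M. M *v u"] by simp
  have ia: "adj M *v (adj M *v u) = adj M *v u" for u
    using arg_cong[OF idem, of "\<lambda>M. adj M *v u"] by (simp add: adj_mult)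
  have n: "M *v (adj M *v u) = adj M *v (M *v u)" for u
    using arg_cong[OF normal, of "\<lambda>M. M *v u"] by simp
  define N where "N = M - adj M ** M"
  have "adj N *v (N *v u) = 0" for u
    by (simp add: N_def adj_diff adj_mult matrix_vector_mult_diff_rdistrib matrix_vector_mult_diff_distrib i ia n)
  then have "inner (N *v u) (N *v u) = 0" for u by (simp add: inner_adj)
  then have "N = 0" by (simp add: matrix_eq)
  then have "M = adj M ** M" by (simp add: N_def)
  then show ?thesis by (metis adj_adj adj_mult)
qed

text \<open>F is the sum of the orthogonal idempotents FG and F - FG, so primitivity makes one of
  them vanish.\<close>

lemma primitive_split:
  assumes T: "subalg T" and comm: "F ** G = G ** F" and F: "primitive_idempotent T F" and G: "idempotent_in T G"
  shows "F ** G = 0 \<or> F ** G = F"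
proof (rule ccontr)
  assume a: "\<not> ?thesis"
  have Fi: "F \<in> T" "F ** F = F" and Gi: "G \<in> T" "G ** G = G"
    using F G by (auto simp: primitive_idempotent_def idempotent_in_def)
  have f: "F *v (F *v u) = F *v u" "G *v (G *v u) = G *v u" "G *v (F *v u) = F *v (G *v u)" for u
    using arg_cong[OF Fi(2), of "\<lambda>M. M *v u"] arg_cong[OF Gi(2), of "\<lambda>M. M *v u"]
      arg_cong[OF comm, of "\<lambda>M. M *v u"] by simp_all
  have "(F ** G) ** (F ** G) = F ** G" "(F - F ** G) ** (F - F ** G) = F - F ** G"
    by (simp_all add: matrix_eq f matrix_vector_mult_diff_rdistrib matrix_vector_mult_diff_distrib)
  moreover have "F ** G \<noteq> 0" "F - F ** G \<noteq> 0" using a by auto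
  moreover have FG: "F ** G \<in> T" by (rule subalgD(3)[OF T Fi(1) Gi(1)])
  moreover have "F - F ** G \<in> T" by (rule subalg_diff[OF T Fi(1) FG])
  ultimately have "idempotent_in T (F ** G)" "idempotent_in T (F - F ** G)"
    by (simp_all add: idempotent_in_def)
  moreover have "(F ** G) ** (F - F ** G) = 0" "(F - F ** G) ** (F ** G) = 0" "F = F ** G + (F - F ** G)"
    by (simp_all add: matrix_eq f matrix_vector_mult_diff_rdistrib matrix_vector_mult_diff_distrib)
  ultimately show False using F unfolding primitive_idempotent_def by blast
qed

text \<open>The E_i are given as an enumeration of all primitive idempotents, together with the
  expansion of A; orthogonality, completeness and distinct eigenvalues have to be derived.\<close>

locale primitive_system =
  fixes A :: "'v::finite cmat" and E :: "nat \<Rightarrow> 'v cmat" and theta :: "nat \<Rightarrow> complex" and D :: nat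
  assumes inj: "inj_on E {..D}" and prim: "E ` {..D} = {F. primitive_idempotent (gen_alg {A}) F}"
    and A_sum: "A = (\<Sum>i\<le>D. cmult (theta i) (E i))"
begin

lemma E_prim: "i \<le> D \<Longrightarrow> primitive_idempotent (gen_alg {A}) (E i)"
  using prim by blast

lemma E_in: "i \<le> D \<Longrightarrow> E i \<in> gen_alg {A}" and E_idem: "i \<le> D \<Longrightarrow> E i ** E i = E i"
  and E_nz: "i \<le> D \<Longrightarrow> E i \<noteq> 0" and E_idem_in: "i \<le> D \<Longrightarrow> idempotent_in (gen_alg {A}) (E i)"
  using E_prim[of i] by (auto simp: primitive_idempotent_def idempotent_in_def)

lemma E_orth:
  assumes "i \<le> D" "j \<le> D"
  shows "E i ** E j = (if i = j then E i else 0)"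
proof (cases "i = j")
  case False
  note c = gen_alg_commute[OF E_in E_in, OF assms]
  have "E i \<noteq> E j" using False inj assms by (auto simp: inj_on_def)
  then show ?thesis
    using primitive_split[OF subalg_gen_alg c E_prim[OF assms(1)] E_idem_in[OF assms(2)]]
      primitive_split[OF subalg_gen_alg c[symmetric] E_prim[OF assms(2)] E_idem_in[OF assms(1)]] c False
    by auto
qed (use assms E_idem in simp)

text \<open>The missing part F = 1 - \<Sum> E_i is annihilated by A, so the algebra acts on it by
  scalars. If nonzero it would be a primitive idempotent, hence one of the E_i, all of which
  annihilate it.\<close>

lemma E_total: "(\<Sum>i\<le>D. E i) = mat 1"
proof (rule ccontr)
  define F where "F = mat 1 - (\<Sum>i\<le>D. E i)"
  assume "\<not> ?thesis"
  then have F0: "F \<noteq> 0" by (simp add: F_def)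
  note T = subalg_gen_alg[of "{A}"]
  have Fin: "F \<in> gen_alg {A}"
    unfolding F_def using E_in by (intro subalg_diff[OF T] subalg_sum[OF T] subalgD[OF T]) auto
  have vE: "E i *v (E j *v u) = (if i = j then E i *v u else 0)" if "i \<le> D" "j \<le> D" for i j u
    using arg_cong[OF E_orth[OF that], of "\<lambda>M. M *v u"] by (simp split: if_splits)
  have EF: "E i ** F = 0" if "i \<le> D" for i
    using that by (simp add: F_def matrix_eq matrix_vector_mult_diff_rdistrib matrix_vector_mult_diff_distrib
        sum_mat_vec mat_vec_sum vE)
  have AF: "A ** F = 0"
    unfolding A_sum sum_mat_mul by (intro sum.neutral) (simp add: EF)
  have FF: "F ** F = F"
  proof -
    have "F ** F = (mat 1 - (\<Sum>i\<le>D. E i)) ** F" by (simp add: F_def)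
    also have "\<dots> = F - (\<Sum>i\<le>D. E i ** F)"
      by (simp add: matrix_eq matrix_vector_mult_diff_rdistrib sum_mat_vec)
    finally show ?thesis by (simp add: EF)
  qed
  have "subalg {M. \<exists>c. M ** F = cmult c F}"
    unfolding subalg_def
  proof (intro conjI ballI allI)
    show "mat 1 \<in> {M. \<exists>c. M ** F = cmult c F}" by (auto intro: exI[of _ 1])
    fix M N assume "M \<in> {M. \<exists>c. M ** F = cmult c F}" "N \<in> {M. \<exists>c. M ** F = cmult c F}"
    then obtain c d where cd: "M ** F = cmult c F" "N ** F = cmult d F" by blast
    have "(M + N) ** F = cmult (c + d) F"
      using cd by (simp add: matrix_eq matrix_vector_mult_add_rdistrib vec.scale_left_distrib)
    moreover have "(M ** N) ** F = cmult (d * c) F"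
      by (simp add: matrix_mul_assoc[symmetric] cd)
    ultimately show "M + N \<in> {M. \<exists>c. M ** F = cmult c F}" "M ** N \<in> {M. \<exists>c. M ** F = cmult c F}" by blast+
  next
    fix e M assume "M \<in> {M. \<exists>c. M ** F = cmult c F}"
    then obtain c where "M ** F = cmult c F" by blast
    then have "cmult e M ** F = cmult (e * c) F" by simp
    then show "cmult e M \<in> {M. \<exists>c. M ** F = cmult c F}" by blast
  qed
  moreover have "{A} \<subseteq> {M. \<exists>c. M ** F = cmult c F}" using AF by (auto intro: exI[of _ 0])
  ultimately have sc: "\<exists>c. M ** F = cmult c F" if "M \<in> gen_alg {A}" for M
    using gen_alg_induct[OF that] by blast
  have "primitive_idempotent (gen_alg {A}) F"
    unfolding primitive_idempotent_def
  proof (intro conjI notI)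
    show "idempotent_in (gen_alg {A}) F" using Fin FF F0 by (simp add: idempotent_in_def)
    assume "\<exists>G H. idempotent_in (gen_alg {A}) G \<and> idempotent_in (gen_alg {A}) H \<and> G ** H = 0 \<and> H ** G = 0 \<and> F = G + H"
    then obtain G H where GH: "idempotent_in (gen_alg {A}) G" "idempotent_in (gen_alg {A}) H"
      "G ** H = 0" "H ** G = 0" "F = G + H" by blast
    have g: "G ** G = G" "G \<noteq> 0" "H ** H = H" "H \<noteq> 0" using GH by (auto simp: idempotent_in_def)
    obtain c where "G ** F = cmult c F" using sc[of G] GH(1) by (auto simp: idempotent_in_def)
    moreover obtain d where "H ** F = cmult d F" using sc[of H] GH(2) by (auto simp: idempotent_in_def)
    moreover have "G ** F = G" "H ** F = H" unfolding GH(5) using GH(3-5) g by (simp_all add: matrix_add_ldistrib)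
    ultimately have Gc: "G = cmult c F" "H = cmult d F" by simp_all
    then have "G ** H = cmult (c * d) F" using FF by (simp add: mult.commute)
    then have "c = 0 \<or> d = 0" using GH(3) F0 by (auto simp: vec_eq_iff)
    then show False using Gc g by auto
  qed
  then obtain i where "i \<le> D" "F = E i" using prim by (metis (mono_tags, lifting) atMost_iff imageE mem_Collect_eq)
  then show False using EF[of i] FF F0 by simp
qed

text \<open>If two eigenvalues agreed, each element of the algebra would act on \<open>E i\<close>
  and \<open>E j\<close> by a common scalar, but \<open>E i\<close> acts by 1 on itself and by 0 on
  \<open>E j\<close>.\<close>

lemma theta_inj:
  assumes "i \<le> D" "j \<le> D" "theta i = theta j"
  shows "i = j"
proof (rule ccontr)
  assume ij: "i \<noteq> j"
  let ?S = "{M. \<exists>c. M ** E i = cmult c (E i) \<and> M ** E j = cmult c (E j)}"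
  have AE: "A ** E k = cmult (theta k) (E k)" if "k \<le> D" for k
  proof -
    have "A ** E k = (\<Sum>l\<le>D. if l = k then cmult (theta k) (E k) else 0)"
      unfolding A_sum sum_mat_mul by (intro sum.cong) (auto simp: E_orth that)
    then show ?thesis using that by simp
  qed
  have "subalg ?S"
    unfolding subalg_def
  proof (intro conjI ballI allI)
    show "mat 1 \<in> ?S" by (auto intro: exI[of _ 1])
    fix M N assume "M \<in> ?S" "N \<in> ?S"
    then obtain c d where cd: "M ** E i = cmult c (E i)" "N ** E i = cmult d (E i)"
      "M ** E j = cmult c (E j)" "N ** E j = cmult d (E j)" by blast
    have "(M + N) ** E i = cmult (c + d) (E i)" "(M + N) ** E j = cmult (c + d) (E j)"
      using cd by (simp_all add: matrix_eq matrix_vector_mult_add_rdistrib vec.scale_left_distrib)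
    moreover have "(M ** N) ** E i = cmult (d * c) (E i)" "(M ** N) ** E j = cmult (d * c) (E j)"
      by (simp_all add: matrix_mul_assoc[symmetric] cd)
    ultimately show "M + N \<in> ?S" "M ** N \<in> ?S" by blast+
  next
    fix e M assume "M \<in> ?S"
    then obtain c where "M ** E i = cmult c (E i)" "M ** E j = cmult c (E j)" by blast
    then have "cmult e M ** E i = cmult (e * c) (E i)" "cmult e M ** E j = cmult (e * c) (E j)" by simp_all
    then show "cmult e M \<in> ?S" by blast
  qed
  moreover have "{A} \<subseteq> ?S" using AE assms by auto
  ultimately have "E i \<in> ?S" using gen_alg_induct[OF E_in[OF assms(1)]] by blast
  then obtain c where "E i = cmult c (E i)" "0 = cmult c (E j)"
    using E_orth assms ij by auto
  then have "c = 0" using E_nz[OF assms(2)] by (auto simp: vec_eq_iff)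
  then show False using \<open>E i = cmult c (E i)\<close> E_nz[OF assms(1)] by simp
qed

lemma gen_alg_span:
  assumes "M \<in> gen_alg {A}"
  shows "\<exists>c. M = (\<Sum>h\<le>D. cmult (c h) (E h))"
proof -
  let ?S = "{M. \<exists>c. M = (\<Sum>h\<le>D. cmult (c h) (E h))}"
  have "subalg ?S"
    unfolding subalg_def
  proof (intro conjI ballI allI)
    show "mat 1 \<in> ?S" using E_total by (auto intro: exI[of _ "\<lambda>_. 1"])
    fix M N assume "M \<in> ?S" "N \<in> ?S"
    then obtain c d where cd: "M = (\<Sum>h\<le>D. cmult (c h) (E h))" "N = (\<Sum>h\<le>D. cmult (d h) (E h))" by blast
    have "M + N = (\<Sum>h\<le>D. cmult (c h + d h) (E h))"
      unfolding cd sum.distrib[symmetric] by (intro sum.cong) (auto simp: vec_eq_iff distrib_right)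
    then show "M + N \<in> ?S" by (intro CollectI exI)
    have "M ** N = (\<Sum>h\<le>D. \<Sum>k\<le>D. cmult (d k * c h) (E h ** E k))"
      unfolding cd sum_mat_mul mat_mul_sum by (simp, rule sum.swap)
    also have "\<dots> = (\<Sum>h\<le>D. \<Sum>k\<le>D. if k = h then cmult (d h * c h) (E h) else 0)"
      by (intro sum.cong refl) (auto simp: E_orth)
    also have "\<dots> = (\<Sum>h\<le>D. cmult (d h * c h) (E h))" by simp
    finally show "M ** N \<in> ?S" by (intro CollectI exI)
  next
    fix e M assume "M \<in> ?S"
    then obtain c where "M = (\<Sum>h\<le>D. cmult (c h) (E h))" by blast
    then have "cmult e M = (\<Sum>h\<le>D. cmult (e * c h) (E h))" by (simp add: cmult_sum)
    then show "cmult e M \<in> ?S" by (intro CollectI exI)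
  qed
  moreover have "{A} \<subseteq> ?S" using A_sum by blast
  ultimately show ?thesis using gen_alg_induct[OF assms] by blast
qed

lemma E_transpose: "transpose A = A \<Longrightarrow> i \<le> D \<Longrightarrow> transpose (E i) = E i"
  using gen_alg_transpose E_in by blast

lemma E_adj: "adj A = A \<Longrightarrow> i \<le> D \<Longrightarrow> adj (E i) = E i"
proof (rule normal_idempotent_adj)
  assume a: "adj A = A" and i: "i \<le> D"
  then have "adj (E i) \<in> gen_alg {A}" using gen_alg_adj[of "{A}"] E_in by blast
  then show "adj (E i) ** E i = E i ** adj (E i)" using gen_alg_commute E_in[OF i] by blast
qed (rule E_idem)

end

section \<open>Distances and the dual idempotents\<close>

lemma walk_gdist: "connected_graph Adj \<Longrightarrow> (x, y) \<in> walk_rel Adj ^^ gdist Adj x y"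
  unfolding gdist_def connected_graph_def by (rule LeastI_ex) blast

lemma gdist_le: "(x, y) \<in> walk_rel Adj ^^ n \<Longrightarrow> gdist Adj x y \<le> n"
  unfolding gdist_def by (rule Least_le)

lemma gdist_step: "connected_graph Adj \<Longrightarrow> Adj y z \<Longrightarrow> gdist Adj x z \<le> Suc (gdist Adj x y)"
  by (rule gdist_le, rule relpow_Suc_I[OF walk_gdist]) (simp_all add: walk_rel_def)

lemma gdist_diameter: "gdist Adj x y \<le> diameter (Adj :: 'v::finite \<Rightarrow> 'v \<Rightarrow> bool)"
proof -
  have "{gdist Adj x y | x y. True} = (\<lambda>(x, y). gdist Adj x y) ` UNIV" by auto
  then have "finite {gdist Adj x y | x y. True}" by simp
  then show ?thesis unfolding diameter_def by (rule Max_ge) blast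
qed

lemma mat_vec_nth: "(M *v u) $ y = (\<Sum>z\<in>UNIV. M $ y $ z * u $ z)"
  by (simp add: matrix_vector_mult_def)

lemma adj_mat_nth: "adj_mat Adj $ x $ y = (if Adj x y then 1 else 0)"
  by (simp add: adj_mat_def)

text \<open>Entries count walks. The natural number witness lets the existence of a walk be read off
  a complex entry.\<close>

lemma mpow_walk:
  "\<exists>n::nat. mpow (adj_mat Adj) k $ x $ y = of_nat n \<and> (0 < n \<longleftrightarrow> (x, y) \<in> walk_rel Adj ^^ k)"
proof (induction k arbitrary: x)
  case 0
  show ?case by (auto simp: mpow_def mat_def intro: exI[of _ 1] exI[of _ 0])
next
  case (Suc k)
  obtain f where f: "\<And>x. mpow (adj_mat Adj) k $ x $ y = of_nat (f x) \<and> (0 < f x \<longleftrightarrow> (x, y) \<in> walk_rel Adj ^^ k)"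
    using Suc by metis
  have "mpow (adj_mat Adj) (Suc k) $ x $ y = (\<Sum>z\<in>UNIV. adj_mat Adj $ x $ z * mpow (adj_mat Adj) k $ z $ y)"
    by (simp add: mpow_def matrix_matrix_mult_def)
  also have "\<dots> = (\<Sum>z\<in>UNIV. of_nat (if Adj x z then f z else 0))"
    by (intro sum.cong) (auto simp: adj_mat_nth f)
  also have "\<dots> = of_nat (\<Sum>z\<in>UNIV. if Adj x z then f z else 0)" by simp
  finally have "mpow (adj_mat Adj) (Suc k) $ x $ y = of_nat (\<Sum>z\<in>UNIV. if Adj x z then f z else 0)" .
  moreover have "0 < (\<Sum>z\<in>UNIV. if Adj x z then f z else 0) \<longleftrightarrow> (\<exists>z. Adj x z \<and> 0 < f z)"
    unfolding zero_less_iff_neq_zero sum_eq_0_iff[OF finite] by auto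
  moreover have "(\<exists>z. Adj x z \<and> 0 < f z) \<longleftrightarrow> (x, y) \<in> walk_rel Adj ^^ Suc k"
  proof -
    have "(x, y) \<in> walk_rel Adj ^^ Suc k \<longleftrightarrow> (\<exists>z. (x, z) \<in> walk_rel Adj \<and> (z, y) \<in> walk_rel Adj ^^ k)"
      by (meson relpow_Suc_D2 relpow_Suc_I2)
    moreover have "(x, z) \<in> walk_rel Adj \<longleftrightarrow> Adj x z" for z by (simp add: walk_rel_def)
    ultimately show ?thesis using f by metis
  qed
  ultimately show ?case by (intro exI conjI) (assumption, simp only:)
qed

lemma mpow_in: "mpow A k \<in> gen_alg {A}"
proof (induction k)
  case (Suc k)
  have "A ** mpow A k \<in> gen_alg {A}"
    by (rule subalgD(3)[OF subalg_gen_alg gen_alg_gen Suc]) simp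
  then show ?case by (simp add: mpow_def)
qed (simp add: mpow_def subalgD[OF subalg_gen_alg])

lemma dual_idem_vec [simp]: "(dual_idem Adj x i *v u) $ y = (if gdist Adj x y = i then u $ y else 0)"
proof -
  have "(dual_idem Adj x i *v u) $ y = (\<Sum>z\<in>UNIV. if z = y then (if gdist Adj x y = i then u $ y else 0) else 0)"
    unfolding mat_vec_nth by (intro sum.cong) (auto simp: dual_idem_def)
  then show ?thesis by simp
qed

lemma dual_idem_mult: "dual_idem Adj x i ** dual_idem Adj x j = (if i = j then dual_idem Adj x i else 0)"
  by (auto simp: matrix_eq vec_eq_iff)

lemma dual_idem_total:
  assumes "D = diameter Adj"
  shows "(\<Sum>i\<le>D. dual_idem Adj x i) = mat 1"
  using gdist_diameter[of Adj x] assms by (auto simp: matrix_eq vec_eq_iff sum_mat_vec)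

text \<open>\<open>endpoint\<close> and \<open>mod_diam\<close> put no bound on the index, so
  indices beyond the diameter must be seen to contribute nothing.\<close>

lemma dual_idem_large: "diameter Adj < i \<Longrightarrow> dual_idem Adj x i = 0"
proof -
  assume "diameter Adj < i"
  then have "gdist Adj x y \<noteq> i" for y using gdist_diameter[of Adj x y] by simp
  then show ?thesis by (simp add: matrix_eq vec_eq_iff)
qed

lemma dual_idem_adj_mat:
  assumes "simple_graph Adj" "connected_graph Adj" "Suc i < j \<or> Suc j < i"
  shows "dual_idem Adj x i ** adj_mat Adj ** dual_idem Adj x j = 0"
proof -
  have "adj_mat Adj $ y $ z * (if gdist Adj x z = j then u $ z else 0) = 0" if "gdist Adj x y = i" for y z and u :: "complex^'a"
  proof (cases "Adj y z \<and> gdist Adj x z = j")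
    case True
    moreover from this assms(1) have "Adj z y" by (auto simp: simple_graph_def)
    ultimately show ?thesis
      using gdist_step[OF assms(2), of y z x] gdist_step[OF assms(2), of z y x] assms(3) that by auto
  qed (auto simp: adj_mat_def)
  then have "(dual_idem Adj x i *v (adj_mat Adj *v (dual_idem Adj x j *v u))) $ y = 0" for u y
    unfolding dual_idem_vec mat_vec_nth[of "adj_mat Adj"] by (auto intro!: sum.neutral)
  then show ?thesis by (simp add: matrix_eq vec_eq_iff)
qed

text \<open>The squared Frobenius norm of \<open>E\<^sub>i A\<^sup>* E\<^sub>j\<close> is a multiple of the Krein parameter
  \<open>q\<^sup>1\<^sub>i\<^sub>j\<close>.\<close>
lemma krein_triple_zero:
  fixes E :: "nat \<Rightarrow> 'v::finite cmat"
  assumes sym: "\<And>i. i \<le> D \<Longrightarrow> transpose (E i) = E i" and herm: "\<And>i. i \<le> D \<Longrightarrow> adj (E i) = E i"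
    and orth: "\<And>i j. i \<le> D \<Longrightarrow> j \<le> D \<Longrightarrow> E i ** E j = (if i = j then E i else 0)"
    and ij: "i \<le> D" "j \<le> D" "1 \<le> D"
    and kr: "schur (E i) (E j) = cmult (1 / of_nat CARD('v)) (\<Sum>h\<le>D. cmult (kr h) (E h))" "kr 1 = 0"
  shows "E i ** dual_adj (E 1) x ** E j = 0"
proof -
  let ?n = "of_nat CARD('v) :: complex"
  define As where "As = dual_adj (E 1) x"
  define s where "s = (\<lambda>y. ?n * E 1 $ x $ y)"
  have sy: "E k $ y $ z = E k $ z $ y" if "k \<le> D" for k y z
    using arg_cong[OF sym[OF that], of "\<lambda>M. M $ z $ y"] by (simp add: transpose_def)
  have re: "cnj (E k $ y $ z) = E k $ y $ z" if "k \<le> D" for k y z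
    using arg_cong[OF herm[OF that], of "\<lambda>M. M $ z $ y"] sy[OF that, of y z] by (simp add: adj_def)
  have AsM: "(As ** M) $ y $ z = s y * M $ y $ z" for M :: "'v cmat" and y z
    by (simp add: As_def dual_adj_def matrix_matrix_mult_def s_def if_distrib if_distribR cong: if_cong)
  have cs: "cnj (s y) = s y" for y using re[OF ij(3), of x y] by (simp add: s_def)
  define N where "N = E i ** (As ** E j)"
  \<comment> \<open>\<open>E i\<close> is a self-adjoint idempotent, so one of its two copies in the
    norm of N is absorbed.\<close>
  have "inner N N = inner (As ** E j) (adj (E i) ** (E i ** (As ** E j)))"
    unfolding N_def by (simp add: inner_adj_mat)
  also have "adj (E i) ** (E i ** (As ** E j)) = E i ** (As ** E j)"
    using orth[OF ij(1,1)] herm[OF ij(1)] by (simp add: matrix_mul_assoc)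
  also have "inner (As ** E j) (E i ** (As ** E j))
      = Re (\<Sum>y\<in>UNIV. \<Sum>z\<in>UNIV. cnj ((As ** E j) $ y $ z) * (E i ** (As ** E j)) $ y $ z)"
    by (simp add: inner_vec_def inner_complex_def)
  also have "(\<Sum>y\<in>UNIV. \<Sum>z\<in>UNIV. cnj ((As ** E j) $ y $ z) * (E i ** (As ** E j)) $ y $ z)
      = (\<Sum>y\<in>UNIV. \<Sum>z\<in>UNIV. \<Sum>w\<in>UNIV. s y * E j $ y $ z * (E i $ y $ w * (s w * E j $ w $ z)))"
    by (simp add: AsM re ij cs matrix_matrix_mult_def[of "E i"] sum_distrib_left)
  also have "\<dots> = (\<Sum>y\<in>UNIV. \<Sum>w\<in>UNIV. \<Sum>z\<in>UNIV. s y * E j $ y $ z * (E i $ y $ w * (s w * E j $ w $ z)))"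
    by (rule sum.cong[OF refl], rule sum.swap)
  \<comment> \<open>The sum over z is an entry of the square of \<open>E j\<close>, which is
    \<open>E j\<close>; what remains is an entry of the Schur product, open to the Krein
    expansion.\<close>
  also have "\<dots> = (\<Sum>y\<in>UNIV. \<Sum>w\<in>UNIV. s y * s w * E i $ y $ w * (\<Sum>z\<in>UNIV. E j $ y $ z * E j $ z $ w))"
    unfolding sum_distrib_left by (intro sum.cong refl) (simp add: sy[OF ij(2), of _ "_ :: 'v"] mult_ac)
  also have "\<dots> = (\<Sum>y\<in>UNIV. \<Sum>w\<in>UNIV. s y * s w * schur (E i) (E j) $ y $ w)"
    using arg_cong[OF orth[OF ij(2,2)], of "\<lambda>M. M $ y $ w" for y w]
    by (simp add: schur_def matrix_matrix_mult_def vec_eq_iff mult.assoc)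
  also have "\<dots> = (\<Sum>y\<in>UNIV. \<Sum>w\<in>UNIV. \<Sum>h\<le>D. ?n * kr h * (E 1 $ x $ y * E h $ y $ w * E 1 $ w $ x))"
  proof -
    have "s w = ?n * E 1 $ w $ x" for w using sy[OF ij(3), of x w] by (simp add: s_def)
    then have "s y * s w * schur (E i) (E j) $ y $ w = (\<Sum>h\<le>D. ?n * kr h * (E 1 $ x $ y * E h $ y $ w * E 1 $ w $ x))" for y w
      unfolding kr by (simp add: s_def sum_distrib_left sum_component mult_ac)
    then show ?thesis by simp
  qed
  also have "\<dots> = (\<Sum>h\<le>D. ?n * kr h * (\<Sum>w\<in>UNIV. \<Sum>y\<in>UNIV. E 1 $ x $ y * E h $ y $ w * E 1 $ w $ x))"
  proof -
    define g where "g = (\<lambda>y w h. ?n * kr h * (E 1 $ x $ y * E h $ y $ w * E 1 $ w $ x))"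
    have "(\<Sum>y\<in>UNIV. \<Sum>w\<in>UNIV. \<Sum>h\<le>D. g y w h) = (\<Sum>y\<in>UNIV. \<Sum>h\<le>D. \<Sum>w\<in>UNIV. g y w h)"
      by (rule sum.cong[OF refl], rule sum.swap)
    also have "\<dots> = (\<Sum>h\<le>D. \<Sum>y\<in>UNIV. \<Sum>w\<in>UNIV. g y w h)" by (rule sum.swap)
    also have "\<dots> = (\<Sum>h\<le>D. \<Sum>w\<in>UNIV. \<Sum>y\<in>UNIV. g y w h)"
      by (rule sum.cong[OF refl], rule sum.swap)
    finally show ?thesis by (simp add: g_def sum_distrib_left)
  qed
  \<comment> \<open>The sums over y and w assemble into a diagonal entry of E_1 E_h E_1. It vanishes
    unless h = 1, and there the Krein parameter vanishes.\<close>
  also have "\<dots> = (\<Sum>h\<le>D. ?n * kr h * (E 1 ** E h ** E 1) $ x $ x)"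
    by (simp add: matrix_matrix_mult_def sum_distrib_right)
  also have "\<dots> = 0"
    using orth kr(2) ij(3) by (intro sum.neutral) (auto simp: orth)
  finally have "N = 0" by simp
  then show ?thesis by (simp add: N_def As_def matrix_mul_assoc)
qed

text \<open>By the three-term recurrence for Schur multiplication with \<open>E\<^sub>1\<close>, the entries of \<open>E\<^sub>1\<close> determine
  those of all \<open>E\<^sub>h\<close>.\<close>
lemma E1_determines:
  fixes E :: "nat \<Rightarrow> 'v::finite cmat"
  assumes Q: "Q_polynomial D E" and E0: "E 0 = cmult (1 / of_nat CARD('v)) allones" and D: "1 \<le> D"
    and eq: "E 1 $ x $ y = E 1 $ x $ z"
  shows "h \<le> D \<Longrightarrow> E h $ x $ y = E h $ x $ z"
proof (induction h rule: less_induct)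
  case (less h)
  from Q[unfolded Q_polynomial_def] obtain kr where
    K: "\<forall>i\<le>D. \<forall>j\<le>D. schur (E i) (E j) = cmult (1 / of_nat CARD('v)) (\<Sum>h\<le>D. cmult (kr h i j) (E h))"
      "\<forall>h\<le>D. \<forall>i\<le>D. \<forall>j\<le>D.
         ((h > i + j \<or> i > h + j \<or> j > h + i) \<longrightarrow> kr h i j = 0) \<and>
         ((h = i + j \<or> i = h + j \<or> j = h + i) \<longrightarrow> kr h i j \<noteq> (0 :: complex))"
    by (elim exE conjE)
  note kr = K(1)[rule_format]
  have zero: "kr k i j = 0" if "k \<le> D" "i \<le> D" "j \<le> D" "i + j < k" for k i j
    using K(2) that by simp
  have nonzero: "kr k i j \<noteq> 0" if "k \<le> D" "i \<le> D" "j \<le> D" "k = i + j" for k i j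
    using K(2) that by simp
  show ?case
  proof (cases h)
    case 0 then show ?thesis by (simp add: E0 allones_def)
  next
    case (Suc i)
    then have i: "i \<le> D" "i < h" using less.prems by auto
    have exp: "of_nat CARD('v) * (E i $ x $ w * E 1 $ x $ w)
        = (\<Sum>k<h. kr k i 1 * E k $ x $ w) + kr h i 1 * E h $ x $ w" for w
    proof -
      have "E i $ x $ w * E 1 $ x $ w = (1 / of_nat CARD('v)) * (\<Sum>k\<le>D. kr k i 1 * E k $ x $ w)"
        using arg_cong[OF kr[OF i(1) D], of "\<lambda>M. M $ x $ w"] by (simp add: schur_def sum_component)
      \<comment> \<open>The Krein parameters vanish above h = i + 1, so the expansion ends with E_h,
        whose coefficient is nonzero.\<close>
      also have "(\<Sum>k\<le>D. kr k i 1 * E k $ x $ w) = (\<Sum>k\<le>h. kr k i 1 * E k $ x $ w)"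
        using less.prems zero[OF _ i(1) D] Suc by (intro sum.mono_neutral_right) auto
      also have "\<dots> = (\<Sum>k<h. kr k i 1 * E k $ x $ w) + kr h i 1 * E h $ x $ w"
        by (simp add: lessThan_Suc_atMost[symmetric])
      finally show ?thesis by simp
    qed
    have "(\<Sum>k<h. kr k i 1 * E k $ x $ y) = (\<Sum>k<h. kr k i 1 * E k $ x $ z)"
      using less by (intro sum.cong) auto
    then have "kr h i 1 * E h $ x $ y = kr h i 1 * E h $ x $ z"
      using exp[of y] exp[of z] less.IH[OF i(2,1)] eq by auto
    then show ?thesis using nonzero[OF less.prems i(1) D] Suc by simp
  qed
qed

section \<open>Parameters of thin irreducible modules\<close>

lemma thin_scalar:
  assumes "thin Es W" "u \<in> W" "u' \<in> W" "Es i *v u \<noteq> 0"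
  shows "\<exists>k. Es i *v u' = k *s (Es i *v u)"
proof (rule ccontr)
  let ?a = "Es i *v u" and ?b = "Es i *v u'"
  assume n: "\<not> ?thesis"
  have "?b \<notin> vec.span {?a}" using n by (auto simp: vec.span_singleton)
  then have "vec.independent {?b, ?a}" using assms(4) by (simp add: vec.independent_insert)
  moreover have "?b \<noteq> ?a" using n by (metis vector_smult_lid)
  ultimately have "2 \<le> vec.dim (img (Es i) W)"
    using vec.independent_card_le_dim[of "{?b, ?a}" "img (Es i) W"] assms(2,3) by (simp add: img_def)
  then show False using assms(1) unfolding thin_def by (metis Suc_1 not_less_eq_eq)
qed

text \<open>\<open>trace_on\<close> selects a value over some basis, so the sum is computed for
  every basis. M sends each v to a multiple of w0; weighted by the coordinates of w0, these factors
  add up to the factor for w0 itself, which is x.\<close>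

lemma trace_on_rank_one:
  assumes W: "vec.subspace W" and w0: "w0 \<in> W" "w0 \<noteq> 0"
    and M: "\<And>v. v \<in> W \<Longrightarrow> \<exists>k. M *v v = k *s w0" and x: "M *v w0 = x *s w0"
  shows "trace_on W (\<lambda>v. M *v v) = x"
proof -
  obtain i where i: "w0 $ i \<noteq> 0" using w0(2) by (auto simp: vec_eq_iff)
  have Mg: "M *v v = ((M *v v) $ i / w0 $ i) *s w0" if v: "v \<in> W" for v
    using M[OF v] i by auto
  have tr: "(\<Sum>b\<in>B. vec.representation B (M *v b) b) = x"
    if B: "finite B" "vec.independent B" "vec.span B = W" for B
  proof -
    have "vec.representation B (M *v b) b = (M *v (vec.representation B w0 b *s b)) $ i / w0 $ i" if "b \<in> B" for b
    proof -
      have b: "b \<in> W" using vec.span_base[OF \<open>b \<in> B\<close>] B(3) by simp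
      have "vec.representation B (M *v b) b = vec.representation B (((M *v b) $ i / w0 $ i) *s w0) b"
        using Mg[OF b] by simp
      also have "\<dots> = ((M *v b) $ i / w0 $ i) * vec.representation B w0 b"
        using w0 B by (simp add: vec.representation_scale)
      finally show ?thesis by simp
    qed
    then have "(\<Sum>b\<in>B. vec.representation B (M *v b) b)
        = (\<Sum>b\<in>B. (M *v (vec.representation B w0 b *s b)) $ i) / w0 $ i"
      unfolding sum_divide_distrib by (rule sum.cong[OF refl])
    also have "(\<Sum>b\<in>B. (M *v (vec.representation B w0 b *s b)) $ i)
        = (M *v (\<Sum>b\<in>B. vec.representation B w0 b *s b)) $ i"
      by (simp only: mat_vec_sum sum_component)
    also have "(\<Sum>b\<in>B. vec.representation B w0 b *s b) = w0"
      using B w0 by (intro vec.sum_representation_eq) auto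
    finally show ?thesis using i x by simp
  qed
  obtain B where B: "B \<subseteq> W" "vec.independent B" "W \<subseteq> vec.span B"
    using vec.basis_exists[of W] by metis
  have "finite B" by (rule vec.finiteI_independent[OF B(2)])
  moreover have "vec.span B = W" using vec.span_minimal[OF B(1) W] B(3) by (rule subset_antisym)
  ultimately have "\<exists>t B. finite B \<and> vec.independent B \<and> vec.span B = W \<and>
      t = (\<Sum>b\<in>B. vec.representation B (M *v b) b)" using B by blast
  then have "\<exists>B. finite B \<and> vec.independent B \<and> vec.span B = W \<and>
      trace_on W (\<lambda>v. M *v v) = (\<Sum>b\<in>B. vec.representation B (M *v b) b)"
    unfolding trace_on_def by (rule someI_ex)
  then show ?thesis using tr by auto
qed

lemma img_nonzero: "vec.subspace W \<Longrightarrow> img M W \<noteq> {0} \<longleftrightarrow> (\<exists>u\<in>W. M *v u \<noteq> 0)"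
  using vec.subspace_0[of W] by (force simp: img_def)

lemma Least_interval: "{i. P i} = {r..r + (d::nat)} \<Longrightarrow> (LEAST i. P i) = r"
  by (rule Least_equality) auto

text \<open>The normalized matrices are affine images of the originals with nonzero factors, so both
  pairs have the same invariant subspaces and irreducibility carries over. The support intervals
  then identify \<open>endpoint\<close>, \<open>mod_diam\<close> and
  \<open>dual_endpoint\<close>.\<close>

lemma ex_leonard:
  assumes a: "eigen A' E (lev q s D) D" and b: "eigen B' Es (lev q t D) D"
    and EBE: "\<And>i j. i \<le> D \<Longrightarrow> j \<le> D \<Longrightarrow> Suc i < j \<or> Suc j < i \<Longrightarrow> E i ** B' ** E j = 0"
    and EsAEs: "\<And>i j. i \<le> D \<Longrightarrow> j \<le> D \<Longrightarrow> Suc i < j \<or> Suc j < i \<Longrightarrow> Es i ** A' ** Es j = 0"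
    and nz: "q \<noteq> 0" "s \<noteq> 0" "t \<noteq> 0" and q4: "q ^ 4 \<noteq> 1"
    and large: "\<And>i. D < i \<Longrightarrow> Es i = 0"
    and A': "A' = cmult x (A - mat w)" "x \<noteq> 0" and B': "B' = cmult y (B - mat ws)" "y \<noteq> 0"
    and W: "irred_module (gen_alg {A, B}) W" and thin: "thin Es W"
  shows "leonard q s t A' B' E Es D W (endpoint Es W) (mod_diam Es W) (dual_endpoint D E W)"
proof -
  have affine: "A' *v u \<in> U \<longleftrightarrow> A *v u \<in> U"
    if U: "vec.subspace U" "u \<in> U" and A': "A' = cmult x (A - mat w)" "x \<noteq> 0"
    for A A' :: "'a cmat" and x w :: complex and u U
  proof
    have *: "A' *v u = x *s (A *v u - w *s u)" by (simp add: A' matrix_vector_mult_diff_rdistrib)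
    show "A *v u \<in> U \<Longrightarrow> A' *v u \<in> U"
      unfolding * using U by (intro vec.subspace_scale vec.subspace_diff) auto
    assume "A' *v u \<in> U"
    then have "inverse x *s (A' *v u) + w *s u \<in> U"
      using U by (intro vec.subspace_add vec.subspace_scale)
    moreover have "inverse x *s (A' *v u) + w *s u = A *v u"
      unfolding * using A'(2) by (simp add: vec_eq_iff field_simps)
    ultimately show "A *v u \<in> U" by simp
  qed
  have sub: "vec.subspace W" by (rule irred_moduleD(2)[OF W])
  note ne = irred_moduleD(5)[OF W]
  interpret a: eigen A' E "lev q s D" D by (rule a)
  interpret b: eigen B' Es "lev q t D" D by (rule b)
  interpret tridiag q s t A' B' E Es D W
  proof unfold_locales
    show "A' *v u \<in> W" "B' *v u \<in> W" if "u \<in> W" for u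
      using that affine[OF sub that A'] affine[OF sub that B'] irred_moduleD(3)[OF W] gen_alg_gen by blast+
    fix U assume U: "vec.subspace U" "\<And>u. u \<in> U \<Longrightarrow> A' *v u \<in> U" "\<And>u. u \<in> U \<Longrightarrow> B' *v u \<in> U" "U \<subseteq> W"
    then have "tmodule (gen_alg {A, B}) U"
      using affine[OF U(1) _ A'] affine[OF U(1) _ B'] by (auto simp: tmodule_gen_alg)
    then show "U = {0} \<or> U = W" using irred_moduleD(4)[OF W] U(4) by blast
  qed (use EBE EsAEs nz q4 sub in auto)
  have "W \<noteq> {0}" using ne by blast
  then obtain r d where rd: "r + d \<le> D" "{i. i \<le> D \<and> (\<exists>u\<in>W. Es i *v u \<noteq> 0)} = {r..r + d}"
    by (rule support_interval)
  interpret thin_tridiag q s t A' B' E Es D W r d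
    by unfold_locales (use rd thin_scalar[OF thin] in auto)
  obtain tau where tau: "tau + d \<le> D" "{i. i \<le> D \<and> (\<exists>u\<in>W. E i *v u \<noteq> 0)} = {tau..tau + d}"
    by (rule dual_support)
  have "i \<le> D" if "u \<in> W" "Es i *v u \<noteq> 0" for i u
    using large[of i] that by (cases "D < i") auto
  then have supp: "{i. img (Es i) W \<noteq> {0}} = {r..r + d}"
    unfolding rd(2)[symmetric] img_nonzero[OF sub] by blast
  have "endpoint Es W = r" unfolding endpoint_def by (rule Least_interval[OF supp])
  moreover have "mod_diam Es W = d" unfolding mod_diam_def supp by simp
  moreover have "dual_endpoint D E W = tau"
    unfolding dual_endpoint_def by (rule Least_interval) (simp only: img_nonzero[OF sub] tau(2))
  moreover have "leonard q s t A' B' E Es D W r d tau"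
    by unfold_locales (use tau in auto)
  ultimately show ?thesis by simp
qed

lemma module_relations:
  fixes A B :: "'v::finite cmat"
  assumes leo: "leonard q s t A B E Es D W (endpoint Es W) (mod_diam Es W) (dual_endpoint D E W)"
  defines "a' \<equiv> a_of q s D E Es W" and "b' \<equiv> b_of q t D Es W" and "k \<equiv> kappa_of q s t D A E Es W"
  assumes L: "L = q ^ (mod_diam Es W + 1) + inverse (q ^ (mod_diam Es W + 1))"
    and C: "\<And>v. v \<in> W \<Longrightarrow> C *v v = ((k * L + (a' + inverse a') * (b' + inverse b')) / (q + inverse q)) *s v
        - (1 / (q^2 - inverse q ^ 2)) *s (q *s (A *v (B *v v)) - inverse q *s (B *v (A *v v)))"
    and u: "u \<in> W"
  shows "A *v u + (1 / (q^2 - inverse q ^ 2)) *s (q *s (B *v (C *v u)) - inverse q *s (C *v (B *v u)))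
      = (((a' + inverse a') * L + (b' + inverse b') * k) / (q + inverse q)) *s u"
      (is ?P)
    and "B *v u + (1 / (q^2 - inverse q ^ 2)) *s (q *s (C *v (A *v u)) - inverse q *s (A *v (C *v u)))
      = (((b' + inverse b') * L + k * (a' + inverse a')) / (q + inverse q)) *s u"
      (is ?Q)
proof -
  define rho d tau where "rho = endpoint Es W" and "d = mod_diam Es W" and "tau = dual_endpoint D E W"
  note defs = rho_def[symmetric] d_def[symmetric] tau_def[symmetric]
  interpret leonard q s t A B E Es D W rho d tau using leo unfolding defs .
  have a': "a' = s * q powi (2 * int tau + int d - int D)" and b': "b' = t * q powi (2 * int rho + int d - int D)"
    unfolding a'_def b'_def a_of_def b_of_def aW_def bW_def defs by simp_all
  have la: "lev q s D (tau + i) = lev q a' d i" and lb: "lev q t D (rho + i) = lev q b' d i" for i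
    using lev_shift[of q] nz by (simp_all add: a' b')
  have qs: "q + inverse q \<noteq> 0" "q - inverse q \<noteq> 0" "q^2 - inverse q ^ 2 = (q - inverse q) * (q + inverse q)"
  proof -
    show *: "q^2 - inverse q ^ 2 = (q - inverse q) * (q + inverse q)" by (simp add: algebra_simps power2_eq_square)
    have "q^2 - inverse q ^ 2 \<noteq> 0"
    proof
      assume "q^2 - inverse q ^ 2 = 0"
      then have "q ^ 2 * q ^ 2 = inverse q ^ 2 * q ^ 2" by simp
      then show False using nz(1) q4 by (simp add: field_simps power2_eq_square power4_eq_xxxx)
    qed
    then show "q + inverse q \<noteq> 0" "q - inverse q \<noteq> 0" unfolding * by auto
  qed
  let ?g = "(k * L + (a' + inverse a') * (b' + inverse b')) / (q + inverse q)"
  \<comment> \<open>For d = 0 both A and B are scalars on W, and \<kappa> = 0 makes C vanish there;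
    L = q + 1/q turns the right-hand sides into the scalars of A and B.\<close>
  have zero: ?P ?Q if "d = 0"
  proof -
    have k: "k = 0" using that unfolding k_def kappa_of_def Let_def defs by simp
    have L1: "L = q + inverse q" unfolding L defs using that by simp
    have r: "rho \<le> D" "tau \<le> D" using rho_d tau_d by auto
    have Ev: "E tau *v v = v" "Es rho *v v = v" if v: "v \<in> W" for v
    proof -
      show "E tau *v v = v"
      proof (rule a.E_eqI)
        fix i assume "i \<le> D"
        then show "E i *v (E tau *v v) = E i *v v"
          using r E_zero[of i v] v \<open>d = 0\<close> by (cases "i < tau") (auto simp: a.E_E)
      qed
      show "Es rho *v v = v"
      proof (rule b.E_eqI)
        fix i assume "i \<le> D"
        then show "Es i *v (Es rho *v v) = Es i *v v"
          using r Es_zero[of i v] v \<open>d = 0\<close> by (cases "i < rho") (auto simp: b.E_E)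
      qed
    qed
    have l: "lev q a' d 0 = a' + inverse a'" "lev q b' d 0 = b' + inverse b'" using that by (simp_all add: lev_def)
    have Av: "A *v v = (a' + inverse a') *s v" and Bv: "B *v v = (b' + inverse b') *s v" if "v \<in> W" for v
      using a.A_E[OF r(2), of v] b.A_E[OF r(1), of v] Ev[OF that] la[of 0] lb[of 0] l by simp_all
    have Cv: "C *v v = 0" if "v \<in> W" for v
    proof -
      have "C *v v = ((a' + inverse a') * (b' + inverse b') / (q + inverse q)
          - (1 / (q^2 - inverse q ^ 2)) * (q - inverse q) * ((a' + inverse a') * (b' + inverse b'))) *s v"
        unfolding C[OF that] k Bv[OF that] mat_vec_scale Av[OF that]
        by (simp add: vec_eq_iff algebra_simps diff_divide_distrib add_divide_distrib)
      then show ?thesis using qs by (simp add: qs(3))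
    qed
    show ?P ?Q
      unfolding Cv[OF u] Cv[OF WA[OF u]] Cv[OF WB[OF u]] unfolding Av[OF u] Bv[OF u] k L1
      using qs(1) by simp_all
  qed
  have pos: ?P ?Q if "d \<noteq> 0"
  proof -
    have d1: "1 \<le> d" using that by simp
    obtain w0 where w0: "w0 \<in> W" "w0 \<noteq> 0" "Es rho *v w0 = w0" by (rule ex_w0)
    obtain x where x: "\<And>u. u \<in> W \<Longrightarrow> Es rho *v (A *v (Es rho *v u)) = x *s (Es rho *v u)" by (rule ex_corner) blast
    have tr: "trace_on W (\<lambda>v. (Es rho ** A) *v v) = x"
    proof (rule trace_on_rank_one[OF W w0(1,2)])
      fix v assume v: "v \<in> W"
      then show "\<exists>k. (Es rho ** A) *v v = k *s w0"
        using thin_s[of rho w0 "A *v v"] w0 WA rho_d by simp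
    qed (use x[OF w0(1)] w0 in simp)
    have k: "k = a' / b' * q ^ (d - 1) + b' / a' * q powi (1 - int d)
      + (lev q b' d 0 - lev q b' d 1) * (x - lev q a' d d) / ((q - inverse q) * (q ^ d - q powi (- int d)))"
      using that unfolding k_def kappa_of_def Let_def defs a'_def[symmetric] b'_def[symmetric] tr by simp
    note aw = aw_coefficients[OF d1 x a' b' k L[folded d_def] u]
    let ?h = "((a' + inverse a') * L + (b' + inverse b') * k) / (q + inverse q)"
    let ?h' = "((b' + inverse b') * L + k * (a' + inverse a')) / (q + inverse q)"
    have qq: "q^2 - 1 / q^2 = (q - 1 / q) * (q + inverse q)" "q - inverse q = q - 1 / q"
      using nz(1) by (simp_all add: field_simps power2_eq_square)
    have sc: "- z * f^2 = - (z / r) * f * (f * r)" "z * f * (f * r) = z / r * (f * r)^2"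
      if "r \<noteq> 0" for z f r :: complex using that by (simp_all add: power2_eq_square)
    have e: "- (k * L + (a' + inverse a') * (b' + inverse b')) * (q - 1 / q)^2 = - ?g * (q - 1 / q) * (q^2 - 1 / q^2)"
      unfolding qq(1) by (rule sc(1)[OF qs(1)])
    have m: "y * (q - 1 / q) * (q^2 - 1 / q^2) = y / (q + inverse q) * (q^2 - 1 / q^2)^2" for y
      unfolding qq(1) by (rule sc(2)[OF qs(1)])
    \<comment> \<open>C is known on W only, whereas \<open>aw_to_cyclic\<close> asks for a function
      given by the formula everywhere.\<close>
    define Cf where "Cf = (\<lambda>v. ?g *s v - (1 / (q^2 - inverse q ^ 2)) *s (q *s (A *v (B *v v)) - inverse q *s (B *v (A *v v))))"
    have CfC: "C *v v = Cf v" if "v \<in> W" for v using C[OF that] by (simp add: Cf_def)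
    have "A *v u + (1 / (q^2 - inverse q ^ 2)) *s (q *s (B *v Cf u) - inverse q *s Cf (B *v u)) = ?h *s u"
      by (rule aw_to_cyclic[OF nz(1) q4 fun_cong[OF Cf_def] aw(2) e m])
    then show "A *v u + (1 / (q^2 - inverse q ^ 2)) *s (q *s (B *v (C *v u)) - inverse q *s (C *v (B *v u))) = ?h *s u"
      by (simp add: CfC u WB)
    text \<open>The second relation is the first one with \<open>A\<close> and \<open>B\<close> exchanged and \<open>q\<close> inverted.\<close>
    let ?q = "inverse q"
    have "1 / (?q^2 - inverse ?q ^ 2) = - (1 / (q^2 - inverse q ^ 2))"
      by (simp add: minus_divide_right)
    then have Cf': "Cf v = ?g *s v - (1 / (?q^2 - inverse ?q ^ 2)) *s (?q *s (B *v (A *v v)) - inverse ?q *s (A *v (B *v v)))" for v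
      unfolding Cf_def by (simp add: vec_eq_iff algebra_simps)
    \<comment> \<open>q enters X only through q^2 + q^-2 and (q^2 - q^-2)^2, both unchanged when q
      is inverted.\<close>
    have X: "aw ?q A B u = (- (k * L + (a' + inverse a') * (b' + inverse b')) * (q - 1 / q)^2) *s (A *v u)
        + (((b' + inverse b') * L + k * (a' + inverse a')) * (q - 1 / q) * (q^2 - 1 / q^2)) *s u"
      using aw(1) unfolding aw_def by (simp add: add.commute[of "?q^2"] power2_commute[of "?q^2"])
    have inv: "1 / ?q = q" "1 / ?q^2 = q^2" "?q = 1 / q" "?q^2 = 1 / q^2"
      by (simp_all add: inverse_eq_divide power_divide)
    have minus_swap: "(x - y) * (z - w) = (y - x) * (w - z)" for x y z w :: complex by (simp add: algebra_simps)
    have "(q - 1 / q) * (q^2 - 1 / q^2) = (?q - 1 / ?q) * (?q^2 - 1 / ?q^2)"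
      unfolding inv(1,2) unfolding inv(4) unfolding inv(3) by (rule minus_swap)
    then have i: "- ?g * (q - 1 / q) * (q^2 - 1 / q^2) = - ?g * (?q - 1 / ?q) * (?q^2 - 1 / ?q^2)"
      "(q^2 - 1 / q^2)^2 = (?q^2 - 1 / ?q^2)^2"
      unfolding mult.assoc inv(2,4) by (simp_all add: power2_commute)
    have q4': "?q ^ 4 \<noteq> 1" "?q \<noteq> 0" using q4 nz(1) by (auto simp: power_inverse)
    have "B *v u + (1 / (?q^2 - inverse ?q ^ 2)) *s (?q *s (A *v Cf u) - inverse ?q *s Cf (A *v u)) = ?h' *s u"
      by (rule aw_to_cyclic[OF q4'(2,1) Cf' X e[unfolded i(1)] m[unfolded i(2)]])
    moreover have "(1 / (?q^2 - inverse ?q ^ 2)) *s (?q *s (A *v Cf u) - inverse ?q *s Cf (A *v u))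
        = (1 / (q^2 - inverse q ^ 2)) *s (q *s Cf (A *v u) - inverse q *s (A *v Cf u))"
      unfolding \<open>1 / (?q^2 - inverse ?q ^ 2) = - (1 / (q^2 - inverse q ^ 2))\<close>
      by (simp add: vec_eq_iff algebra_simps)
    ultimately show "B *v u + (1 / (q^2 - inverse q ^ 2)) *s (q *s (C *v (A *v u)) - inverse q *s (A *v (C *v u))) = ?h' *s u"
      by (simp add: CfC u WA)
  qed
  show ?P ?Q using zero pos by blast+
qed

theorem theorem5p12:
  fixes Adj :: "'v::finite \<Rightarrow> 'v \<Rightarrow> bool"
    and x :: 'v
    and D :: nat
    and E :: "nat \<Rightarrow> 'v cmat"
    and theta thetas :: "nat \<Rightarrow> complex"
    and q w u v ws us vs a b :: complex
    and c :: "'v cvec set set \<Rightarrow> complex"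
  defines "A \<equiv> adj_mat Adj"
    and "Es \<equiv> dual_idem Adj x"
    and "As \<equiv> dual_adj (E 1) x"
  defines "T \<equiv> gen_alg {A, As}"
    and "Ab \<equiv> cmult (1 / (a * v)) (A - mat w)"
    and "Bb \<equiv> cmult (1 / (b * vs)) (As - mat ws)"
  defines "ab \<equiv> type_sum T (\<lambda>psi. a_of q a D E Es (rep psi))"
    and "bb \<equiv> type_sum T (\<lambda>psi. b_of q b D Es (rep psi))"
    and "cb \<equiv> type_sum T c"
    and "Lam \<equiv> type_sum T (\<lambda>psi. q ^ (mod_diam Es (rep psi) + 1))"
  assumes q_nz: "q \<noteq> 0" and q4: "q ^ 4 \<noteq> 1"
    and drg: "distance_regular Adj"
    and D_def: "D = diameter Adj" and D3: "D \<ge> 3"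
    and E_inj: "inj_on E {..D}"
    and E_prim: "E ` {..D} = {F. primitive_idempotent (bose_mesner Adj) F}"
    and E0: "E 0 = cmult (1 / of_nat CARD('v)) allones"
    and Qpoly: "Q_polynomial D E"
    and A_sum: "A = (\<Sum>i\<le>D. cmult (theta i) (E i))"
    and As_sum: "As = (\<Sum>i\<le>D. cmult (thetas i) (Es i))"
    and theta_qr: "\<forall>i\<le>D. theta i = w + u * q powi (2 * int i - int D) + v * q powi (int D - 2 * int i)"
    and thetas_qr: "\<forall>i\<le>D. thetas i = ws + us * q powi (2 * int i - int D) + vs * q powi (int D - 2 * int i)"
    and nz: "u \<noteq> 0" "v \<noteq> 0" "us \<noteq> 0" "vs \<noteq> 0"
    and a_sq: "a ^ 2 = u / v" and b_sq: "b ^ 2 = us / vs"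
    and all_thin: "\<forall>W. irred_module T W \<longrightarrow> thin Es W"
    and c_root: "\<forall>psi\<in>iso_types T.
        c psi ^ 2 - kappa_of q a b D Ab E Es (rep psi) * c psi + 1 = 0"
  shows "\<exists>!C. C \<in> T \<and>
     Ab + cmult (1 / (q^2 - inverse q ^ 2)) (cmult q (Bb ** C) - cmult (inverse q) (C ** Bb)) =
       cmult (1 / (q + inverse q))
         ((ab + matrix_inv ab) ** (Lam + matrix_inv Lam) + (bb + matrix_inv bb) ** (cb + matrix_inv cb)) \<and>
     Bb + cmult (1 / (q^2 - inverse q ^ 2)) (cmult q (C ** Ab) - cmult (inverse q) (Ab ** C)) =
       cmult (1 / (q + inverse q))
         ((bb + matrix_inv bb) ** (Lam + matrix_inv Lam) + (cb + matrix_inv cb) ** (ab + matrix_inv ab)) \<and>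
     C + cmult (1 / (q^2 - inverse q ^ 2)) (cmult q (Ab ** Bb) - cmult (inverse q) (Bb ** Ab)) =
       cmult (1 / (q + inverse q))
         ((cb + matrix_inv cb) ** (Lam + matrix_inv Lam) + (ab + matrix_inv ab) ** (bb + matrix_inv bb))"
proof -

  \<comment> \<open>From the graph to a Leonard system on each irreducible module\<close>
  interpret ps: primitive_system A E theta D
    by unfold_locales (use E_inj E_prim A_sum in \<open>simp_all add: bose_mesner_def A_def\<close>)
  have simple: "simple_graph Adj" and conn: "connected_graph Adj" using drg by (auto simp: distance_regular_def)
  have adjA: "adj A = A" and trA: "transpose A = A"
    using simple by (auto simp: A_def adj_mat_def adj_def transpose_def vec_eq_iff simple_graph_def)
  have D1: "1 \<le> D" using D3 by simp
  note orth = ps.E_orth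
  have E1_real: "cnj (E 1 $ y $ z) = E 1 $ y $ z" for y z
    using arg_cong[OF ps.E_adj[OF adjA D1], of "\<lambda>M. M $ z $ y"] arg_cong[OF ps.E_transpose[OF trA D1], of "\<lambda>M. M $ z $ y"]
    by (simp add: adj_def transpose_def)
  have adjAs: "adj As = As"
    by (auto simp: As_def dual_adj_def adj_def vec_eq_iff E1_real[simplified])
  have star: "staralg T"
    unfolding staralg_def T_def using subalg_gen_alg gen_alg_adj[of "{A, As}"] adjA adjAs by blast
  note T = subalg_gen_alg[of "{A, As}", folded T_def]
  have AT: "A \<in> T" "As \<in> T" by (auto simp: T_def intro: gen_alg_gen)
  have a0: "a \<noteq> 0" "b \<noteq> 0" using a_sq b_sq nz by auto
  have ua: "u / (a * v) = a" "v / (a * v) = inverse a"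
    using a_sq a0 nz by (auto simp: field_simps power2_eq_square)
  have ub: "us / (b * vs) = b" "vs / (b * vs) = inverse b"
    using b_sq a0 nz by (auto simp: field_simps power2_eq_square)
  have lev_a: "lev q a D i = (theta i - w) / (a * v)" if "i \<le> D" for i
  proof -
    have "(theta i - w) / (a * v) = u / (a * v) * q powi (2 * int i - int D) + v / (a * v) * q powi (int D - 2 * int i)"
      using theta_qr that by (simp add: add_divide_distrib)
    then show ?thesis unfolding ua lev_def by simp
  qed
  have lev_b: "lev q b D i = (thetas i - ws) / (b * vs)" if "i \<le> D" for i
  proof -
    have "(thetas i - ws) / (b * vs) = us / (b * vs) * q powi (2 * int i - int D) + vs / (b * vs) * q powi (int D - 2 * int i)"
      using thetas_qr that by (simp add: add_divide_distrib)
    then show ?thesis unfolding ub lev_def by simp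
  qed
  have normalized: "cmult z (M - mat y) = (\<Sum>i\<le>D. cmult (f i) (F i))"
    if "M = (\<Sum>i\<le>D. cmult (g i) (F i))" "(\<Sum>i\<le>D. F i) = mat 1" "\<And>i. i \<le> D \<Longrightarrow> f i = (g i - y) * z"
    for z y f g F and M :: "'v cmat"
  proof -
    have "cmult z (M - mat y) *v u = (\<Sum>i\<le>D. cmult (f i) (F i)) *v u" for u
    proof -
      have u: "(\<Sum>i\<le>D. F i *v u) = u" using arg_cong[OF that(2), of "\<lambda>M. M *v u"] by (simp add: sum_mat_vec)
      have "cmult z (M - mat y) *v u = z *s ((\<Sum>i\<le>D. g i *s (F i *v u)) - y *s (\<Sum>i\<le>D. F i *v u))"
        unfolding u by (simp add: that(1) sum_mat_vec matrix_vector_mult_diff_rdistrib)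
      also have "\<dots> = (\<Sum>i\<le>D. z *s (g i *s (F i *v u)) - z *s (y *s (F i *v u)))"
        by (simp only: sum_subtractf vec.scale_sum_right vector_ssub_ldistrib)
      also have "\<dots> = (\<Sum>i\<le>D. f i *s (F i *v u))"
        by (intro sum.cong refl) (simp add: that(3) vec_eq_iff algebra_simps)
      finally show ?thesis by (simp add: sum_mat_vec)
    qed
    then show ?thesis unfolding matrix_eq by blast
  qed
  have eigA: "eigen Ab E (lev q a D) D"
  proof
    show "Ab = (\<Sum>i\<le>D. cmult (lev q a D i) (E i))"
      unfolding Ab_def by (rule normalized[OF A_sum ps.E_total]) (simp add: lev_a)
    show "i = j" if "i \<le> D" "j \<le> D" "lev q a D i = lev q a D j" for i j
      using that a0 nz ps.theta_inj[OF that(1,2)] by (simp add: lev_a)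
  qed (use orth ps.E_total in auto)
  \<comment> \<open>Applied to the all-ones vector a diagonal matrix shows its diagonal; the two
    descriptions of \<open>As\<close> are compared in this way.\<close>
  have thetas_entry: "thetas (gdist Adj x y) = of_nat CARD('v) * E 1 $ x $ y" for y
  proof -
    have "(As *v (\<chi> z. 1)) $ y = (\<Sum>i\<le>D. thetas i * (Es i *v (\<chi> z. 1)) $ y)"
      unfolding As_sum sum_mat_vec by (simp add: sum_component)
    also have "\<dots> = (\<Sum>i\<le>D. if i = gdist Adj x y then thetas i else 0)"
      unfolding Es_def by (intro sum.cong) auto
    also have "\<dots> = thetas (gdist Adj x y)" using gdist_diameter[of Adj x y] D_def by simp
    finally show ?thesis
      unfolding As_def mat_vec_nth by (simp add: dual_adj_def if_distrib if_distribR cong: if_cong)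
  qed
  \<comment> \<open>The power of A whose exponent is the distance of y is a combination of the
    \<open>E h\<close>, so its entries at (x, y) and (x, z) agree. Yet a walk of that length reaches
    y, and none reaches the more distant z.\<close>
  have not_less: "\<not> gdist Adj x y < gdist Adj x z" if eq: "E 1 $ x $ y = E 1 $ x $ z" for y z
  proof
    assume l: "gdist Adj x y < gdist Adj x z"
    let ?i = "gdist Adj x y"
    obtain f where f: "mpow A ?i = (\<Sum>h\<le>D. cmult (f h) (E h))" using ps.gen_alg_span[OF mpow_in] by blast
    have "mpow A ?i $ x $ y = mpow A ?i $ x $ z"
      unfolding f using E1_determines[OF Qpoly E0 D1 eq] by (simp add: sum_component)
    moreover have "(x, y) \<in> walk_rel Adj ^^ ?i" by (rule walk_gdist[OF conn])
    moreover have "(x, z) \<notin> walk_rel Adj ^^ ?i" using gdist_le[of x z ?i Adj] l by auto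
    ultimately show False
      using mpow_walk[of Adj ?i x y] mpow_walk[of Adj ?i x z] unfolding A_def by auto
  qed
  have thetas_inj: "i = j" if ij: "Es i \<noteq> 0" "Es j \<noteq> 0" "thetas i = thetas j" for i j
  proof -
    have "\<exists>y. gdist Adj x y = k" if "Es k \<noteq> 0" for k
      using that unfolding Es_def dual_idem_def by (auto simp: vec_eq_iff split: if_splits)
    then obtain y z where yz: "gdist Adj x y = i" "gdist Adj x z = j" using ij by metis
    then have "E 1 $ x $ y = E 1 $ x $ z" using ij(3) thetas_entry[of y] thetas_entry[of z] by simp
    then show ?thesis using not_less[of y z] not_less[of z y] yz by simp
  qed
  have Es_total: "(\<Sum>i\<le>D. Es i) = mat 1" unfolding Es_def by (rule dual_idem_total[OF D_def])
  have eigB: "eigen Bb Es (lev q b D) D"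
  proof
    show "Bb = (\<Sum>i\<le>D. cmult (lev q b D i) (Es i))"
      unfolding Bb_def by (rule normalized[OF As_sum Es_total]) (simp add: lev_b)
    show "i = j" if "i \<le> D" "j \<le> D" "Es i \<noteq> 0" "Es j \<noteq> 0" "lev q b D i = lev q b D j" for i j
      using that a0 nz thetas_inj[of i j] by (simp add: lev_b)
  qed (simp_all add: Es_total, simp add: Es_def dual_idem_mult)
  have sandwich: "P ** cmult z (M - mat y) ** R = 0" if "P ** M ** R = 0" "P ** R = 0" for P M R :: "'v cmat" and y z
    using arg_cong[OF that(1), of "\<lambda>M. M *v h" for h] arg_cong[OF that(2), of "\<lambda>M. M *v h" for h]
    by (simp add: matrix_eq matrix_vector_mult_diff_rdistrib matrix_vector_mult_diff_distrib)
  have EBE: "E i ** Bb ** E j = 0" if ij: "i \<le> D" "j \<le> D" "Suc i < j \<or> Suc j < i" for i j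
    unfolding Bb_def
  proof (rule sandwich)
    from Qpoly[unfolded Q_polynomial_def] obtain kr where
      K: "\<forall>i\<le>D. \<forall>j\<le>D. schur (E i) (E j) = cmult (1 / of_nat CARD('v)) (\<Sum>h\<le>D. cmult (kr h i j) (E h))"
      "\<forall>h\<le>D. \<forall>i\<le>D. \<forall>j\<le>D.
         ((h > i + j \<or> i > h + j \<or> j > h + i) \<longrightarrow> kr h i j = 0) \<and>
         ((h = i + j \<or> i = h + j \<or> j = h + i) \<longrightarrow> kr h i j \<noteq> (0 :: complex))"
      by (elim exE conjE)
    \<comment> \<open>The triangle condition for upper index 1: as |i - j| > 1, one of i and j
      exceeds the other plus 1.\<close>
    have "kr 1 i j = 0" using K(2) ij D1 by auto
    then show "E i ** As ** E j = 0"
      unfolding As_def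
      by (intro krein_triple_zero[where kr = "\<lambda>h. kr h i j", OF ps.E_transpose[OF trA] ps.E_adj[OF adjA] orth ij(1,2) D1])
        (use K(1) ij in auto)
    show "E i ** E j = 0" using orth[OF ij(1,2)] ij(3) by auto
  qed
  have EsAEs: "Es i ** Ab ** Es j = 0" if "Suc i < j \<or> Suc j < i" for i j
    unfolding Ab_def Es_def A_def
    using that by (intro sandwich dual_idem_adj_mat[OF simple conn]) (auto simp: dual_idem_mult)
  have leo: "leonard q a b Ab Bb E Es D W (endpoint Es W) (mod_diam Es W) (dual_endpoint D E W)"
    if W: "irred_module T W" for W
  proof (rule ex_leonard[OF eigA eigB EBE EsAEs q_nz a0 q4])
    show "Ab = cmult (1 / (a * v)) (A - mat w)" "Bb = cmult (1 / (b * vs)) (As - mat ws)"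
      by (simp_all add: Ab_def Bb_def)
    show "irred_module (gen_alg {A, As}) W" "thin Es W" using W all_thin by (simp_all add: T_def)
    show "Es i = 0" if "D < i" for i using that dual_idem_large[of Adj i x] by (simp add: Es_def D_def)
  qed (use a0 nz in auto)
  have AbT: "Ab \<in> T" and BbT: "Bb \<in> T"
    unfolding Ab_def Bb_def by (intro subalgD(4)[OF T] subalg_diff[OF T] subalg_mat[OF T] AT)+

  \<comment> \<open>Scalars on the homogeneous components, and the element C\<close>
  define fa where "fa = (\<lambda>psi. a_of q a D E Es (rep psi))"
  define fb where "fb = (\<lambda>psi. b_of q b D Es (rep psi))"
  define fL where "fL = (\<lambda>psi. q ^ (mod_diam Es (rep psi) + 1))"
  define fk where "fk = (\<lambda>psi. kappa_of q a b D Ab E Es (rep psi))"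
  have f0: "fa psi \<noteq> 0" "fb psi \<noteq> 0" "fL psi \<noteq> 0" for psi
    using a0 q_nz by (simp_all add: fa_def fb_def fL_def a_of_def b_of_def aW_def bW_def)
  have c0: "c psi \<noteq> 0" and ck: "c psi + inverse (c psi) = fk psi" if "psi \<in> iso_types T" for psi
  proof -
    have r: "c psi ^ 2 - fk psi * c psi + 1 = 0" using c_root that by (simp add: fk_def)
    then show n: "c psi \<noteq> 0" by auto
    have "c psi ^ 2 + 1 = fk psi * c psi" using r by (simp add: algebra_simps add_eq_0_iff)
    then show "c psi + inverse (c psi) = fk psi" using n by (simp add: field_simps power2_eq_square)
  qed
  have inv_c: "matrix_inv (type_sum T c) = type_sum T (\<lambda>psi. inverse (c psi))"
    by (rule type_sum_inv[OF star c0])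
  note inv = type_sum_inv[OF star, of fa, OF f0(1)] type_sum_inv[OF star, of fb, OF f0(2)]
    type_sum_inv[OF star, of fL, OF f0(3)] inv_c
  have defs: "ab = type_sum T fa" "bb = type_sum T fb" "cb = type_sum T c" "Lam = type_sum T fL"
    by (simp_all add: ab_def bb_def cb_def Lam_def fa_def fb_def fL_def)
  define al where "al = (\<lambda>psi. fa psi + inverse (fa psi))"
  define be where "be = (\<lambda>psi. fb psi + inverse (fb psi))"
  define la where "la = (\<lambda>psi. fL psi + inverse (fL psi))"
  have S: "(ab + matrix_inv ab) *v u = al psi *s u" "(bb + matrix_inv bb) *v u = be psi *s u"
    "(cb + matrix_inv cb) *v u = fk psi *s u" "(Lam + matrix_inv Lam) *v u = la psi *s u"
    if "psi \<in> iso_types T" "u \<in> Vtype psi" for psi u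
    unfolding defs inv al_def be_def la_def ck[OF that(1), symmetric]
    by (simp_all add: matrix_vector_mult_add_rdistrib type_sum_vec[OF star that] vec.scale_left_distrib)
  define R1 where "R1 = cmult (1 / (q + inverse q))
         ((ab + matrix_inv ab) ** (Lam + matrix_inv Lam) + (bb + matrix_inv bb) ** (cb + matrix_inv cb))"
  define R2 where "R2 = cmult (1 / (q + inverse q))
         ((bb + matrix_inv bb) ** (Lam + matrix_inv Lam) + (cb + matrix_inv cb) ** (ab + matrix_inv ab))"
  define R3 where "R3 = cmult (1 / (q + inverse q))
         ((cb + matrix_inv cb) ** (Lam + matrix_inv Lam) + (ab + matrix_inv ab) ** (bb + matrix_inv bb))"
  have scalar: "cmult (1 / z) (P ** Q + P' ** Q') *v u = ((f * g + f' * g') / z) *s u"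
    if "P *v u = f *s u" "Q *v u = g *s u" "P' *v u = f' *s u" "Q' *v u = g' *s u"
    for P Q P' Q' :: "'v cmat" and u f g f' g' z
    unfolding cmult_vec matrix_vector_mult_add_rdistrib mul_vec that mat_vec_scale
    by (simp add: vec_eq_iff algebra_simps add_divide_distrib)
  have R: "R1 *v u = ((al psi * la psi + be psi * fk psi) / (q + inverse q)) *s u"
    "R2 *v u = ((be psi * la psi + fk psi * al psi) / (q + inverse q)) *s u"
    "R3 *v u = ((fk psi * la psi + al psi * be psi) / (q + inverse q)) *s u"
    if "psi \<in> iso_types T" "u \<in> Vtype psi" for psi u
    unfolding R1_def R2_def R3_def by (rule scalar[OF S(1,4,2,3)[OF that]] scalar[OF S(2,4,3,1)[OF that]] scalar[OF S(3,4,1,2)[OF that]])+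
  have R3T: "R3 \<in> T"
    unfolding R3_def defs inv by (intro subalgD(2-4)[OF T] type_sum_in[OF star])
  define r where "r = 1 / (q^2 - inverse q ^ 2)"
  \<comment> \<open>Solved from the third equation, whose right-hand side lies in T because type
    sums do.\<close>
  define C where "C = R3 - cmult r (cmult q (Ab ** Bb) - cmult (inverse q) (Bb ** Ab))"
  have CT: "C \<in> T"
    unfolding C_def by (intro subalg_diff[OF T] subalgD(3,4)[OF T] R3T AbT BbT)
  have rel: "Ab *v u + r *s (q *s (Bb *v (C *v u)) - inverse q *s (C *v (Bb *v u)))
      = ((al psi * la psi + be psi * fk psi) / (q + inverse q)) *s u"
    "Bb *v u + r *s (q *s (C *v (Ab *v u)) - inverse q *s (Ab *v (C *v u)))
      = ((be psi * la psi + fk psi * al psi) / (q + inverse q)) *s u"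
    if psi: "psi \<in> iso_types T" and u: "u \<in> rep psi" for psi u
  proof -
    note irr = iso_types_mem(1)[OF psi iso_types_rep[OF psi]]
    have "C *v w = ((fk psi * la psi + al psi * be psi) / (q + inverse q)) *s w
        - r *s (q *s (Ab *v (Bb *v w)) - inverse q *s (Bb *v (Ab *v w)))" if "w \<in> rep psi" for w
    proof -
      have "w \<in> Vtype psi" using that iso_types_rep[OF psi] by (auto simp: Vtype_def intro: vec.span_base)
      then show ?thesis by (simp add: C_def matrix_vector_mult_diff_rdistrib R(3)[OF psi])
    qed
    then show "Ab *v u + r *s (q *s (Bb *v (C *v u)) - inverse q *s (C *v (Bb *v u)))
      = ((al psi * la psi + be psi * fk psi) / (q + inverse q)) *s u"
      "Bb *v u + r *s (q *s (C *v (Ab *v u)) - inverse q *s (Ab *v (C *v u)))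
      = ((be psi * la psi + fk psi * al psi) / (q + inverse q)) *s u"
      using module_relations[OF leo[OF irr], of "la psi" C u] u
      unfolding r_def fk_def al_def be_def la_def fa_def fb_def fL_def by blast+
  qed
  \<comment> \<open>M is compared with the scalar \<open>f psi\<close> first: their difference lies
    in T, so its vanishing on the representative spreads to the whole component.\<close>
  have lift: "M = N"
    if M: "M \<in> T" and N: "\<And>psi u. psi \<in> iso_types T \<Longrightarrow> u \<in> Vtype psi \<Longrightarrow> N *v u = f psi *s u"
      and MN: "\<And>psi u. psi \<in> iso_types T \<Longrightarrow> u \<in> rep psi \<Longrightarrow> M *v u = f psi *s u" for M N f
  proof (rule Vtype_ext[OF star])
    fix psi u assume psi: "psi \<in> iso_types T" and u: "u \<in> Vtype psi"
    have "(M - mat (f psi)) *v u = 0"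
      using MN[OF psi] by (intro annihilates_type[OF subalg_diff[OF T M subalg_mat[OF T]] psi _ u])
        (simp add: matrix_vector_mult_diff_rdistrib)
    then show "M *v u = N *v u" by (simp add: matrix_vector_mult_diff_rdistrib N[OF psi u])
  qed
  have eq1: "Ab + cmult r (cmult q (Bb ** C) - cmult (inverse q) (C ** Bb)) = R1"
  proof (rule lift[OF _ R(1)])
    show "Ab + cmult r (cmult q (Bb ** C) - cmult (inverse q) (C ** Bb)) \<in> T"
      by (intro subalgD(2-4)[OF T] subalg_diff[OF T] AbT BbT CT)
  qed (simp_all only: matrix_vector_mult_add_rdistrib matrix_vector_mult_diff_rdistrib cmult_vec mul_vec rel(1))
  have eq2: "Bb + cmult r (cmult q (C ** Ab) - cmult (inverse q) (Ab ** C)) = R2"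
  proof (rule lift[OF _ R(2)])
    show "Bb + cmult r (cmult q (C ** Ab) - cmult (inverse q) (Ab ** C)) \<in> T"
      by (intro subalgD(2-4)[OF T] subalg_diff[OF T] AbT BbT CT)
  qed (simp_all only: matrix_vector_mult_add_rdistrib matrix_vector_mult_diff_rdistrib cmult_vec mul_vec rel(2))
  show ?thesis
    unfolding R1_def[symmetric] R2_def[symmetric] R3_def[symmetric] r_def[symmetric]
  proof (rule ex1I[of _ C])
    show "C \<in> T \<and> Ab + cmult r (cmult q (Bb ** C) - cmult (inverse q) (C ** Bb)) = R1 \<and>
      Bb + cmult r (cmult q (C ** Ab) - cmult (inverse q) (Ab ** C)) = R2 \<and>
      C + cmult r (cmult q (Ab ** Bb) - cmult (inverse q) (Bb ** Ab)) = R3"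
      using CT eq1 eq2 by (simp add: C_def)
  qed (auto simp: C_def algebra_simps)
qed

end
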